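(* Let $p>1$, let $\gamma\ge0$ be real, let $\Omega\subset\mathbb{R}^{N+l}$ ($N+l\ge3$) be a bounded open domain, and let $f:\mathbb{R}^{N+l}\times\mathbb{R}\to\mathbb{R}$ be continuous with $F(z,u)=\int_0^u f(z,s)\,ds$. If $u\in W^{1,p}_{\lambda,0}(\Omega)\cap C^1(\Omega)$ is a (weak) solution of $$-\Delta_\gamma^p u=f(z,u)\ \text{ in }\Omega,\qquad u=0\ \text{ on }\partial\Omega,$$ then for any domain $D\subset\Omega$, with unit outward normal $\nu=(\nu_x,\nu_y)$ on $\partial D$ and $\nu_\gamma=(\nu_x,|x|^\gamma\nu_y)$, $u$ satisfies $$\frac1p\int_{\partial D}|\nabla_\gamma u|^p\nu_x^i\,dS-\int_{\partial D}|\nabla_\gamma u|^{p-2}\frac{\partial u}{\partial x_i}\langle\nabla_\gamma u,\nu_\gamma\rangle\,dS-\int_D|\nabla_\gamma u|^{p-2}\gamma|x|^{2(\gamma-1)}x_i|\nabla_y u|^2\,dz=\int_{\partial D}F(z,u)\nu_x^i\,dS-\int_D\frac{\partial F(z,u)}{\partial x_i}\,dz$$ for $i=1,\dots,N$, and $$\frac1p\int_{\partial D}|\nabla_\gamma u|^p\nu_y^j\,dS-\int_{\partial D}|\nabla_\gamma u|^{p-2}\frac{\partial u}{\partial y_j}\langle\nabla_\gamma u,\nu_\gamma\rangle\,dS=\int_{\partial D}F(z,u)\nu_y^j\,dS-\int_D\frac{\partial F(z,u)}{\partial y_j}\,dz$$ for $j=1,\dots,l$.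
   Context: Points of $\mathbb{R}^{N+l}$ are written $z=(x,y)=(x_1,\dots,x_N,y_1,\dots,y_l)$. The Grushin gradient is $\nabla_\gamma u=(\nabla_x u,\,|x|^\gamma\nabla_y u)$; the Grushin divergence of a vector field $(p_1,\dots,p_N,q_1,\dots,q_l)$ is $\mathrm{div}_\gamma=\sum_{i=1}^N\frac{\partial p_i}{\partial x_i}+|x|^\gamma\sum_{j=1}^l\frac{\partial q_j}{\partial y_j}$; and $\Delta_\gamma^p u=\mathrm{div}_\gamma(|\nabla_\gamma u|^{p-2}\nabla_\gamma u)$. For $p\ge1$, $$W^{1,p}_\lambda(\Omega)=\Big\{u\in L^p(\Omega): \tfrac{\partial u}{\partial x_i},\ |x|^\gamma\tfrac{\partial u}{\partial y_j}\in L^p(\Omega),\ i=1,\dots,N,\ j=1,\dots,l\Big\},$$ with norm $\|u\|_{W^{1,p}_\lambda(\Omega)}=\big(\int_\Omega|\nabla_\gamma u|^p+|u|^p\,dz\big)^{1/p}$, and $W^{1,p}_{\lambda,0}(\Omega)$ is the closure of $C_0^\infty(\Omega)$ in this norm. A function $u\in W^{1,p}_{\lambda,0}(\Omega)$ is a weak solution of the Dirichlet problem if $$\int_\Omega|\nabla_\gamma u|^{p-2}\nabla_\gamma u\cdot\nabla_\gamma\varphi\,dz=\int_\Omega f(z,u)\varphi\,dz\quad\text{for all }\varphi\in W^{1,p}_{\lambda,0}(\Omega).$$ The components of $\nu$ are $\nu_x=(\nu_x^1,\dots,\nu_x^N)$ and $\nu_y=(\nu_y^1,\dots,\nu_y^l)$.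 The symbol $\frac{\partial F(z,u)}{\partial x_i}$ is the partial derivative of $F$ in its explicit variable $x_i$ (second argument held fixed), evaluated at $(z,u(z))$; it is related to the total derivative $F_{x_i}(z,u)$ of $z\mapsto F(z,u(z))$ by $F_{x_i}(z,u)=\frac{\partial F(z,u)}{\partial x_i}+f(z,u)\frac{\partial u}{\partial x_i}$. The symbol $\frac{\partial F(z,u)}{\partial y_j}$ is understood in the same way.
   Formalization: Proved for domains D with C^1 boundary, with u and its gradient extending continuously to the closure of D (automatic if that lies in Ω), and assuming the partial derivatives of F in x_i, y_j exist at (z,u(z)) for z in D and are integrable over D; N and l are at least 1. *)

theory Defs
  imports "HOL-Analysis.Analysis"
begin

section \<open>Classical gradients and test functions\<close>

definition grad :: "('a::euclidean_space \<Rightarrow> real) \<Rightarrow> 'a \<Rightarrow> 'a" where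
  "grad f z = (\<Sum>b\<in>Basis. frechet_derivative f (at z) b *\<^sub>R b)"

primrec C_k :: "nat \<Rightarrow> ('a::euclidean_space \<Rightarrow> real) \<Rightarrow> bool" where
  "C_k 0 f \<longleftrightarrow> continuous_on UNIV f"
| "C_k (Suc k) f \<longleftrightarrow> (\<forall>z. f differentiable (at z)) \<and> (\<forall>b\<in>Basis. C_k k (\<lambda>z. grad f z \<bullet> b))"

text \<open>The elements of \<open>C\<^sub>0\<^sup>\<infinity>(\<Omega>)\<close> are taken to be defined on the whole space, extended by zero.\<close>

definition test_functions :: "'a::euclidean_space set \<Rightarrow> ('a \<Rightarrow> real) set" where
  "test_functions \<Omega> =
     {\<phi>. (\<forall>k. C_k k \<phi>) \<and> (\<exists>K. compact K \<and> K \<subseteq> \<Omega> \<and> (\<forall>z. z \<notin> K \<longrightarrow> \<phi> z = 0))}"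


section \<open>The Grushin gradient\<close>

text \<open>\<open>|x|\<^sup>\<gamma>\<close>, with \<open>|x|\<^sup>0 = 1\<close> also at \<open>x = 0\<close> (whereas \<open>0 powr 0 = 0\<close>). This matters
  on \<open>\<partial>D\<close>, which may contain an open piece of the hyperplane \<open>x = 0\<close> when \<open>N = 1\<close>.\<close>

definition grushin_weight :: "real \<Rightarrow> real ^ 'n \<Rightarrow> real" where
  "grushin_weight \<gamma> x = (if \<gamma> = 0 then 1 else norm x powr \<gamma>)"

text \<open>The map \<open>(a, b) \<mapsto> (a, |x|\<^sup>\<gamma> b)\<close> at the point \<open>z = (x, y)\<close>; it sends \<open>\<nabla>u\<close> to
  \<open>\<nabla>\<^sub>\<gamma>u\<close> and \<open>\<nu>\<close> to \<open>\<nu>\<^sub>\<gamma>\<close>.\<close>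

definition grushin ::
    "real \<Rightarrow> (real ^ 'n) \<times> (real ^ 'm) \<Rightarrow> (real ^ 'n) \<times> (real ^ 'm) \<Rightarrow> (real ^ 'n) \<times> (real ^ 'm)" where
  "grushin \<gamma> z v = (fst v, grushin_weight \<gamma> (fst z) *\<^sub>R snd v)"


section \<open>The spaces \<open>W\<^sup>1\<^sup>,\<^sup>p\<^sub>\<lambda>\<close> and \<open>W\<^sup>1\<^sup>,\<^sup>p\<^sub>\<lambda>\<^sub>,\<^sub>0\<close>\<close>

definition in_Lp :: "'a::euclidean_space set \<Rightarrow> real \<Rightarrow> ('a \<Rightarrow> real) \<Rightarrow> bool" where
  "in_Lp \<Omega> p g \<longleftrightarrow> set_borel_measurable lebesgue \<Omega> g
     \<and> set_integrable lebesgue \<Omega> (\<lambda>z. \<bar>g z\<bar> powr p)"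

definition has_weak_gradient ::
    "'a::euclidean_space set \<Rightarrow> ('a \<Rightarrow> real) \<Rightarrow> ('a \<Rightarrow> 'a) \<Rightarrow> bool" where
  "has_weak_gradient \<Omega> u G \<longleftrightarrow>
     (\<forall>K. compact K \<and> K \<subseteq> \<Omega> \<longrightarrow> set_integrable lebesgue K u \<and> set_integrable lebesgue K G) \<and>
     (\<forall>\<phi>\<in>test_functions \<Omega>.
        (LINT z:\<Omega>|lebesgue. u z *\<^sub>R grad \<phi> z) = - (LINT z:\<Omega>|lebesgue. \<phi> z *\<^sub>R G z))"

definition grushin_W ::
    "((real ^ 'n) \<times> (real ^ 'm)) set \<Rightarrow> real \<Rightarrow> real \<Rightarrow> ((real ^ 'n) \<times> (real ^ 'm) \<Rightarrow> real) set" where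
  "grushin_W \<Omega> \<gamma> p =
     {u. in_Lp \<Omega> p u \<and>
         (\<exists>G. has_weak_gradient \<Omega> u G \<and>
              (\<forall>i. in_Lp \<Omega> p (\<lambda>z. fst (G z) $ i)) \<and>
              (\<forall>j. in_Lp \<Omega> p (\<lambda>z. grushin_weight \<gamma> (fst z) * snd (G z) $ j)))}"

text \<open>The norm of \<open>u\<close>, computed from a representative \<open>G\<close> of its weak gradient; by almost
  everywhere uniqueness of weak gradients the choice of \<open>G\<close> is irrelevant.\<close>

definition grushin_W_norm ::
    "((real ^ 'n) \<times> (real ^ 'm)) set \<Rightarrow> real \<Rightarrow> real \<Rightarrow> ((real ^ 'n) \<times> (real ^ 'm) \<Rightarrow> real) \<Rightarrow>
     ((real ^ 'n) \<times> (real ^ 'm) \<Rightarrow> (real ^ 'n) \<times> (real ^ 'm)) \<Rightarrow> real" where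
  "grushin_W_norm \<Omega> \<gamma> p u G =
     (LINT z:\<Omega>|lebesgue. norm (grushin \<gamma> z (G z)) powr p + \<bar>u z\<bar> powr p) powr (1 / p)"

definition grushin_W0 ::
    "((real ^ 'n) \<times> (real ^ 'm)) set \<Rightarrow> real \<Rightarrow> real \<Rightarrow> ((real ^ 'n) \<times> (real ^ 'm) \<Rightarrow> real) set" where
  "grushin_W0 \<Omega> \<gamma> p =
     {u \<in> grushin_W \<Omega> \<gamma> p.
        \<exists>G \<phi>. has_weak_gradient \<Omega> u G \<and> (\<forall>n. \<phi> n \<in> test_functions \<Omega>) \<and>
          (\<lambda>n::nat. grushin_W_norm \<Omega> \<gamma> p (\<lambda>z. u z - \<phi> n z) (\<lambda>z. G z - grad (\<phi> n) z))
            \<longlonglongrightarrow> 0}"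


section \<open>Weak solutions of the Dirichlet problem\<close>

text \<open>\<open>U\<close> and \<open>\<Phi>\<close> range over the representatives of the weak gradients of \<open>u\<close> and \<open>\<phi>\<close>.
  The integrability clause says that the right-hand side exists as an integral, which would
  otherwise be \<open>0\<close> by convention; the left-hand side always exists, by Hoelder's inequality.\<close>

definition weak_solution ::
    "((real ^ 'n) \<times> (real ^ 'm)) set \<Rightarrow> real \<Rightarrow> real \<Rightarrow> ((real ^ 'n) \<times> (real ^ 'm) \<Rightarrow> real \<Rightarrow> real) \<Rightarrow>
     ((real ^ 'n) \<times> (real ^ 'm) \<Rightarrow> real) \<Rightarrow> bool" where
  "weak_solution \<Omega> \<gamma> p f u \<longleftrightarrow>
     u \<in> grushin_W0 \<Omega> \<gamma> p \<and>
     (\<forall>\<phi>\<in>grushin_W0 \<Omega> \<gamma> p. \<forall>U \<Phi>.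
        has_weak_gradient \<Omega> u U \<longrightarrow> has_weak_gradient \<Omega> \<phi> \<Phi> \<longrightarrow>
        set_integrable lebesgue \<Omega> (\<lambda>z. f z (u z) * \<phi> z) \<and>
        (LINT z:\<Omega>|lebesgue. norm (grushin \<gamma> z (U z)) powr (p - 2) *
            (grushin \<gamma> z (U z) \<bullet> grushin \<gamma> z (\<Phi> z)))
          = (LINT z:\<Omega>|lebesgue. f z (u z) * \<phi> z))"

text \<open>The primitive \<open>F(z, s)\<close>, an oriented integral from \<open>0\<close> to \<open>s\<close>.\<close>

definition primitive :: "('a \<Rightarrow> real \<Rightarrow> real) \<Rightarrow> 'a \<Rightarrow> real \<Rightarrow> real" where
  "primitive f z s = (LBINT t=ereal 0..ereal s. f z t)"

text \<open>Partial derivative in the direction \<open>b\<close> of the explicit variable \<open>z\<close>, with \<open>s\<close> held fixed.\<close>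

definition explicit_partial ::
    "'a::euclidean_space \<Rightarrow> ('a \<Rightarrow> real \<Rightarrow> real) \<Rightarrow> 'a \<Rightarrow> real \<Rightarrow> real" where
  "explicit_partial b F z s = deriv (\<lambda>t. F (z + t *\<^sub>R b) s) 0"


section \<open>Domains with \<open>C\<^sup>1\<close> boundary, outward normal, surface measure\<close>

text \<open>Inside \<open>U\<close>, the set \<open>D\<close> is the part below the graph of a \<open>C\<^sup>1\<close> function \<open>g\<close> over the
  hyperplane orthogonal to the unit vector \<open>e\<close>. A function on that hyperplane is encoded as a
  function on the whole space that is invariant under translations along \<open>e\<close>.\<close>

definition C1_chart ::
    "'a::euclidean_space set \<Rightarrow> 'a \<Rightarrow> ('a \<Rightarrow> real) \<Rightarrow> 'a set \<Rightarrow> bool" where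
  "C1_chart D e g U \<longleftrightarrow>
     norm e = 1 \<and> C_k 1 g \<and> (\<forall>z t. g (z + t *\<^sub>R e) = g z) \<and>
     open U \<and> D \<inter> U = {z\<in>U. z \<bullet> e < g z}"

definition C1_domain :: "'a::euclidean_space set \<Rightarrow> bool" where
  "C1_domain D \<longleftrightarrow>
     open D \<and> connected D \<and> D \<noteq> {} \<and> (\<forall>z\<in>frontier D. \<exists>e g U. C1_chart D e g U \<and> z \<in> U)"

text \<open>\<open>n\<close> is the unit outward normal at \<open>z \<in> \<partial>D\<close>: directions making an obtuse angle with \<open>n\<close>
  enter \<open>D\<close>, those making an acute angle leave it. At most one \<open>n\<close> has this property, and
  in a \<open>C1_chart\<close> it is \<open>(e - \<nabla>g) / |e - \<nabla>g|\<close>.\<close>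

definition outward_normal :: "'a::euclidean_space set \<Rightarrow> 'a \<Rightarrow> 'a \<Rightarrow> bool" where
  "outward_normal D z n \<longleftrightarrow>
     norm n = 1 \<and>
     (\<forall>v. v \<bullet> n < 0 \<longrightarrow> (\<forall>\<^sub>F t in at_right 0. z + t *\<^sub>R v \<in> D)) \<and>
     (\<forall>v. v \<bullet> n > 0 \<longrightarrow> (\<forall>\<^sub>F t in at_right 0. z + t *\<^sub>R v \<notin> D))"

text \<open>\<open>\<sigma>\<close> is the surface measure of the \<open>C\<^sup>1\<close> hypersurface \<open>\<partial>D\<close>: it is carried by \<open>\<partial>D\<close>, and in
  every chart it is given by the area element \<open>dS = sqrt (1 + |\<nabla>g|\<^sup>2) dz'\<close>, where \<open>z'\<close> runs
  through the hyperplane orthogonal to \<open>e\<close>. By the change of variables formula these local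
  prescriptions are compatible, so that for a \<open>C1_domain\<close> there is exactly one such \<open>\<sigma>\<close>.

  Integration over the hyperplane is expressed by integration over the slab \<open>0 \<le> z \<bullet> e \<le> 1\<close>,
  whose thickness is one, of a function not depending on \<open>z \<bullet> e\<close>. The point
  \<open>z + (g z - z \<bullet> e) e\<close> is the point of the graph on the line through \<open>z\<close> in direction \<open>e\<close>.\<close>

definition surface_measure :: "'a::euclidean_space set \<Rightarrow> 'a measure \<Rightarrow> bool" where
  "surface_measure D \<sigma> \<longleftrightarrow>
     sets \<sigma> = sets borel \<and> emeasure \<sigma> (- frontier D) = 0 \<and>
     (\<forall>e g U A. C1_chart D e g U \<longrightarrow> A \<in> sets borel \<longrightarrow> A \<subseteq> frontier D \<inter> U \<longrightarrow>
        emeasure \<sigma> A =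
          (\<integral>\<^sup>+ z\<in>{z. 0 \<le> z \<bullet> e \<and> z \<bullet> e \<le> 1 \<and> z + (g z - z \<bullet> e) *\<^sub>R e \<in> A}.
             ennreal (sqrt (1 + (norm (grad g z))\<^sup>2)) \<partial>lborel))"

end

theory Submission
  imports Defs
begin

text \<open>
  Put \<open>L(z, \<xi>) = |(\<xi>\<^sub>x, |x|\<^sup>\<gamma> \<xi>\<^sub>y)|\<^sup>p / p\<close>, so that the equation reads \<open>- div A(z, \<nabla>u) = f(z, u)\<close> with
  \<open>A = \<partial>L/\<partial>\<xi>\<close>. For a fixed coordinate direction \<open>e\<close> both identities say that the vector field
  \<open>Y = L(z, \<nabla>u) e - (\<partial>\<^sub>e u) A(z, \<nabla>u) - F(z, u) e\<close>, the \<open>e\<close>-row of the energy-momentum tensor, has flux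
  \<open>\<integral>\<^sub>D (\<partial>L/\<partial>e - \<partial>F/\<partial>e) dz\<close> through \<open>\<partial>D\<close>, where \<open>\<partial>/\<partial>e\<close> acts on the explicit variable \<open>z\<close> only. For smooth
  \<open>u\<close> this is the divergence theorem after multiplying the equation by \<open>\<partial>\<^sub>e u\<close>. Here \<open>u\<close> is only
  \<open>C\<^sup>1\<close>, so \<open>Y\<close> is merely continuous, and there are two things to prove: that \<open>Y\<close> has the expected
  distributional divergence, and that the divergence theorem holds for continuous fields of this kind.

  The divergence of \<open>Y\<close> comes from the convexity of \<open>L\<close> in \<open>\<xi>\<close>, without any second derivative of \<open>u\<close>
  (\<open>convex_stress_energy_identity\<close>). Test the weak equation with \<open>\<psi> (u(\<cdot> + h e) - u)\<close> for
  \<open>\<psi> \<ge> 0\<close>. Convexity bounds \<open>A(z, \<nabla>u) \<cdot> (\<nabla>u(z + h e) - \<nabla>u(z))\<close> from above by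
  \<open>L(z, \<nabla>u(z + h e)) - L(z, \<nabla>u(z))\<close>, and a translation moves the increment in the integral of the latter from \<open>u\<close> to
  \<open>\<psi>\<close> and to the explicit variable of \<open>L\<close>, which may be differentiated. Dividing by \<open>h\<close> and letting
  \<open>h\<close> tend to \<open>0\<close> from the right and from the left gives the two opposite inequalities. The test functions that arise are only
  \<open>C\<^sup>1\<close> of compact support; by mollification they belong to \<open>W\<^sup>1\<^sup>,\<^sup>p\<^sub>\<lambda>\<^sub>,\<^sub>0\<close>
  (\<open>C1_compact_in_grushin_W0\<close>). The weight \<open>|x|\<^sup>\<gamma>\<close> is not Lipschitz for \<open>0 < \<gamma> < 1\<close>, but its difference quotients in the
  direction of \<open>x\<^sub>i\<close> are dominated by the locally integrable function \<open>|x\<^sub>i|\<^sup>\<gamma>\<^sup>-\<^sup>1\<close>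
  (\<open>grushin_energy_x_domination\<close>). The term \<open>F(z, u(z))\<close> is differentiable at every point in the direction \<open>e\<close>, with
  integrable derivative, hence it can be integrated by parts on lines parallel to \<open>e\<close>
  (\<open>primitive_integration_by_parts\<close>).

  For the divergence theorem, let \<open>Y\<close> be continuous on the closure of \<open>D\<close> with integrable distributional divergence \<open>G\<close>.
  Below the graph of a \<open>C\<^sup>1\<close> function \<open>g\<close> one tests with a cutoff that vanishes up to depth \<open>\<epsilon>\<close> below the graph and equals \<open>1\<close>
  from depth \<open>2 \<epsilon>\<close> on. The gradient of the cutoff is concentrated in this layer, and the mean of \<open>Y \<cdot> (\<nabla>g - e)\<close> across the layer converges to its value on the graph
  (\<open>boundary_layer_limit\<close>), which is the surface integral of \<open>- Y \<cdot> \<nu>\<close>. A product of bump functions reduces the global statement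
  to charts (\<open>divergence_theorem\<close>).

  Integrals over the hyperplane orthogonal to \<open>e\<close> are always written as integrals over the slab \<open>0 \<le> z \<bullet> e \<le> 1\<close>. Fubini's theorem for
  this slicing (\<open>lborel_distr_slab\<close>) needs only the translation invariance of Lebesgue measure.
\<close>


section \<open>Integration along parallel lines\<close>

abbreviation slab :: "'a::euclidean_space \<Rightarrow> 'a set" where
  "slab e \<equiv> {z. 0 \<le> z \<bullet> e \<and> z \<bullet> e \<le> 1}"

lemma slab_measurable [measurable]: "slab e \<in> sets borel"
  by measurable

lemma borel_measurable_add_shift:
  "(\<lambda>x. fst x + snd x *\<^sub>R e) \<in> borel_measurable (lborel \<Otimes>\<^sub>M (lborel :: real measure))"
  for e :: "'a::euclidean_space"
  by measurable

text \<open>Every line parallel to \<open>e\<close> meets the slab in a segment of length one. So if \<open>z\<close> runs through the slab and \<open>t\<close>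
  through the reals, every point of the space is reached as \<open>z + t e\<close> with total weight one.\<close>

lemma lborel_distr_slab:
  fixes e :: "'a::euclidean_space"
  assumes e: "norm e = 1"
  shows "distr (density (lborel \<Otimes>\<^sub>M lborel) (\<lambda>(z, t). indicator (slab e) z)) borel (\<lambda>(z, t::real). z + t *\<^sub>R e)
    = (lborel :: 'a measure)"
proof (rule measure_eqI)
  fix A :: "'a set" assume "A \<in> sets (distr (density (lborel \<Otimes>\<^sub>M lborel) (\<lambda>(z, t). indicator (slab e) z)) borel (\<lambda>(z, t::real). z + t *\<^sub>R e))"
  then have A [measurable]: "A \<in> sets borel" by simp
  have ee: "e \<bullet> e = 1" using e by (simp add: norm_eq_1)
  have "emeasure (distr (density (lborel \<Otimes>\<^sub>M lborel) (\<lambda>(z, t). indicator (slab e) z)) borel (\<lambda>(z, t::real). z + t *\<^sub>R e)) A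
     = (\<integral>\<^sup>+x. indicator (slab e) (fst x) * indicator A (fst x + snd x *\<^sub>R e) \<partial>(lborel \<Otimes>\<^sub>M lborel))"
    using measurable_sets[OF borel_measurable_add_shift A, of e]
    by (subst emeasure_distr, measurable, simp, subst emeasure_density)
      (auto simp: space_pair_measure split_beta' intro!: nn_integral_cong split: split_indicator)
  also have "\<dots> = (\<integral>\<^sup>+t. \<integral>\<^sup>+z. indicator (slab e) z * indicator A (z + t *\<^sub>R e) \<partial>lborel \<partial>lborel)"
    by (subst lborel_pair.nn_integral_snd[symmetric]) (auto)
  also have "\<dots> = (\<integral>\<^sup>+t. \<integral>\<^sup>+z. indicator (slab e) (z - t *\<^sub>R e) * indicator A z \<partial>lborel \<partial>lborel)"
  proof (rule nn_integral_cong)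
    fix t :: real
    have "(\<integral>\<^sup>+z. indicator (slab e) (z - t *\<^sub>R e) * indicator A z \<partial>lborel)
      = (\<integral>\<^sup>+z. indicator (slab e) (z - t *\<^sub>R e) * indicator A z \<partial>(distr lborel borel ((+) (t *\<^sub>R e))))"
      by (simp add: lborel_distr_plus)
    also have "\<dots> = (\<integral>\<^sup>+z. indicator (slab e) z * indicator A (z + t *\<^sub>R e) \<partial>lborel)"
      by (subst nn_integral_distr) (auto simp: add.commute)
    finally show "(\<integral>\<^sup>+z. indicator (slab e) z * indicator A (z + t *\<^sub>R e) \<partial>lborel) =
      (\<integral>\<^sup>+z. indicator (slab e) (z - t *\<^sub>R e) * indicator A z \<partial>lborel)" by simp
  qed
  also have "\<dots> = (\<integral>\<^sup>+z. \<integral>\<^sup>+t. indicator (slab e) (z - t *\<^sub>R e) * indicator A z \<partial>lborel \<partial>lborel)"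
    by (rule lborel_pair.Fubini') measurable
  also have "\<dots> = (\<integral>\<^sup>+z. indicator A z \<partial>lborel)"
  proof (rule nn_integral_cong)
    fix z :: 'a
    have "(\<integral>\<^sup>+t. indicator (slab e) (z - t *\<^sub>R e) * indicator A z \<partial>lborel)
       = (\<integral>\<^sup>+t. indicator {z \<bullet> e - 1..z \<bullet> e} t * indicator A z \<partial>lborel)"
      by (intro nn_integral_cong) (auto split: split_indicator simp: inner_diff_left ee)
    also have "\<dots> = indicator A z"
      by (simp add: nn_integral_multc)
    finally show "(\<integral>\<^sup>+t. indicator (slab e) (z - t *\<^sub>R e) * indicator A z \<partial>lborel) = indicator A z" .
  qed
  finally show "emeasure (distr (density (lborel \<Otimes>\<^sub>M lborel) (\<lambda>(z, t). indicator (slab e) z)) borel (\<lambda>(z, t::real). z + t *\<^sub>R e)) A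
     = emeasure lborel A" by simp
qed simp

lemma nn_integral_slab:
  fixes e :: "'a::euclidean_space" and h :: "'a \<Rightarrow> ennreal"
  assumes e: "norm e = 1" and [measurable]: "h \<in> borel_measurable borel"
  shows "(\<integral>\<^sup>+z. h z \<partial>lborel) = (\<integral>\<^sup>+z\<in>slab e. (\<integral>\<^sup>+t. h (z + t *\<^sub>R e) \<partial>lborel) \<partial>lborel)"
proof -
  have "(\<integral>\<^sup>+z. h z \<partial>lborel) = (\<integral>\<^sup>+x. indicator (slab e) (fst x) * h (fst x + snd x *\<^sub>R e) \<partial>(lborel \<Otimes>\<^sub>M lborel))"
    by (subst lborel_distr_slab[OF e, symmetric], subst nn_integral_distr, measurable,
        subst nn_integral_density) (auto simp: split_beta')
  also have "\<dots> = (\<integral>\<^sup>+z. \<integral>\<^sup>+t. indicator (slab e) z * h (z + t *\<^sub>R e) \<partial>lborel \<partial>lborel)"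
    by (subst lborel.nn_integral_fst[symmetric]) auto
  also have "\<dots> = (\<integral>\<^sup>+z\<in>slab e. (\<integral>\<^sup>+t. h (z + t *\<^sub>R e) \<partial>lborel) \<partial>lborel)"
    by (intro nn_integral_cong, subst nn_integral_cmult) (auto simp: mult.commute)
  finally show ?thesis .
qed

lemma integral_slab:
  fixes e :: "'a::euclidean_space" and h :: "'a \<Rightarrow> real"
  assumes e: "norm e = 1" and h: "integrable lborel h"
  shows "AE z in lborel. z \<in> slab e \<longrightarrow> integrable lborel (\<lambda>t. h (z + t *\<^sub>R e))"
    and "(LINT z|lborel. h z) = (LINT z:slab e|lborel. (LINT t|lborel. h (z + t *\<^sub>R e)))"
proof -
  have [measurable]: "h \<in> borel_measurable borel" using h by auto
  have "integrable (distr (density (lborel \<Otimes>\<^sub>M lborel) (\<lambda>(z, t). indicator (slab e) z)) borel (\<lambda>(z, t::real). z + t *\<^sub>R e)) h"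
    using h by (simp add: lborel_distr_slab[OF e])
  then have "integrable (density (lborel \<Otimes>\<^sub>M lborel) (\<lambda>(z, t::real). ennreal (indicator (slab e) z))) (\<lambda>(z, t). h (z + t *\<^sub>R e))"
    by (subst (asm) integrable_distr_eq) (auto simp: split_beta' ennreal_indicator)
  then have int: "integrable (lborel \<Otimes>\<^sub>M lborel) (\<lambda>(z, t::real). indicator (slab e) z * h (z + t *\<^sub>R e))"
    unfolding split_beta' by (subst (asm) integrable_density) (auto simp: split_beta')
  show "AE z in lborel. z \<in> slab e \<longrightarrow> integrable lborel (\<lambda>t. h (z + t *\<^sub>R e))"
    using lborel_pair.AE_integrable_fst'[OF int] by eventually_elim auto
  have "(LINT z|lborel. h z) = (LINT x|(lborel \<Otimes>\<^sub>M lborel). indicator (slab e) (fst x) * h (fst x + snd x *\<^sub>R e))"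
    by (subst lborel_distr_slab[OF e, symmetric], subst integral_distr, measurable, unfold split_beta' ennreal_indicator[symmetric],
        subst integral_density) (auto simp: split_beta')
  also have "\<dots> = (LINT z|lborel. LINT t|lborel. indicator (slab e) z * h (z + t *\<^sub>R e))"
    using lborel_pair.integral_fst'[OF int] by (simp add: split_beta')
  finally show "(LINT z|lborel. h z) = (LINT z:slab e|lborel. (LINT t|lborel. h (z + t *\<^sub>R e)))"
    by (simp add: set_lebesgue_integral_def)
qed

text \<open>The derivative only has to exist at every point and to be integrable, so the fundamental theorem of calculus on
  almost every line is that of the Henstock-Kurzweil integral.\<close>

lemma integral_directional_derivative_eq_0:
  fixes e :: "'a::euclidean_space" and w w' :: "'a \<Rightarrow> real"
  assumes e: "norm e = 1"
    and w: "\<And>z. ((\<lambda>t. w (z + t *\<^sub>R e)) has_real_derivative w' z) (at 0)"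
    and w0: "bounded K" "\<And>z. z \<notin> K \<Longrightarrow> w z = 0"
    and w': "integrable lborel w'"
  shows "(LINT z|lborel. w' z) = 0"
proof -
  obtain R where R: "\<And>z. z \<in> K \<Longrightarrow> norm z < R" "R > 0"
    using w0(1) by (metis bounded_normE_less)
  have line: "(LINT t|lborel. w' (z + t *\<^sub>R e)) = 0" if int: "integrable lborel (\<lambda>t. w' (z + t *\<^sub>R e))" for z
  proof -
    define T where "T = R + norm z"
    have out: "w (z + t *\<^sub>R e) = 0" if "\<bar>t\<bar> \<ge> T" for t
    proof (rule w0(2), rule notI)
      assume "z + t *\<^sub>R e \<in> K"
      then have "norm (z + t *\<^sub>R e) < R" by (rule R)
      moreover have "\<bar>t\<bar> - norm z \<le> norm (z + t *\<^sub>R e)"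
        using norm_triangle_ineq2[of "t *\<^sub>R e" "- z"] e by (simp add: add.commute)
      ultimately show False using that by (simp add: T_def)
    qed
    have deriv: "((\<lambda>t. w (z + t *\<^sub>R e)) has_real_derivative w' (z + s *\<^sub>R e)) (at s)" for s
      using DERIV_shift[of "\<lambda>t. w (z + t *\<^sub>R e)" "w' (z + s *\<^sub>R e)" 0 s] w[of "z + s *\<^sub>R e"]
      by (simp add: algebra_simps scaleR_add_left)
    have T: "T > 0" using R by (auto simp: T_def intro: add_pos_nonneg)
    have w'0: "w' (z + t *\<^sub>R e) = 0" if "t \<notin> {-T..T}" for t
    proof -
      have "\<forall>\<^sub>F s in nhds t. w (z + s *\<^sub>R e) = 0"
      proof (rule eventually_nhds_in_open[THEN eventually_mono])
        show "open (- {-T..T})" "t \<in> - {-T..T}" using that by auto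
        show "w (z + s *\<^sub>R e) = 0" if "s \<in> - {-T..T}" for s using that T by (intro out) auto
      qed
      then have "((\<lambda>s. 0) has_real_derivative w' (z + t *\<^sub>R e)) (at t)"
        by (rule DERIV_cong_ev[OF refl _ refl, THEN iffD1, OF _ deriv])
      then show ?thesis by (rule DERIV_unique[OF _ DERIV_const])
    qed
    have "((\<lambda>t. w' (z + t *\<^sub>R e)) has_integral w (z + T *\<^sub>R e) - w (z + (-T) *\<^sub>R e)) {-T..T}"
      using T deriv by (intro fundamental_theorem_of_calculus)
        (auto simp: has_real_derivative_iff_has_vector_derivative[symmetric] intro: has_field_derivative_at_within)
    then have "((\<lambda>t. w' (z + t *\<^sub>R e)) has_integral 0) {-T..T}"
      using T out[of T] out[of "-T"] by simp
    then have "((\<lambda>t. w' (z + t *\<^sub>R e)) has_integral 0) UNIV"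
      by (rule has_integral_on_superset) (auto simp: w'0)
    then show ?thesis
      using has_integral_integral_lborel[OF int] has_integral_unique by blast
  qed
  have "(LINT z|lborel. w' z) = (LINT z:slab e|lborel. (LINT t|lborel. w' (z + t *\<^sub>R e)))"
    by (rule integral_slab(2)[OF e w'])
  also have "\<dots> = (LINT z:slab e|lborel. (0::real))"
    unfolding set_lebesgue_integral_def
  proof (rule integral_cong_AE)
    show "(\<lambda>x. indicat_real (slab e) x *\<^sub>R (LBINT t. w' (x + t *\<^sub>R e))) \<in> borel_measurable lborel"
      using w' by measurable
    show "AE z in lborel. indicat_real (slab e) z *\<^sub>R (LBINT t. w' (z + t *\<^sub>R e)) = indicat_real (slab e) z *\<^sub>R 0"
      using integral_slab(1)[OF e w'] by eventually_elim (auto simp: line indicator_def)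
  qed auto
  finally show ?thesis by (simp add: set_lebesgue_integral_def)
qed


section \<open>Continuously differentiable functions of compact support\<close>

lemma GDERIV_line:
  assumes "GDERIV w z :> W"
  shows "((\<lambda>t. w (z + t *\<^sub>R e)) has_real_derivative W \<bullet> e) (at 0)"
proof -
  have "(w has_derivative (\<lambda>h. h \<bullet> W)) (at (z + 0 *\<^sub>R e))"
    using assms by (simp add: gderiv_def)
  moreover have "((\<lambda>t. z + t *\<^sub>R e) has_derivative (\<lambda>t. t *\<^sub>R e)) (at 0)"
    by (auto intro!: derivative_eq_intros)
  ultimately have "((\<lambda>t. w (z + t *\<^sub>R e)) has_derivative (\<lambda>t. (t *\<^sub>R e) \<bullet> W)) (at 0)"
    by (rule has_derivative_compose[rotated])
  then show ?thesis by (simp add: has_field_derivative_def inner_commute[of e] mult_commute_abs)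
qed

lemma grad_eq:
  assumes "GDERIV f z :> D"
  shows "grad f z = D"
proof -
  have "frechet_derivative f (at z) = (\<lambda>h. h \<bullet> D)"
    using assms by (metis frechet_derivative_at gderiv_def)
  then show ?thesis
    by (simp add: grad_def inner_commute[of _ D] euclidean_representation)
qed

lemma GDERIV_grad:
  assumes "f differentiable (at z)"
  shows "GDERIV f z :> grad f z"
proof -
  have d: "(f has_derivative frechet_derivative f (at z)) (at z)"
    using assms by (simp add: frechet_derivative_works)
  interpret linear "frechet_derivative f (at z)"
    using has_derivative_linear[OF d] .
  have "frechet_derivative f (at z) = (\<lambda>h. h \<bullet> grad f z)"
  proof
    fix h
    have "frechet_derivative f (at z) h = frechet_derivative f (at z) (\<Sum>b\<in>Basis. (h \<bullet> b) *\<^sub>R b)"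
      by (simp add: euclidean_representation)
    also have "\<dots> = h \<bullet> grad f z"
      by (simp add: sum scale grad_def inner_sum_right mult.commute)
    finally show "frechet_derivative f (at z) h = h \<bullet> grad f z" .
  qed
  with d show ?thesis by (simp add: gderiv_def)
qed

lemma GDERIV_cong_open:
  assumes "open S" "z \<in> S" "\<And>x. x \<in> S \<Longrightarrow> f x = g x" "GDERIV g z :> D"
  shows "GDERIV f z :> D"
  using has_derivative_transform_within_open[OF assms(4)[unfolded gderiv_def] assms(1,2)] assms(3)
  unfolding gderiv_def by simp

lemma GDERIV_unique: "GDERIV f z :> D \<Longrightarrow> GDERIV f z :> D' \<Longrightarrow> D = D'"
  for z :: "'a::euclidean_space"
  by (drule grad_eq, drule grad_eq) simp

lemma GDERIV_imp_isCont: "GDERIV f z :> D \<Longrightarrow> isCont f z"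
  unfolding gderiv_def by (rule has_derivative_continuous)

text \<open>The gradient is a parameter, so that products, shifts and cutoffs carry along an explicit
  formula for it.\<close>

definition C1_compact :: "'a::euclidean_space set \<Rightarrow> ('a \<Rightarrow> real) \<Rightarrow> ('a \<Rightarrow> 'a) \<Rightarrow> bool" where
  "C1_compact S \<phi> \<Phi> \<longleftrightarrow> (\<forall>z. GDERIV \<phi> z :> \<Phi> z) \<and> continuous_on UNIV \<Phi> \<and>
     (\<exists>K. compact K \<and> K \<subseteq> S \<and> (\<forall>z. z \<notin> K \<longrightarrow> \<phi> z = 0))"

lemma C1_compactE:
  assumes "C1_compact S \<phi> \<Phi>"
  obtains K where "compact K" "K \<subseteq> S" "\<And>z. z \<notin> K \<Longrightarrow> \<phi> z = 0" "\<And>z. z \<notin> K \<Longrightarrow> \<Phi> z = 0"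
    "\<And>z. GDERIV \<phi> z :> \<Phi> z" "continuous_on UNIV \<phi>" "continuous_on UNIV \<Phi>"
proof -
  obtain K where K: "compact K" "K \<subseteq> S" "\<And>z. z \<notin> K \<Longrightarrow> \<phi> z = 0"
    using assms unfolding C1_compact_def by blast
  have d: "GDERIV \<phi> z :> \<Phi> z" for z using assms unfolding C1_compact_def by blast
  have \<Phi>0: "\<Phi> z = 0" if "z \<notin> K" for z
  proof (rule GDERIV_unique[OF d])
    show "GDERIV \<phi> z :> 0"
    proof (rule GDERIV_cong_open)
      show "open (- K)" using K(1) by (simp add: compact_imp_closed open_Compl)
      show "z \<in> - K" using that by simp
      show "\<phi> x = 0" if "x \<in> - K" for x using that K(3) by simp
    qed (rule GDERIV_const)
  qed
  have c: "continuous_on UNIV \<phi>"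
    using GDERIV_imp_isCont[OF d] by (intro continuous_at_imp_continuous_on) blast
  have c': "continuous_on UNIV \<Phi>" using assms unfolding C1_compact_def by blast
  show thesis by (rule that[OF K \<Phi>0 d c c'])
qed

lemma C1_compactI:
  assumes "\<And>z. GDERIV \<phi> z :> \<Phi> z" "continuous_on UNIV \<Phi>" "compact K" "K \<subseteq> S" "\<And>z. z \<notin> K \<Longrightarrow> \<phi> z = 0"
  shows "C1_compact S \<phi> \<Phi>"
  unfolding C1_compact_def using assms(3-5)
  by (intro conjI allI assms(1,2) exI[of _ K] impI)

lemma C1_compact_mono: "C1_compact S \<phi> \<Phi> \<Longrightarrow> S \<subseteq> T \<Longrightarrow> C1_compact T \<phi> \<Phi>"
  unfolding C1_compact_def by (elim conjE exE, intro conjI exI, assumption+, rule order_trans)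

lemma continuous_on_compact_support:
  fixes v :: "'a::t2_space \<Rightarrow> 'b::{topological_space, zero}"
  assumes "continuous_on \<Omega> v" "open \<Omega>" "compact K" "K \<subseteq> \<Omega>" "\<And>z. z \<notin> K \<Longrightarrow> v z = 0"
  shows "continuous_on UNIV v"
proof -
  have "continuous_on (- K) v"
    by (rule continuous_on_eq[OF continuous_on_const[of _ 0]]) (simp add: assms(5))
  moreover have "open (- K)" using assms(3) by (simp add: compact_imp_closed open_Compl)
  ultimately have "continuous_on (\<Omega> \<union> - K) v"
    using assms(1,2) by (intro continuous_on_open_Un)
  moreover have "\<Omega> \<union> - K = UNIV" using assms by auto
  ultimately show ?thesis by simp
qed

text \<open>Only \<open>\<phi>\<close> has compact support and \<open>\<psi>\<close> may be arbitrary outside \<open>S\<close>: the product is zero near every point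
  outside the support of \<open>\<phi>\<close>.\<close>

lemma C1_compact_mult:
  fixes \<phi> :: "'a::euclidean_space \<Rightarrow> real"
  assumes \<phi>: "C1_compact S \<phi> \<Phi>" and S: "open S"
    and \<psi>: "\<And>z. z \<in> S \<Longrightarrow> GDERIV \<psi> z :> \<Psi> z" "continuous_on S \<Psi>"
  shows "C1_compact S (\<lambda>z. \<phi> z * \<psi> z) (\<lambda>z. \<phi> z *\<^sub>R \<Psi> z + \<psi> z *\<^sub>R \<Phi> z)"
proof -
  obtain K where K: "compact K" "K \<subseteq> S" "\<And>z. z \<notin> K \<Longrightarrow> \<phi> z = 0" "\<And>z. z \<notin> K \<Longrightarrow> \<Phi> z = 0"
    "\<And>z. GDERIV \<phi> z :> \<Phi> z" "continuous_on UNIV \<phi>" "continuous_on UNIV \<Phi>"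
    by (rule C1_compactE[OF \<phi>]) (rule that)
  have \<psi>c: "continuous_on S \<psi>"
    by (intro continuous_at_imp_continuous_on ballI GDERIV_imp_isCont[OF \<psi>(1)])
  have "continuous_on UNIV (\<lambda>z. \<phi> z *\<^sub>R \<Psi> z + \<psi> z *\<^sub>R \<Phi> z)"
  proof (rule continuous_on_compact_support[OF _ S K(1,2)])
    show "continuous_on S (\<lambda>z. \<phi> z *\<^sub>R \<Psi> z + \<psi> z *\<^sub>R \<Phi> z)"
      by (intro continuous_intros \<psi>(2) \<psi>c continuous_on_subset[OF K(6)] continuous_on_subset[OF K(7)]) auto
    show "\<phi> z *\<^sub>R \<Psi> z + \<psi> z *\<^sub>R \<Phi> z = 0" if "z \<notin> K" for z using K(3,4)[OF that] by simp
  qed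
  moreover have "GDERIV (\<lambda>z. \<phi> z * \<psi> z) z :> \<phi> z *\<^sub>R \<Psi> z + \<psi> z *\<^sub>R \<Phi> z" for z
  proof (cases "z \<in> S")
    case True
    then show ?thesis by (intro GDERIV_mult K(5) \<psi>(1))
  next
    case False
    then have z: "z \<notin> K" using K(2) by blast
    have "GDERIV (\<lambda>z. \<phi> z * \<psi> z) z :> 0"
    proof (rule GDERIV_cong_open)
      show "open (- K)" using K(1) by (simp add: compact_imp_closed open_Compl)
      show "z \<in> - K" using z by simp
      show "\<phi> x * \<psi> x = 0" if "x \<in> - K" for x using that K(3) by simp
    qed (rule GDERIV_const)
    then show ?thesis using K(3,4)[OF z] by simp
  qed
  moreover have "\<phi> z * \<psi> z = 0" if "z \<notin> K" for z using K(3) that by simp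
  ultimately show ?thesis
    by (intro C1_compactI[OF _ _ K(1,2)])
qed

lemma integrable_compact_support:
  fixes v :: "'a::euclidean_space \<Rightarrow> 'b::{banach, second_countable_topology}"
  assumes "continuous_on UNIV v" "compact K" "\<And>z. z \<notin> K \<Longrightarrow> v z = 0"
  shows "integrable lborel v"
proof -
  have "integrable lborel (\<lambda>x. indicator K x *\<^sub>R v x)"
    by (intro borel_integrable_compact assms(2) continuous_on_subset[OF assms(1)]) simp
  moreover have "(\<lambda>x. indicator K x *\<^sub>R v x) = v" using assms by (auto simp: indicator_def)
  ultimately show ?thesis by simp
qed

lemma bounded_compact_support:
  fixes v :: "'a::euclidean_space \<Rightarrow> 'b::real_normed_vector"
  assumes "continuous_on UNIV v" "compact K" "\<And>z. z \<notin> K \<Longrightarrow> v z = 0"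
  obtains B where "B > 0" "\<And>z. norm (v z) \<le> B"
proof -
  have "bounded (v ` K)"
    by (intro compact_imp_bounded compact_continuous_image assms(2) continuous_on_subset[OF assms(1)]) simp
  then obtain B where B: "B > 0" "\<And>z. z \<in> K \<Longrightarrow> norm (v z) \<le> B" by (auto simp: bounded_pos)
  show thesis
  proof (rule that[OF B(1)])
    show "norm (v z) \<le> B" for z
      using B assms(3)[of z] by (cases "z \<in> K") auto
  qed
qed

lemma uniformly_continuous_compact_support:
  fixes v :: "'a::euclidean_space \<Rightarrow> 'b::real_normed_vector"
  assumes "continuous_on UNIV v" "compact K" "\<And>z. z \<notin> K \<Longrightarrow> v z = 0"
  shows "uniformly_continuous_on UNIV v"
  unfolding uniformly_continuous_on_def
proof (intro allI impI)
  fix \<epsilon> :: real assume "\<epsilon> > 0"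
  obtain R where R: "K \<subseteq> cball 0 R" using bounded_subset_ballD[OF compact_imp_bounded[OF assms(2)], of 0] ball_subset_cball by (meson order_trans)
  have "uniformly_continuous_on (cball 0 (R + 1)) v"
    by (intro compact_uniformly_continuous continuous_on_subset[OF assms(1)]) auto
  then obtain \<delta> where \<delta>: "\<delta> > 0" "\<And>x y. x \<in> cball 0 (R+1) \<Longrightarrow> y \<in> cball 0 (R+1) \<Longrightarrow> dist y x < \<delta> \<Longrightarrow> dist (v y) (v x) < \<epsilon>"
    using \<open>\<epsilon> > 0\<close> unfolding uniformly_continuous_on_def by metis
  have "dist (v y) (v x) < \<epsilon>" if "dist y x < min \<delta> 1" for x y
  proof (cases "x \<in> cball 0 R \<or> y \<in> cball 0 R")
    case True
    have "dist 0 y \<le> dist 0 x + dist y x" "dist 0 x \<le> dist 0 y + dist y x"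
      using dist_triangle[of 0 y x] dist_triangle[of 0 x y] by (auto simp: dist_commute)
    with True that have "x \<in> cball 0 (R+1)" "y \<in> cball 0 (R+1)"
      by auto
    then show ?thesis using \<delta> that by auto
  next
    case False
    then have "x \<notin> K" "y \<notin> K" using R by auto
    then have "v x = 0" "v y = 0" by (auto simp: assms(3))
    then show ?thesis using \<open>\<epsilon> > 0\<close> by simp
  qed
  then show "\<exists>d>0. \<forall>x\<in>UNIV. \<forall>x'\<in>UNIV. dist x' x < d \<longrightarrow> dist (v x') (v x) < \<epsilon>"
    using \<delta>(1) by (intro exI[of _ "min \<delta> 1"] conjI ballI impI) simp_all
qed

lemma integral_gradient_eq_0:
  fixes \<phi> :: "'a::euclidean_space \<Rightarrow> real"
  assumes \<phi>: "C1_compact S \<phi> \<Phi>"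
  shows "(LINT z|lborel. \<Phi> z) = 0"
proof (rule euclidean_eqI)
  fix b :: 'a assume b: "b \<in> Basis"
  obtain K where K: "compact K" "K \<subseteq> S" "\<And>z. z \<notin> K \<Longrightarrow> \<phi> z = 0" "\<And>z. z \<notin> K \<Longrightarrow> \<Phi> z = 0"
    "\<And>z. GDERIV \<phi> z :> \<Phi> z" "continuous_on UNIV \<phi>" "continuous_on UNIV \<Phi>"
    by (rule C1_compactE[OF \<phi>]) (rule that)
  have int: "integrable lborel \<Phi>" by (rule integrable_compact_support[OF K(7,1,4)])
  then have "(LINT z|lborel. \<Phi> z \<bullet> b) = 0"
    by (intro integral_directional_derivative_eq_0[OF norm_Basis[OF b] GDERIV_line[OF K(5)] compact_imp_bounded[OF K(1)] K(3)])
      auto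
  then show "(LINT z|lborel. \<Phi> z) \<bullet> b = 0 \<bullet> b" using int by simp
qed


section \<open>Smooth bump functions\<close>

lemma C_k_SucI:
  assumes "\<And>z. GDERIV f z :> G z" "\<And>b. b \<in> Basis \<Longrightarrow> C_k k (\<lambda>z. G z \<bullet> b)"
  shows "C_k (Suc k) f"
  using assms by (auto simp: grad_eq[OF assms(1)] gderiv_def differentiable_def)

lemma C_k_SucD:
  assumes "C_k (Suc k) f"
  shows "GDERIV f z :> grad f z" "b \<in> Basis \<Longrightarrow> C_k k (\<lambda>z. grad f z \<bullet> b)"
  using assms GDERIV_grad by auto

lemma C_k_Suc_imp: "C_k (Suc k) f \<Longrightarrow> C_k k f"
proof (induction k arbitrary: f)
  case 0
  then show ?case
    by (auto intro!: continuous_at_imp_continuous_on differentiable_imp_continuous_within)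
next
  case (Suc k)
  show ?case
    using C_k_SucD[OF Suc.prems] Suc.IH by (intro C_k_SucI) auto
qed

lemma C_k_const: "C_k k (\<lambda>z. c)"
proof (induction k arbitrary: c)
  case (Suc k)
  show ?case using Suc[of 0] by (intro C_k_SucI[where G="\<lambda>z. 0"] GDERIV_const) auto
qed auto

lemma C_k_add: "C_k k f \<Longrightarrow> C_k k g \<Longrightarrow> C_k k (\<lambda>z. f z + g z)"
proof (induction k arbitrary: f g)
  case (Suc k)
  show ?case
    using C_k_SucD[OF Suc.prems(1)] C_k_SucD[OF Suc.prems(2)] Suc.IH
    by (intro C_k_SucI[where G="\<lambda>z. grad f z + grad g z"] GDERIV_add) (auto simp: inner_add_left)
qed (auto intro: continuous_intros)

lemma C_k_mult: "C_k k f \<Longrightarrow> C_k k g \<Longrightarrow> C_k k (\<lambda>z. f z * g z)"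
proof (induction k arbitrary: f g)
  case (Suc k)
  show ?case
    using C_k_SucD[OF Suc.prems(1)] C_k_SucD[OF Suc.prems(2)] Suc.IH Suc.prems[THEN C_k_Suc_imp]
    by (intro C_k_SucI[where G="\<lambda>z. f z *\<^sub>R grad g z + g z *\<^sub>R grad f z"] GDERIV_mult)
      (auto simp: inner_add_left intro!: C_k_add)
qed (auto intro: continuous_intros)

lemma C_k_inner: "C_k k (\<lambda>z. z \<bullet> a)"
proof (cases k)
  case (Suc k')
  show ?thesis unfolding Suc
    by (rule C_k_SucI[where G="\<lambda>z. a"]) (auto simp: gderiv_def C_k_const intro!: derivative_eq_intros)
qed (auto intro: continuous_intros)

text \<open>For \<open>j = 0\<close> this is the usual flat function. The powers of \<open>1 / t\<close> make the family closed under
  differentiation, which turns smoothness into an induction over all \<open>j\<close> at once.\<close>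

definition flat :: "nat \<Rightarrow> real \<Rightarrow> real" where
  "flat j t = (if t \<le> 0 then 0 else (1 / t) ^ j * exp (- 1 / t))"

lemma flat_tendsto_0: "(flat j \<longlongrightarrow> 0) (at 0)"
proof -
  have "((\<lambda>t. (1 / t) ^ j / exp (1 / t)) \<longlongrightarrow> 0) (at_right (0::real))"
    by (rule filterlim_compose[OF tendsto_power_div_exp_0])
      (simp add: divide_inverse filterlim_inverse_at_top_right)
  then have "(flat j \<longlongrightarrow> 0) (at_right 0)"
    by (rule Lim_transform_eventually)
      (auto simp: flat_def exp_minus field_simps eventually_at_right_less intro!: eventually_at_rightI[of 0 1])
  moreover have "(flat j \<longlongrightarrow> 0) (at_left 0)"
    by (rule Lim_transform_eventually[OF tendsto_const])
       (auto simp: flat_def intro!: eventually_at_leftI[of "-1" 0])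
  ultimately show ?thesis by (simp add: filterlim_at_split)
qed

lemma flat_deriv: "(flat j has_real_derivative flat (j + 2) t - j * flat (j + 1) t) (at t)"
proof -
  consider "t > 0" | "t < 0" | "t = 0" by linarith
  then show ?thesis
  proof cases
    case 1
    have "((\<lambda>t. inverse t ^ j * exp (- inverse t)) has_real_derivative
       of_nat j * (inverse t ^ (j - 1) * - (inverse t ^ 2)) * exp (- inverse t) + inverse t ^ j * (exp (- inverse t) * inverse t ^ 2)) (at t)"
      using 1 by (auto intro!: derivative_eq_intros simp: power2_eq_square)
    moreover have "of_nat j * (inverse t ^ (j - 1) * - (inverse t ^ 2)) * exp (- inverse t) + inverse t ^ j * (exp (- inverse t) * inverse t ^ 2)
      = flat (j + 2) t - j * flat (j + 1) t"
      using 1 by (cases j) (auto simp: flat_def divide_inverse power2_eq_square algebra_simps)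
    ultimately have "((\<lambda>t. inverse t ^ j * exp (- inverse t)) has_real_derivative flat (j + 2) t - j * flat (j + 1) t) (at t)"
      by simp
    then show ?thesis
      by (rule has_field_derivative_transform_within_open[where S="{0<..}"]) (use 1 in \<open>auto simp: flat_def divide_inverse\<close>)
  next
    case 2
    have "((\<lambda>t. 0) has_real_derivative 0) (at t)" by simp
    then have "(flat j has_real_derivative 0) (at t)"
      by (rule has_field_derivative_transform_within_open[where S="{..<0}"]) (use 2 in \<open>auto simp: flat_def\<close>)
    then show ?thesis using 2 by (simp add: flat_def)
  next
    case 3
    have "((\<lambda>h. (flat j (0 + h) - flat j 0) / h) \<longlongrightarrow> 0) (at 0)"
      using flat_tendsto_0[of "Suc j"] by (rule Lim_transform_eventually)
        (auto simp: flat_def eventually_at_filter)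
    then show ?thesis using 3 by (simp add: DERIV_def flat_def)
  qed
qed

lemma flat_continuous: "continuous_on UNIV (flat j)"
  using flat_deriv by (auto intro!: continuous_at_imp_continuous_on DERIV_isCont)

definition bump :: "real \<Rightarrow> 'a::euclidean_space \<Rightarrow> real" where
  "bump r z = flat 0 (r\<^sup>2 - z \<bullet> z)"

lemma C_k_flat: "C_k k (\<lambda>z::'a::euclidean_space. flat j (c - z \<bullet> z))"
proof (induction k arbitrary: j)
  case 0
  show ?case by (auto intro!: continuous_on_compose2[OF flat_continuous] continuous_intros)
next
  case (Suc k)
  show ?case
  proof (rule C_k_SucI)
    fix z :: 'a
    have "GDERIV (\<lambda>z::'a. c - z \<bullet> z) z :> - 2 *\<^sub>R z"
      unfolding gderiv_def by (auto intro!: derivative_eq_intros simp: inner_commute)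
    then show "GDERIV (\<lambda>z. flat j (c - z \<bullet> z)) z :>
       (flat (j + 2) (c - z \<bullet> z) - j * flat (j + 1) (c - z \<bullet> z)) *\<^sub>R (- 2 *\<^sub>R z)"
      by (rule GDERIV_DERIV_compose[OF _ flat_deriv])
  next
    fix b :: 'a
    have "C_k k (\<lambda>z::'a. (flat (j + 2) (c - z \<bullet> z) + (- j) * flat (j + 1) (c - z \<bullet> z)) * (-2 * (z \<bullet> b)))"
      by (intro C_k_mult C_k_add C_k_const C_k_inner Suc)
    then show "C_k k (\<lambda>z::'a. (flat (j + 2) (c - z \<bullet> z) - j * flat (j + 1) (c - z \<bullet> z)) *\<^sub>R (- 2 *\<^sub>R z) \<bullet> b)"
      by (simp add: algebra_simps)
  qed
qed

lemma bump:
  fixes z :: "'a::euclidean_space"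
  shows "C_k k (bump r :: 'a \<Rightarrow> real)" "bump r z \<ge> 0" "r > 0 \<Longrightarrow> norm z \<ge> r \<Longrightarrow> bump r z = 0"
    "r > 0 \<Longrightarrow> bump r (0::'a) > 0" "continuous_on UNIV (bump r :: 'a \<Rightarrow> real)"
    "bump r (- z) = bump r z"
proof -
  show "C_k k (bump r :: 'a \<Rightarrow> real)" for k using C_k_flat by (simp add: bump_def[abs_def])
  from this[of 0] show "continuous_on UNIV (bump r :: 'a \<Rightarrow> real)" by simp
  show "bump r z \<ge> 0" "r > 0 \<Longrightarrow> bump r (0::'a) > 0" "bump r (- z) = bump r z"
    by (auto simp: bump_def flat_def)
  show "bump r z = 0" if "r > 0" "norm z \<ge> r"
  proof -
    have "r\<^sup>2 \<le> (norm z)\<^sup>2" using that by (intro power_mono) auto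
    then show ?thesis by (simp add: bump_def flat_def power2_norm_eq_inner)
  qed
qed


section \<open>Mollification\<close>

definition conv :: "('a::euclidean_space \<Rightarrow> real) \<Rightarrow> ('a \<Rightarrow> real) \<Rightarrow> 'a \<Rightarrow> real" where
  "conv f g z = (LINT y|lborel. f y * g (z - y))"

lemma conv_commute:
  assumes [measurable]: "f \<in> borel_measurable borel" "g \<in> borel_measurable borel"
  shows "conv f g = conv g f"
proof
  fix z :: 'a
  have "(LINT y|lborel. f y * g (z - y)) = (LINT y|distr lborel borel (\<lambda>y. z - y). f y * g (z - y))"
    using lborel_affine[of "-1" z] by (simp add: density_1)
  also have "\<dots> = (LINT y|lborel. f (z - y) * g (z - (z - y)))"
    by (rule integral_distr) auto
  finally show "conv f g z = conv g f z" by (simp add: conv_def mult.commute)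
qed

lemma compact_support_integral_cbox:
  fixes v :: "'a::euclidean_space \<Rightarrow> 'b::euclidean_space"
  assumes "continuous_on UNIV v" "K \<subseteq> cbox a b" "\<And>z. z \<notin> K \<Longrightarrow> v z = 0"
  shows "(LINT y|lborel. v y) = integral (cbox a b) v"
proof -
  have v0: "v z = 0" if "z \<notin> cbox a b" for z using that assms(2,3) by blast
  have "integrable lborel v"
    by (rule integrable_compact_support[OF assms(1) compact_cbox v0])
  then have "(LINT y|lborel. v y) = integral UNIV v" by (simp add: integral_lborel)
  also have "\<dots> = integral UNIV (\<lambda>x. if x \<in> cbox a b then v x else 0)"
    using v0 by (intro arg_cong[of _ _ "integral UNIV"]) auto
  finally show ?thesis by (simp add: integral_restrict_UNIV)
qed

context
  fixes f :: "'a::euclidean_space \<Rightarrow> real" and K a b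
  assumes f: "continuous_on UNIV f" "K \<subseteq> cbox a b" "\<And>z. z \<notin> K \<Longrightarrow> f z = 0"
begin

lemma conv_integral:
  fixes h :: "'a \<Rightarrow> 'b::euclidean_space"
  assumes "continuous_on UNIV h"
  shows "(LINT y|lborel. f y *\<^sub>R h (z - y)) = integral (cbox a b) (\<lambda>y. f y *\<^sub>R h (z - y))"
    and "(\<lambda>y. f y *\<^sub>R h (z - y)) integrable_on cbox a b"
    "integrable lborel (\<lambda>y. f y *\<^sub>R h (z - y))"
proof -
  have c: "continuous_on UNIV (\<lambda>y. f y *\<^sub>R h (z - y))"
    using f(1) by (intro continuous_intros continuous_on_compose2[OF assms]) auto
  have v0: "f y *\<^sub>R h (z - y) = 0" if "y \<notin> K" for y using f(3)[OF that] by simp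
  show "(LINT y|lborel. f y *\<^sub>R h (z - y)) = integral (cbox a b) (\<lambda>y. f y *\<^sub>R h (z - y))"
    by (rule compact_support_integral_cbox[OF c f(2) v0])
  show "(\<lambda>y. f y *\<^sub>R h (z - y)) integrable_on cbox a b"
    by (rule integrable_continuous, rule continuous_on_subset[OF c]) simp
  show "integrable lborel (\<lambda>y. f y *\<^sub>R h (z - y))"
    by (rule integrable_compact_support[OF c compact_cbox[of a b]]) (use v0 f(2) in blast)
qed

lemma conv_continuous:
  assumes "continuous_on UNIV g"
  shows "continuous_on UNIV (conv f g)"
proof -
  have "continuous_on UNIV (\<lambda>z. integral (cbox a b) (\<lambda>y. f y * g (z - y)))"
    using f(1) unfolding split_beta'
    by (intro integral_continuous_on_param)
      (auto simp: split_beta' intro!: continuous_intros continuous_on_compose2[OF assms] continuous_on_compose2[OF f(1)])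
  also have "(\<lambda>z. integral (cbox a b) (\<lambda>y. f y * g (z - y))) = conv f g"
    using conv_integral(1)[OF assms] by (auto simp: conv_def fun_eq_iff)
  finally show ?thesis .
qed

text \<open>Either factor of a convolution may carry the derivative; together with commutativity this serves both for the smoothness of
  mollifications (the bump is differentiated) and for their convergence in \<open>C\<^sup>1\<close> (the function is differentiated).\<close>

lemma conv_GDERIV:
  assumes g: "\<And>z. GDERIV g z :> G z" "continuous_on UNIV G"
  shows "GDERIV (conv f g) z :> (LINT y|lborel. f y *\<^sub>R G (z - y))"
proof -
  have cg: "continuous_on UNIV g"
    using GDERIV_imp_isCont[OF g(1)] by (intro continuous_at_imp_continuous_on) blast
  have "((\<lambda>z. integral (cbox a b) (\<lambda>y. f y * g (z - y))) has_derivative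
      integral (cbox a b) (\<lambda>y. f y *\<^sub>R blinfun_inner_left (G (z - y)))) (at z within UNIV)"
  proof (rule leibniz_rule)
    fix x t
    have "(g has_derivative (\<lambda>h. h \<bullet> G (x - t))) (at (x - t))" using g(1) by (simp add: gderiv_def)
    then have "((\<lambda>x. g (x - t)) has_derivative (\<lambda>h. h \<bullet> G (x - t))) (at x)"
      by (rule has_derivative_compose[rotated]) (auto intro!: derivative_eq_intros)
    then show "((\<lambda>x. f t * g (x - t)) has_derivative blinfun_apply (f t *\<^sub>R blinfun_inner_left (G (x - t)))) (at x within UNIV)"
      by (auto intro!: derivative_eq_intros simp: blinfun.bilinear_simps mult.commute)
  next
    show "(\<lambda>y. f y * g (x - y)) integrable_on cbox a b" for x
      using conv_integral(2)[OF cg] by simp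
    show "continuous_on (UNIV \<times> cbox a b) (\<lambda>(x, t). f t *\<^sub>R blinfun_inner_left (G (x - t)))"
      by (auto simp: split_beta' intro!: continuous_intros continuous_on_compose2[OF g(2)] continuous_on_compose2[OF f(1)])
  qed auto
  also have "(\<lambda>z. integral (cbox a b) (\<lambda>y. f y * g (z - y))) = conv f g"
    using conv_integral(1)[OF cg] by (auto simp: conv_def fun_eq_iff)
  also have "integral (cbox a b) (\<lambda>y. f y *\<^sub>R blinfun_inner_left (G (z - y))) = blinfun_inner_left (LINT y|lborel. f y *\<^sub>R G (z - y))"
    unfolding conv_integral(1)[OF g(2)]
    by (subst integral_linear[OF conv_integral(2)[OF g(2)] bounded_linear_blinfun_inner_left, symmetric])
      (simp add: o_def linear_scale[OF bounded_linear.linear[OF bounded_linear_blinfun_inner_left]])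
  finally show ?thesis by (simp add: gderiv_def blinfun_inner_left.rep_eq)
qed

lemma C_k_conv: "C_k k g \<Longrightarrow> C_k k (conv f g)"
proof (induction k arbitrary: g)
  case 0
  then show ?case using conv_continuous by simp
next
  case (Suc k)
  have gb: "continuous_on UNIV (\<lambda>z. grad g z \<bullet> b)" if "b \<in> Basis" for b
  proof -
    have "C_k k' h \<Longrightarrow> C_k 0 h" for k' and h :: "'a \<Rightarrow> real"
      by (induction k') (blast, metis C_k_Suc_imp)
    from this[OF C_k_SucD(2)[OF Suc.prems that]] show ?thesis by simp
  qed
  have cG: "continuous_on UNIV (grad g)"
    by (subst continuous_on_componentwise) (use gb in blast)
  show ?case
  proof (rule C_k_SucI)
    show "GDERIV (conv f g) z :> (LINT y|lborel. f y *\<^sub>R grad g (z - y))" for z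
      by (rule conv_GDERIV[OF C_k_SucD(1)[OF Suc.prems] cG])
  next
    fix b :: 'a assume b: "b \<in> Basis"
    have "(\<lambda>z. (LINT y|lborel. f y *\<^sub>R grad g (z - y)) \<bullet> b) = conv f (\<lambda>z. grad g z \<bullet> b)"
      using conv_integral(3)[OF cG] by (auto simp: conv_def fun_eq_iff simp flip: integral_inner_left)
    then show "C_k k (\<lambda>z. (LINT y|lborel. f y *\<^sub>R grad g (z - y)) \<bullet> b)"
      using Suc.IH C_k_SucD(2)[OF Suc.prems b] by simp
  qed
qed

end

lemma integral_bump_pos:
  assumes "r > 0"
  shows "(LINT z|lborel. bump r (z::'a::euclidean_space)) > 0"
proof -
  have int: "integrable lborel (bump r :: 'a \<Rightarrow> real)"
    by (rule integrable_compact_support[OF bump(5), of "cball 0 r"]) (auto intro!: bump(3)[OF assms])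
  have "(LINT z|lborel. bump r (z::'a)) \<noteq> 0"
  proof
    assume "(LINT z|lborel. bump r (z::'a)) = 0"
    then have "AE z::'a in lborel. bump r z = 0"
      using int bump(2) by (subst (asm) integral_nonneg_eq_0_iff_AE) auto
    then have "AE z::'a in lebesgue. bump r z = 0" by (rule AE_completion)
    then have ae: "AE z::'a in lebesgue. z \<notin> {z. bump r z \<noteq> 0}" by simp
    have op: "open {z::'a. bump r z \<noteq> 0}"
      using bump(5) by (intro open_Collect_neq) auto
    then have "{z::'a. bump r z \<noteq> 0} \<in> sets lebesgue" by (simp add: borel_open)
    with ae have "negligible {z::'a. bump r z \<noteq> 0}"
      unfolding negligible_iff_null_sets by (subst AE_iff_null_sets)
    moreover note op
    moreover have "(0::'a) \<in> {z. bump r z \<noteq> 0}" using bump(4)[OF assms, where 'a='a] by simp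
    ultimately show False using open_not_negligible by blast
  qed
  moreover have "(LINT z|lborel. bump r (z::'a)) \<ge> 0" by (intro integral_nonneg_AE) (auto simp: bump)
  ultimately show ?thesis by linarith
qed

lemma bump_average:
  fixes h :: "'a::euclidean_space \<Rightarrow> 'b::euclidean_space"
  assumes "r > 0" "continuous_on UNIV h" "\<And>y. norm y < r \<Longrightarrow> norm (h (z - y) - h z) \<le> \<epsilon>"
  defines "c \<equiv> (LINT z|lborel. bump r (z::'a))"
  shows "norm ((1 / c) *\<^sub>R (LINT y|lborel. bump r y *\<^sub>R h (z - y)) - h z) \<le> \<epsilon>"
proof -
  have c: "c > 0" using integral_bump_pos[OF assms(1)] by (simp add: c_def)
  have b0: "bump r z = 0" if "z \<notin> cball 0 r" for z :: 'a using that by (intro bump(3) assms(1)) auto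
  have int: "integrable lborel (bump r :: 'a \<Rightarrow> real)"
    by (rule integrable_compact_support[OF bump(5), of "cball 0 r"]) (auto intro!: b0)
  have int2: "integrable lborel (\<lambda>y. bump r y *\<^sub>R h (z - y))"
    using b0 by (intro integrable_compact_support[of _ "cball 0 r"] continuous_intros bump(5) continuous_on_compose2[OF assms(2)]) auto
  have eq: "(LINT y|lborel. bump r y *\<^sub>R h (z - y)) - c *\<^sub>R h z = (LINT y|lborel. bump r y *\<^sub>R (h (z - y) - h z))"
    using int int2 by (simp add: c_def algebra_simps integral_scaleR_left)
  have "norm (LINT y|lborel. bump r y *\<^sub>R (h (z - y) - h z)) \<le> (LINT y|lborel. norm (bump r y *\<^sub>R (h (z - y) - h z)))"
    by (rule integral_norm_bound)
  also have "\<dots> \<le> (LINT y::'a|lborel. bump r y * \<epsilon>)"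
  proof (rule Bochner_Integration.integral_mono)
    show "integrable lborel (\<lambda>y. norm (bump r y *\<^sub>R (h (z - y) - h z)))"
      using int int2 by (intro integrable_norm) (simp add: algebra_simps)
    show "norm (bump r y *\<^sub>R (h (z - y) - h z)) \<le> bump r y * \<epsilon>" for y :: 'a
    proof (cases "norm y < r")
      case True
      then show ?thesis using assms(3)[OF True] bump(2)[of r y] by (simp add: mult_left_mono)
    next
      case False
      then show ?thesis using bump(3)[of r y] assms(1) by simp
    qed
  qed (use int in auto)
  also have "\<dots> = c * \<epsilon>" by (simp add: c_def)
  finally have "norm ((1 / c) *\<^sub>R ((LINT y|lborel. bump r y *\<^sub>R h (z - y)) - c *\<^sub>R h z)) \<le> \<epsilon>"
    using c by (simp add: eq field_simps)
  then show ?thesis using c by (simp add: algebra_simps)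
qed

text \<open>Mollification by a bump of radius \<open>r\<close>. Since the function and its gradient have compact support, both are uniformly
  continuous, and averaging over a small ball moves them by little everywhere; the support grows by at most \<open>r\<close>.\<close>

lemma test_function_approximation:
  fixes \<phi> :: "'a::euclidean_space \<Rightarrow> real"
  assumes \<phi>: "C1_compact \<Omega> \<phi> \<Phi>" and \<Omega>: "open \<Omega>" and \<epsilon>: "\<epsilon> > 0"
  obtains \<eta> where "\<eta> \<in> test_functions \<Omega>" "\<And>z. \<bar>\<eta> z - \<phi> z\<bar> \<le> \<epsilon>" "\<And>z. norm (grad \<eta> z - \<Phi> z) \<le> \<epsilon>"
proof -
  obtain K where K: "compact K" "K \<subseteq> \<Omega>" "\<And>z. z \<notin> K \<Longrightarrow> \<phi> z = 0" "\<And>z. z \<notin> K \<Longrightarrow> \<Phi> z = 0"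
    "\<And>z. GDERIV \<phi> z :> \<Phi> z" "continuous_on UNIV \<phi>" "continuous_on UNIV \<Phi>"
    by (rule C1_compactE[OF \<phi>]) (rule that)
  obtain r0 where r0: "r0 > 0" "(\<Union>x\<in>K. cball x r0) \<subseteq> \<Omega>"
    using compact_subset_open_imp_cball_epsilon_subset[OF K(1) \<Omega> K(2)] by blast
  obtain d1 where d1: "d1 > 0" "\<And>x y. dist y x < d1 \<Longrightarrow> dist (\<phi> y) (\<phi> x) < \<epsilon>"
    using uniformly_continuous_compact_support[OF K(6,1,3)] \<epsilon> unfolding uniformly_continuous_on_def by blast
  obtain d2 where d2: "d2 > 0" "\<And>x y. dist y x < d2 \<Longrightarrow> dist (\<Phi> y) (\<Phi> x) < \<epsilon>"
    using uniformly_continuous_compact_support[OF K(7,1,4)] \<epsilon> unfolding uniformly_continuous_on_def by blast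
  define r where "r = min r0 (min d1 d2)"
  have r: "r > 0" "r \<le> r0" "r \<le> d1" "r \<le> d2" using r0 d1 d2 by (auto simp: r_def)
  define c where "c = (LINT z|lborel. bump r (z::'a))"
  have b0: "bump r z = 0" if "z \<notin> cball 0 r" for z :: 'a using that by (intro bump(3) r) auto
  define \<eta> where "\<eta> = (\<lambda>z. (1 / c) * conv (bump r) \<phi> z)"
  have comm: "conv (bump r) \<phi> = conv \<phi> (bump r)"
    by (intro conv_commute borel_measurable_continuous_onI K bump(5))
  obtain a where a: "K \<subseteq> cbox (-a) a" using bounded_subset_cbox_symmetric compact_imp_bounded[OF K(1)] by blast
  obtain a' where a': "cball (0::'a) r \<subseteq> cbox (-a') a'" using bounded_subset_cbox_symmetric[OF bounded_cball] by blast
  have G: "GDERIV \<eta> z :> (1 / c) *\<^sub>R (LINT y|lborel. bump r y *\<^sub>R \<Phi> (z - y))" for z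
    using GDERIV_mult[OF GDERIV_const[of "1 / c"] conv_GDERIV[OF bump(5) a' b0 K(5) K(7)], of z]
    by (simp add: \<eta>_def)
  show thesis
  proof (rule that[of \<eta>])
    have "C_k k \<eta>" for k
      unfolding \<eta>_def comm by (intro C_k_mult C_k_const C_k_conv[OF K(6) a K(3)] bump(1))
    moreover have "\<exists>K'. compact K' \<and> K' \<subseteq> \<Omega> \<and> (\<forall>z. z \<notin> K' \<longrightarrow> \<eta> z = 0)"
    proof (intro exI conjI allI impI)
      show "compact {x + y |x y. x \<in> K \<and> y \<in> cball 0 r}"
        by (intro compact_sums K(1) compact_cball)
      have "x + y \<in> cball x r0" if "y \<in> cball 0 r" for x y :: 'a
        using that r by (simp add: dist_norm)
      then show "{x + y |x y. x \<in> K \<and> y \<in> cball 0 r} \<subseteq> \<Omega>" using r0(2) by blast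
      fix z assume z: "z \<notin> {x + y |x y. x \<in> K \<and> y \<in> cball 0 r}"
      have "\<phi> y * bump r (z - y) = 0" for y
      proof (cases "y \<in> K")
        case True
        have "z - y \<notin> cball 0 r"
        proof
          assume "z - y \<in> cball 0 r"
          then have "y + (z - y) \<in> {x + y |x y. x \<in> K \<and> y \<in> cball 0 r}" using True by blast
          then show False using z by simp
        qed
        then show ?thesis using b0 by simp
      qed (simp add: K(3))
      then have "(\<lambda>y. \<phi> y * bump r (z - y)) = (\<lambda>y. 0)" by (rule ext)
      then have "conv \<phi> (bump r) z = 0"
        unfolding conv_def by simp
      then show "\<eta> z = 0" by (simp add: \<eta>_def comm)
    qed
    ultimately show "\<eta> \<in> test_functions \<Omega>" by (simp add: test_functions_def)
    have near: "norm (\<phi> (z - y) - \<phi> z) \<le> \<epsilon>" if "norm y < r" for y z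
      using d1(2)[of "z - y" z] r(3) that by (simp add: dist_norm)
    show "\<bar>\<eta> z - \<phi> z\<bar> \<le> \<epsilon>" for z
    proof -
      have "norm ((1 / c) *\<^sub>R (LINT y|lborel. bump r y *\<^sub>R \<phi> (z - y)) - \<phi> z) \<le> \<epsilon>"
        unfolding c_def by (rule bump_average[OF r(1) K(6)]) (rule near)
      then show ?thesis by (simp add: \<eta>_def conv_def)
    qed
    show "norm (grad \<eta> z - \<Phi> z) \<le> \<epsilon>" for z
      unfolding grad_eq[OF G] c_def
    proof (rule bump_average[OF r(1) K(7)])
      show "norm (\<Phi> (z - y) - \<Phi> z) \<le> \<epsilon>" if "norm y < r" for y
        using d2(2)[of "z - y" z] r(4) that by (simp add: dist_norm)
    qed
  qed
qed


section \<open>Compactly supported functions in the Grushin Sobolev space\<close>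

lemma C_k_1_continuous_grad:
  assumes "C_k 1 f"
  shows "GDERIV f z :> grad f z" "continuous_on UNIV (grad f)"
proof -
  have f: "C_k (Suc 0) f" using assms by simp
  show "GDERIV f z :> grad f z" by (rule C_k_SucD(1)[OF f])
  show "continuous_on UNIV (grad f)"
    by (subst continuous_on_componentwise) (use C_k_SucD(2)[OF f] in simp)
qed

lemma test_function_C1_compact:
  assumes "\<phi> \<in> test_functions \<Omega>"
  shows "C1_compact \<Omega> \<phi> (grad \<phi>)"
proof -
  obtain K where K: "compact K" "K \<subseteq> \<Omega>" "\<And>z. z \<notin> K \<Longrightarrow> \<phi> z = 0"
    using assms unfolding test_functions_def by blast
  have "C_k 1 \<phi>" using assms unfolding test_functions_def by blast
  from C_k_1_continuous_grad[OF this] show ?thesis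
    by (intro C1_compactI[OF _ _ K])
qed

lemma set_integral_lebesgue_supported:
  fixes h :: "'a::euclidean_space \<Rightarrow> 'b::{banach, second_countable_topology}"
  assumes "h \<in> borel_measurable borel" "\<And>z. z \<notin> \<Omega> \<Longrightarrow> h z = 0"
  shows "(LINT z:\<Omega>|lebesgue. h z) = (LINT z|lborel. h z)"
proof -
  have "(\<lambda>z. indicator \<Omega> z *\<^sub>R h z) = h" using assms(2) by (auto simp: indicator_def)
  then show ?thesis using assms(1) by (simp add: set_lebesgue_integral_def integral_completion)
qed

text \<open>The product of \<open>u\<close> with a test function is \<open>C\<^sup>1\<close> of compact support, so its gradient integrates to zero.\<close>

lemma C1_has_weak_gradient:
  fixes u :: "'a::euclidean_space \<Rightarrow> real"
  assumes \<Omega>: "open \<Omega>" and u: "\<And>z. z \<in> \<Omega> \<Longrightarrow> GDERIV u z :> G z" "continuous_on \<Omega> G"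
  shows "has_weak_gradient \<Omega> u G"
  unfolding has_weak_gradient_def
proof (intro conjI allI ballI impI; (elim conjE)?)
  have cu: "continuous_on \<Omega> u"
    by (intro continuous_at_imp_continuous_on ballI GDERIV_imp_isCont[OF u(1)])
  fix K assume K: "compact K" "K \<subseteq> \<Omega>"
  have "integrable lborel (\<lambda>z. indicator K z *\<^sub>R u z)" "integrable lborel (\<lambda>z. indicator K z *\<^sub>R G z)"
    by (intro borel_integrable_compact K(1) continuous_on_subset[OF cu K(2)] continuous_on_subset[OF u(2) K(2)])+
  then show "set_integrable lebesgue K u" "set_integrable lebesgue K G"
    by (simp_all add: set_integrable_def integrable_completion)
next
  fix \<phi> assume "\<phi> \<in> test_functions \<Omega>"
  then have \<phi>: "C1_compact \<Omega> \<phi> (grad \<phi>)" by (rule test_function_C1_compact)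
  obtain K where K: "compact K" "K \<subseteq> \<Omega>" "\<And>z. z \<notin> K \<Longrightarrow> \<phi> z = 0" "\<And>z. z \<notin> K \<Longrightarrow> grad \<phi> z = 0"
    "\<And>z. GDERIV \<phi> z :> grad \<phi> z" "continuous_on UNIV \<phi>" "continuous_on UNIV (grad \<phi>)"
    by (rule C1_compactE[OF \<phi>]) (rule that)
  have cu: "continuous_on \<Omega> u"
    by (intro continuous_at_imp_continuous_on ballI GDERIV_imp_isCont[OF u(1)])
  have c1: "continuous_on UNIV (\<lambda>z. u z *\<^sub>R grad \<phi> z)"
    by (rule continuous_on_compact_support[OF _ \<Omega> K(1,2)])
      (auto intro!: continuous_intros cu continuous_on_subset[OF K(7)] simp: K(4))
  have c2: "continuous_on UNIV (\<lambda>z. \<phi> z *\<^sub>R G z)"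
    by (rule continuous_on_compact_support[OF _ \<Omega> K(1,2)])
      (auto intro!: continuous_intros u(2) continuous_on_subset[OF K(6)] simp: K(3))
  have i1: "integrable lborel (\<lambda>z. u z *\<^sub>R grad \<phi> z)"
    by (rule integrable_compact_support[OF c1 K(1)]) (simp add: K(4))
  have i2: "integrable lborel (\<lambda>z. \<phi> z *\<^sub>R G z)"
    by (rule integrable_compact_support[OF c2 K(1)]) (simp add: K(3))
  have off: "z \<notin> \<Omega> \<Longrightarrow> z \<notin> K" for z using K(2) by blast
  have "(LINT z|lborel. \<phi> z *\<^sub>R G z + u z *\<^sub>R grad \<phi> z) = 0"
    by (rule integral_gradient_eq_0[OF C1_compact_mult[OF \<phi> \<Omega> u]])
  then have "(LINT z|lborel. u z *\<^sub>R grad \<phi> z) = - (LINT z|lborel. \<phi> z *\<^sub>R G z)"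
    using i1 i2 by (simp add: add_eq_0_iff)
  then show "(LINT z:\<Omega>|lebesgue. u z *\<^sub>R grad \<phi> z) = - (LINT z:\<Omega>|lebesgue. \<phi> z *\<^sub>R G z)"
    using borel_measurable_continuous_onI[OF c1] borel_measurable_continuous_onI[OF c2] K(3,4) off
    by (simp add: set_integral_lebesgue_supported)
qed

lemma grushin_weight_continuous: "\<gamma> \<ge> 0 \<Longrightarrow> continuous_on S (grushin_weight \<gamma>)"
  unfolding grushin_weight_def
  by (cases "\<gamma> = 0") (auto intro!: continuous_intros continuous_on_powr')

lemma continuous_on_grushin [continuous_intros]:
  assumes "\<gamma> \<ge> 0" "continuous_on S a" "continuous_on S b"
  shows "continuous_on S (\<lambda>z. grushin \<gamma> (a z) (b z))"
proof -
  have "continuous_on S (\<lambda>z. grushin_weight \<gamma> (fst (a z)))"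
    using assms by (intro continuous_on_compose2[OF grushin_weight_continuous[of \<gamma> UNIV]] continuous_intros) auto
  then show ?thesis unfolding grushin_def using assms by (intro continuous_intros)
qed

lemma grushin_weight_nonneg: "grushin_weight \<gamma> x \<ge> 0"
  by (simp add: grushin_weight_def)

lemma grushin_weight_bounded:
  fixes \<Omega> :: "((real ^ 'n) \<times> (real ^ 'm)) set"
  assumes "\<gamma> \<ge> 0" "bounded \<Omega>"
  obtains C where "C \<ge> 0" "\<And>z. z \<in> \<Omega> \<Longrightarrow> grushin_weight \<gamma> (fst z) \<le> C"
proof -
  have "compact (closure \<Omega>)" using assms(2) by simp
  moreover have "continuous_on (closure \<Omega>) (\<lambda>z. grushin_weight \<gamma> (fst z))"
    using assms(1) by (intro continuous_on_compose2[OF grushin_weight_continuous[of \<gamma> UNIV]] continuous_intros) auto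
  ultimately have "bounded ((\<lambda>z. grushin_weight \<gamma> (fst z)) ` closure \<Omega>)"
    by (intro compact_imp_bounded compact_continuous_image)
  then obtain C where "C > 0" "\<And>z. z \<in> closure \<Omega> \<Longrightarrow> norm (grushin_weight \<gamma> (fst z)) \<le> C"
    by (auto simp: bounded_pos)
  then show thesis using that[of C] closure_subset[of \<Omega>] by force
qed

lemma norm_grushin_le:
  assumes "grushin_weight \<gamma> (fst z) \<le> C"
  shows "norm (grushin \<gamma> z v) \<le> (1 + C) * norm v"
proof -
  have "norm (grushin \<gamma> z v) \<le> norm (fst v) + grushin_weight \<gamma> (fst z) * norm (snd v)"
    using norm_Pair_le[of "fst v" "grushin_weight \<gamma> (fst z) *\<^sub>R snd v"] grushin_weight_nonneg[of \<gamma> "fst z"]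
    by (simp add: grushin_def)
  also have "\<dots> \<le> norm v + C * norm v"
    using assms norm_fst_le[of "fst v" "snd v"] norm_snd_le[of "snd v" "fst v"] grushin_weight_nonneg[of \<gamma> "fst z"]
    by (intro add_mono mult_mono) auto
  finally show ?thesis by (simp add: algebra_simps)
qed

lemma continuous_in_Lp:
  assumes "continuous_on UNIV g" "compact K" "\<And>z. z \<notin> K \<Longrightarrow> g z = 0" "open \<Omega>" "p > 0"
  shows "in_Lp \<Omega> p g"
  unfolding in_Lp_def
proof
  have \<Omega>: "\<Omega> \<in> sets lborel" using assms(4) by simp
  have "g \<in> borel_measurable borel" using assms(1) by (rule borel_measurable_continuous_onI)
  then have "(\<lambda>z. indicator \<Omega> z *\<^sub>R g z) \<in> borel_measurable lborel" using \<Omega> by measurable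
  then show "set_borel_measurable lebesgue \<Omega> g"
    unfolding set_borel_measurable_def by (rule measurable_completion)
  have "continuous_on UNIV (\<lambda>z. \<bar>g z\<bar> powr p)"
    using assms(1,5) by (intro continuous_on_powr' continuous_intros) auto
  then have "integrable lborel (\<lambda>z. \<bar>g z\<bar> powr p)"
    by (rule integrable_compact_support[OF _ assms(2)]) (simp add: assms(3))
  then have "integrable lborel (\<lambda>z. indicator \<Omega> z *\<^sub>R (\<bar>g z\<bar> powr p))"
    by (rule integrable_mult_indicator[OF \<Omega>])
  then show "set_integrable lebesgue \<Omega> (\<lambda>z. \<bar>g z\<bar> powr p)"
    by (simp add: set_integrable_def integrable_completion)
qed

text \<open>On a bounded set uniform convergence of functions and gradients implies convergence in the weighted norm, because the
  weight is bounded there.\<close>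

lemma C1_compact_in_grushin_W0:
  fixes \<phi> :: "(real ^ 'n) \<times> (real ^ 'm) \<Rightarrow> real"
  assumes \<Omega>: "open \<Omega>" "bounded \<Omega>" and p: "p > 0" and \<gamma>: "\<gamma> \<ge> 0"
    and \<phi>: "C1_compact \<Omega> \<phi> \<Phi>"
  shows "has_weak_gradient \<Omega> \<phi> \<Phi>" "\<phi> \<in> grushin_W0 \<Omega> \<gamma> p"
proof -
  obtain K where K: "compact K" "K \<subseteq> \<Omega>" "\<And>z. z \<notin> K \<Longrightarrow> \<phi> z = 0" "\<And>z. z \<notin> K \<Longrightarrow> \<Phi> z = 0"
    "\<And>z. GDERIV \<phi> z :> \<Phi> z" "continuous_on UNIV \<phi>" "continuous_on UNIV \<Phi>"
    by (rule C1_compactE[OF \<phi>]) (rule that)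
  show weak: "has_weak_gradient \<Omega> \<phi> \<Phi>"
    by (rule C1_has_weak_gradient[OF \<Omega>(1) K(5) continuous_on_subset[OF K(7)]]) simp
  have wc: "continuous_on UNIV (\<lambda>z::(real ^ 'n) \<times> (real ^ 'm). grushin_weight \<gamma> (fst z))"
    using \<gamma> by (intro continuous_on_compose2[OF grushin_weight_continuous[of \<gamma> UNIV]] continuous_intros) auto
  have W: "\<phi> \<in> grushin_W \<Omega> \<gamma> p"
    unfolding grushin_W_def
  proof (intro CollectI conjI exI[of _ \<Phi>] allI weak)
    show "in_Lp \<Omega> p \<phi>" by (rule continuous_in_Lp[OF K(6,1,3) \<Omega>(1) p])
    show "in_Lp \<Omega> p (\<lambda>z. fst (\<Phi> z) $ i)" for i
      by (rule continuous_in_Lp[OF _ K(1) _ \<Omega>(1) p]) (auto intro!: continuous_intros K(7) simp: K(4))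
    show "in_Lp \<Omega> p (\<lambda>z. grushin_weight \<gamma> (fst z) * snd (\<Phi> z) $ j)" for j
      by (rule continuous_in_Lp[OF _ K(1) _ \<Omega>(1) p]) (auto intro!: continuous_intros K(7) wc simp: K(4))
  qed
  define \<epsilon> where "\<epsilon> n = inverse (real (Suc n))" for n
  have \<epsilon>: "\<epsilon> n > 0" for n by (simp add: \<epsilon>_def)
  have "\<exists>\<eta>. \<eta> \<in> test_functions \<Omega> \<and> (\<forall>z. \<bar>\<eta> z - \<phi> z\<bar> \<le> \<epsilon> n) \<and> (\<forall>z. norm (grad \<eta> z - \<Phi> z) \<le> \<epsilon> n)" for n
    by (rule test_function_approximation[OF \<phi> \<Omega>(1) \<epsilon>[of n]]) blast
  then obtain \<eta> where \<eta>: "\<eta> n \<in> test_functions \<Omega>" "\<bar>\<eta> n z - \<phi> z\<bar> \<le> \<epsilon> n" "norm (grad (\<eta> n) z - \<Phi> z) \<le> \<epsilon> n" for n z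
    by metis
  obtain C where C: "C \<ge> 0" "\<And>z. z \<in> \<Omega> \<Longrightarrow> grushin_weight \<gamma> (fst z) \<le> C"
    by (rule grushin_weight_bounded[OF \<gamma> \<Omega>(2)]) (rule that)
  define I where "I n = (LINT z:\<Omega>|lebesgue. norm (grushin \<gamma> z (\<Phi> z - grad (\<eta> n) z)) powr p + \<bar>\<phi> z - \<eta> n z\<bar> powr p)" for n
  define B where "B = measure lebesgue \<Omega> * ((1 + C) powr p + 1)"
  have I: "0 \<le> I n" "I n \<le> B * \<epsilon> n powr p" for n
  proof -
    show "0 \<le> I n" unfolding I_def set_lebesgue_integral_def by (intro integral_nonneg_AE) auto
    have m: "\<Omega> \<in> lmeasurable" by (simp add: \<Omega> lmeasurable_open)
    have "I n \<le> (LINT z|lebesgue. indicator \<Omega> z * (((1 + C) * \<epsilon> n) powr p + \<epsilon> n powr p))"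
      unfolding I_def set_lebesgue_integral_def
    proof (rule integral_mono')
      show "integrable lebesgue (\<lambda>z. indicator \<Omega> z * (((1 + C) * \<epsilon> n) powr p + \<epsilon> n powr p))"
        using m by (intro integrable_mult_left integrable_real_indicator) (auto simp: fmeasurable_def)
      fix z :: "(real ^ 'n) \<times> (real ^ 'm)"
      show "0 \<le> indicator \<Omega> z * (((1 + C) * \<epsilon> n) powr p + \<epsilon> n powr p)" by simp
      show "indicator \<Omega> z *\<^sub>R (norm (grushin \<gamma> z (\<Phi> z - grad (\<eta> n) z)) powr p + \<bar>\<phi> z - \<eta> n z\<bar> powr p)
         \<le> indicator \<Omega> z * (((1 + C) * \<epsilon> n) powr p + \<epsilon> n powr p)"
      proof (cases "z \<in> \<Omega>")
        case True
        have "norm (grushin \<gamma> z (\<Phi> z - grad (\<eta> n) z)) \<le> (1 + C) * norm (\<Phi> z - grad (\<eta> n) z)"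
          by (rule norm_grushin_le[OF C(2)[OF True]])
        also have "\<dots> \<le> (1 + C) * \<epsilon> n"
          using \<eta>(3)[of n z] C(1) by (intro mult_left_mono) (auto simp: norm_minus_commute)
        finally have "norm (grushin \<gamma> z (\<Phi> z - grad (\<eta> n) z)) powr p \<le> ((1 + C) * \<epsilon> n) powr p"
          using p by (intro powr_mono2) auto
        moreover have "\<bar>\<phi> z - \<eta> n z\<bar> powr p \<le> \<epsilon> n powr p"
          using p \<eta>(2)[of n z] by (intro powr_mono2) (auto simp: abs_minus_commute)
        ultimately show ?thesis using True by simp
      qed simp
    qed
    also have "\<dots> = measure lebesgue \<Omega> * (((1 + C) * \<epsilon> n) powr p + \<epsilon> n powr p)"
      using m by simp
    also have "\<dots> = B * \<epsilon> n powr p"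
      by (subst powr_mult) (simp add: B_def algebra_simps)
    finally show "I n \<le> B * \<epsilon> n powr p" .
  qed
  have \<epsilon>0: "\<epsilon> \<longlonglongrightarrow> 0" unfolding \<epsilon>_def[abs_def] by (rule LIMSEQ_inverse_real_of_nat)
  have "(\<lambda>n. \<epsilon> n powr p) \<longlonglongrightarrow> 0"
    using \<epsilon>0 p \<epsilon> by (intro tendsto_zero_powrI[where b=p] tendsto_const) (auto intro: always_eventually less_imp_le)
  then have B0: "(\<lambda>n. B * \<epsilon> n powr p) \<longlonglongrightarrow> 0" by (rule tendsto_mult_right_zero)
  have "I \<longlonglongrightarrow> 0"
    by (rule tendsto_sandwich[OF _ _ tendsto_const B0]) (use I in auto)
  then have "(\<lambda>n. I n powr (1 / p)) \<longlonglongrightarrow> 0"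
    using p I(1) by (intro tendsto_zero_powrI[where b="1/p"] tendsto_const) (auto intro: always_eventually)
  then have "(\<lambda>n. grushin_W_norm \<Omega> \<gamma> p (\<lambda>z. \<phi> z - \<eta> n z) (\<lambda>z. \<Phi> z - grad (\<eta> n) z)) \<longlonglongrightarrow> 0"
    by (simp add: grushin_W_norm_def I_def)
  then show "\<phi> \<in> grushin_W0 \<Omega> \<gamma> p"
    unfolding grushin_W0_def using W weak \<eta>(1) by blast
qed


section \<open>The Grushin energy and its flux\<close>

text \<open>The gradient of \<open>|v|\<^sup>p / p\<close>. At \<open>v = 0\<close> the value is \<open>0\<close> for every \<open>p\<close>, in accordance with \<open>0 powr a = 0\<close>.\<close>

definition power_flux :: "real \<Rightarrow> 'a::real_normed_vector \<Rightarrow> 'a" where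
  "power_flux p v = norm v powr (p - 2) *\<^sub>R v"

lemma continuous_power_flux:
  assumes "p > 1"
  shows "continuous_on UNIV (power_flux p :: 'a::real_normed_vector \<Rightarrow> 'a)"
proof (intro continuous_at_imp_continuous_on ballI)
  fix v :: 'a
  show "isCont (power_flux p) v"
  proof (cases "v = 0")
    case False
    then show ?thesis unfolding power_flux_def by (intro continuous_intros) auto
  next
    case True
    have "((\<lambda>v::'a. norm v powr (p - 1)) \<longlongrightarrow> 0) (at 0)"
      using assms by (intro tendsto_zero_powrI[where b="p - 1"] tendsto_norm_zero tendsto_ident_at tendsto_const) auto
    moreover have "norm v powr (p - 1) = norm (power_flux p v)" for v :: 'a
      by (cases "v = 0") (simp_all add: power_flux_def powr_mult_base mult.commute)
    ultimately have "((\<lambda>v::'a. norm (power_flux p v)) \<longlongrightarrow> 0) (at 0)" by simp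
    then have "((power_flux p :: 'a \<Rightarrow> 'a) \<longlongrightarrow> 0) (at 0)" by (rule tendsto_norm_zero_cancel)
    moreover have "power_flux p (0::'a) = 0" by (simp add: power_flux_def)
    ultimately show ?thesis using True by (simp add: isCont_def)
  qed
qed

text \<open>Convexity of \<open>|v|\<^sup>p / p\<close>. By the Cauchy-Schwarz inequality it reduces to Young's inequality for the numbers
  \<open>|b|\<close> and \<open>|a|\<^sup>p\<^sup>-\<^sup>1\<close>.\<close>

lemma power_energy_convex:
  fixes a b :: "'a::real_inner"
  assumes p: "p > 1"
  shows "power_flux p a \<bullet> (b - a) \<le> 1 / p * norm b powr p - 1 / p * norm a powr p"
proof (cases "a = 0")
  case True
  then show ?thesis using p by (simp add: power_flux_def)
next
  case False
  define n where "n = norm a"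
  have n: "n > 0" using False by (simp add: n_def)
  have e1: "n powr (p - 2) * n = n powr (p - 1)" using n by (simp add: powr_mult_base mult.commute)
  have e2: "n powr (p - 1) * n = n powr p" using n by (simp add: powr_mult_base mult.commute)
  have "power_flux p a \<bullet> (b - a) = n powr (p - 2) * (a \<bullet> b) - n powr (p - 2) * (n * n)"
    by (simp add: power_flux_def n_def inner_diff_right right_diff_distrib power2_norm_eq_inner[symmetric] power2_eq_square)
  also have "\<dots> \<le> n powr (p - 2) * (n * norm b) - n powr (p - 2) * (n * n)"
    using norm_cauchy_schwarz[of a b] by (auto simp: n_def intro!: mult_left_mono)
  also have "\<dots> = norm b * n powr (p - 1) - n powr p"
    unfolding e2[symmetric] e1[symmetric] by (simp add: algebra_simps)
  also have "norm b * n powr (p - 1) \<le> norm b powr p / p + (n powr (p - 1)) powr (p / (p - 1)) / (p / (p - 1))"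
    using p by (intro Youngs_inequality) (auto simp: field_simps)
  also have "(n powr (p - 1)) powr (p / (p - 1)) = n powr p" using p by (simp add: powr_powr)
  finally show ?thesis using p by (simp add: n_def field_simps)
qed

text \<open>Both bounds are the convexity inequality, with base point \<open>a\<close> and with base point \<open>b\<close>.\<close>

lemma power_energy_Lipschitz:
  fixes a b :: "'a::real_inner"
  assumes p: "p > 1" and R: "norm a \<le> R" "norm b \<le> R"
  shows "\<bar>1 / p * norm b powr p - 1 / p * norm a powr p\<bar> \<le> R powr (p - 1) * norm (b - a)"
proof -
  have *: "- (R powr (p - 1) * norm (d - c)) \<le> 1 / p * norm d powr p - 1 / p * norm c powr p" if "norm c \<le> R" for c d :: 'a
  proof -
    have "norm (power_flux p c) = norm c powr (p - 1)"
      by (cases "c = 0") (simp_all add: power_flux_def powr_mult_base mult.commute)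
    also have "\<dots> \<le> R powr (p - 1)" using p that by (intro powr_mono2) auto
    finally have "norm (power_flux p c) * norm (d - c) \<le> R powr (p - 1) * norm (d - c)"
      by (rule mult_right_mono) simp
    then have "- (R powr (p - 1) * norm (d - c)) \<le> power_flux p c \<bullet> (d - c)"
      using Cauchy_Schwarz_ineq2[of "power_flux p c" "d - c"] by linarith
    then show ?thesis using power_energy_convex[OF p, of c d] by linarith
  qed
  show ?thesis using *[OF R(1), of b] *[OF R(2), of a] by (simp add: abs_le_iff norm_minus_commute)
qed

text \<open>The gradient of \<open>\<xi> \<mapsto> L(z, \<xi>)\<close> for \<open>L\<close> as in the next definition. The outer \<open>grushin\<close> is the
  adjoint of the inner one.\<close>

definition grushin_flux :: "real \<Rightarrow> real \<Rightarrow> (real ^ 'n) \<times> (real ^ 'm) \<Rightarrow> (real ^ 'n) \<times> (real ^ 'm) \<Rightarrow> (real ^ 'n) \<times> (real ^ 'm)" where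
  "grushin_flux p \<gamma> z \<xi> = grushin \<gamma> z (power_flux p (grushin \<gamma> z \<xi>))"

definition grushin_energy :: "real \<Rightarrow> real \<Rightarrow> (real ^ 'n) \<times> (real ^ 'm) \<Rightarrow> (real ^ 'n) \<times> (real ^ 'm) \<Rightarrow> real" where
  "grushin_energy p \<gamma> z \<xi> = 1 / p * norm (grushin \<gamma> z \<xi>) powr p"

lemma grushin_selfadjoint: "grushin \<gamma> z a \<bullet> b = a \<bullet> grushin \<gamma> z b"
  by (simp add: grushin_def inner_prod_def)

lemma grushin_diff: "grushin \<gamma> z (a - b) = grushin \<gamma> z a - grushin \<gamma> z b"
  by (simp add: grushin_def scaleR_diff_right prod_eq_iff)

lemma grushin_flux_inner:
  "grushin_flux p \<gamma> z \<xi> \<bullet> v = norm (grushin \<gamma> z \<xi>) powr (p - 2) * (grushin \<gamma> z \<xi> \<bullet> grushin \<gamma> z v)"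
  by (simp add: grushin_flux_def grushin_selfadjoint power_flux_def)

lemma grushin_energy_convex:
  assumes "p > 1"
  shows "grushin_flux p \<gamma> z \<xi> \<bullet> (\<eta> - \<xi>) \<le> grushin_energy p \<gamma> z \<eta> - grushin_energy p \<gamma> z \<xi>"
  using power_energy_convex[OF assms, of "grushin \<gamma> z \<xi>" "grushin \<gamma> z \<eta>"]
  by (simp add: grushin_flux_def grushin_energy_def grushin_selfadjoint grushin_diff)

lemma continuous_on_grushin_flux [continuous_intros]:
  assumes "p > 1" "\<gamma> \<ge> 0" "continuous_on S a" "continuous_on S b"
  shows "continuous_on S (\<lambda>z. grushin_flux p \<gamma> (a z) (b z))"
  unfolding grushin_flux_def
  using assms by (intro continuous_intros continuous_on_compose2[OF continuous_power_flux[OF assms(1)]]) auto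

lemma continuous_on_grushin_energy [continuous_intros]:
  assumes "p > 0" "\<gamma> \<ge> 0" "continuous_on S a" "continuous_on S b"
  shows "continuous_on S (\<lambda>z. grushin_energy p \<gamma> (a z) (b z))"
  unfolding grushin_energy_def
  using assms by (intro continuous_intros continuous_on_powr') auto

text \<open>The weak equation extends to test functions of class \<open>C\<^sup>1\<close> and, since all integrands have compact support and are
  continuous, it may be read with respect to Borel-Lebesgue measure on the whole space.\<close>

lemma weak_solution_C1_compact:
  fixes u :: "(real ^ 'n) \<times> (real ^ 'm) \<Rightarrow> real"
  assumes \<Omega>: "open \<Omega>" "bounded \<Omega>" and p: "p > 1" and \<gamma>: "\<gamma> \<ge> 0"
    and f: "continuous_on UNIV (\<lambda>(z, s). f z s)"
    and u_sol: "weak_solution \<Omega> \<gamma> p f u"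
    and u: "\<And>z. z \<in> \<Omega> \<Longrightarrow> GDERIV u z :> Du z" "continuous_on \<Omega> Du"
    and \<phi>: "C1_compact \<Omega> \<phi> \<Phi>"
  shows "(LINT z|lborel. grushin_flux p \<gamma> z (Du z) \<bullet> \<Phi> z) = (LINT z|lborel. f z (u z) * \<phi> z)"
proof -
  obtain K where K: "compact K" "K \<subseteq> \<Omega>" "\<And>z. z \<notin> K \<Longrightarrow> \<phi> z = 0" "\<And>z. z \<notin> K \<Longrightarrow> \<Phi> z = 0"
    "\<And>z. GDERIV \<phi> z :> \<Phi> z" "continuous_on UNIV \<phi>" "continuous_on UNIV \<Phi>"
    by (rule C1_compactE[OF \<phi>]) (rule that)
  have cu: "continuous_on \<Omega> u"
    by (intro continuous_at_imp_continuous_on ballI GDERIV_imp_isCont[OF u(1)])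
  have cf: "continuous_on \<Omega> (\<lambda>z. f z (u z))"
  proof -
    have "continuous_on \<Omega> (\<lambda>z. (z, u z))" by (intro continuous_intros cu)
    from continuous_on_compose2[OF f this] show ?thesis by simp
  qed
  have c1: "continuous_on UNIV (\<lambda>z. grushin_flux p \<gamma> z (Du z) \<bullet> \<Phi> z)"
    by (rule continuous_on_compact_support[OF _ \<Omega>(1) K(1,2)])
      (auto intro!: continuous_intros p \<gamma> u(2) continuous_on_subset[OF K(7)] simp: K(4))
  have c2: "continuous_on UNIV (\<lambda>z. f z (u z) * \<phi> z)"
    by (rule continuous_on_compact_support[OF _ \<Omega>(1) K(1,2)])
      (auto intro!: continuous_intros cf continuous_on_subset[OF K(6)] simp: K(3))
  have W: "has_weak_gradient \<Omega> \<phi> \<Phi>" "\<phi> \<in> grushin_W0 \<Omega> \<gamma> p"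
    using C1_compact_in_grushin_W0[OF \<Omega> _ \<gamma> \<phi>, of p] p by auto
  have "has_weak_gradient \<Omega> u Du" by (rule C1_has_weak_gradient[OF \<Omega>(1) u])
  with u_sol W have "(LINT z:\<Omega>|lebesgue. norm (grushin \<gamma> z (Du z)) powr (p - 2) *
            (grushin \<gamma> z (Du z) \<bullet> grushin \<gamma> z (\<Phi> z))) = (LINT z:\<Omega>|lebesgue. f z (u z) * \<phi> z)"
    unfolding weak_solution_def by blast
  then have "(LINT z:\<Omega>|lebesgue. grushin_flux p \<gamma> z (Du z) \<bullet> \<Phi> z) = (LINT z:\<Omega>|lebesgue. f z (u z) * \<phi> z)"
    by (simp add: grushin_flux_inner)
  moreover have "grushin_flux p \<gamma> z (Du z) \<bullet> \<Phi> z = 0" "f z (u z) * \<phi> z = 0" if "z \<notin> \<Omega>" for z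
  proof -
    have "z \<notin> K" using K(2) that by blast
    then show "grushin_flux p \<gamma> z (Du z) \<bullet> \<Phi> z = 0" "f z (u z) * \<phi> z = 0" by (simp_all add: K(3,4))
  qed
  ultimately show ?thesis
    using borel_measurable_continuous_onI[OF c1] borel_measurable_continuous_onI[OF c2]
    by (simp add: set_integral_lebesgue_supported)
qed


section \<open>Inner variations of convex energies\<close>

lemma integral_lborel_translation:
  fixes v :: "'a::euclidean_space \<Rightarrow> real"
  assumes "v \<in> borel_measurable borel"
  shows "(LINT z|lborel. v (z + c)) = (LINT z|lborel. v z)"
proof -
  have "(LINT z|distr lborel borel ((+) c). v z) = (LINT z|lborel. v (c + z))"
    using assms by (intro integral_distr) auto
  then show ?thesis by (simp add: lborel_distr_plus add.commute)
qed

lemma GDERIV_bound: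
  fixes u :: "'a::euclidean_space \<Rightarrow> real"
  assumes "convex S" "\<And>x. x \<in> S \<Longrightarrow> GDERIV u x :> D x" "\<And>x. x \<in> S \<Longrightarrow> norm (D x) \<le> B" "x \<in> S" "y \<in> S"
  shows "\<bar>u x - u y\<bar> \<le> B * norm (x - y)"
proof -
  have "norm (u x - u y) \<le> B * norm (x - y)"
  proof (rule differentiable_bound[OF assms(1) _ _ assms(4,5)])
    fix z assume z: "z \<in> S"
    show "(u has_derivative (\<lambda>h. h \<bullet> D z)) (at z within S)"
      using assms(2)[OF z] unfolding gderiv_def by (rule has_derivative_at_withinI)
    show "onorm (\<lambda>h. h \<bullet> D z) \<le> B"
    proof (rule onorm_bound)
      show "0 \<le> B" using assms(3)[OF z] norm_ge_zero order_trans by blast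
      show "norm (h \<bullet> D z) \<le> B * norm h" for h
        using Cauchy_Schwarz_ineq2[of h "D z"] mult_right_mono[OF assms(3)[OF z] norm_ge_zero[of h]] by (simp add: mult.commute)
    qed
  qed
  then show ?thesis by simp
qed

lemma GDERIV_shift:
  fixes u :: "'a::euclidean_space \<Rightarrow> real"
  assumes "GDERIV u (z + c) :> D"
  shows "GDERIV (\<lambda>z. u (z + c)) z :> D"
proof -
  have "((\<lambda>z. u (z + c)) has_derivative (\<lambda>h. h \<bullet> D)) (at z)"
    using assms unfolding gderiv_def
    by (rule has_derivative_compose[rotated]) (auto intro!: derivative_eq_intros)
  then show ?thesis by (simp add: gderiv_def)
qed

lemma LIMSEQ_difference_quotient:
  fixes g :: "real \<Rightarrow> real"
  assumes "(g has_real_derivative D) (at 0)" "h \<longlonglongrightarrow> 0" "\<And>n. h n \<noteq> 0"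
  shows "(\<lambda>n. (g (h n) - g 0) / h n) \<longlonglongrightarrow> D"
proof -
  have "((\<lambda>t. (g t - g 0) / t) \<longlongrightarrow> D) (at 0)" using assms(1) by (simp add: DERIV_def)
  moreover have "filterlim h (at 0) sequentially"
    using assms(2,3) by (auto simp: filterlim_at)
  ultimately show ?thesis by (rule filterlim_compose)
qed

text \<open>A weak solution \<open>u\<close> of class \<open>C\<^sup>1\<close> of \<open>- div A = c\<close> with \<open>A = \<partial>L/\<partial>\<xi> (z, \<nabla>u)\<close> and \<open>L\<close> convex in
  \<open>\<xi>\<close> satisfies, in the sense of distributions, the conservation law
  \<open>div (L e - (\<partial>\<^sub>e u) A) = \<partial>L/\<partial>e + c \<partial>\<^sub>e u\<close>, where \<open>\<partial>L/\<partial>e\<close> is the function \<open>Le\<close>.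
  The relation between \<open>A\<close> and \<open>L\<close> is expressed by the subgradient inequality.
  Differentiability of \<open>L\<close> in \<open>z\<close> is only required almost everywhere, with a dominated difference quotient; this is what the
  weight \<open>|x|\<^sup>\<gamma>\<close> with \<open>0 < \<gamma> < 1\<close> provides.\<close>

lemma convex_stress_energy_identity:
  fixes u :: "'a::euclidean_space \<Rightarrow> real" and L :: "'a \<Rightarrow> 'a \<Rightarrow> real"
  assumes \<Omega>: "open \<Omega>" and e: "norm e = 1"
    and convex: "\<And>z \<eta>. z \<in> \<Omega> \<Longrightarrow> A z \<bullet> (\<eta> - Du z) \<le> L z \<eta> - L z (Du z)"
    and L: "continuous_on UNIV (\<lambda>(z, \<xi>). L z \<xi>)" and A: "continuous_on \<Omega> A" and c: "continuous_on \<Omega> c"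
    and u: "\<And>z. z \<in> \<Omega> \<Longrightarrow> GDERIV u z :> Du z" "continuous_on \<Omega> Du"
    and weak: "\<And>\<phi> \<Phi>. C1_compact \<Omega> \<phi> \<Phi> \<Longrightarrow> (LINT z|lborel. A z \<bullet> \<Phi> z) = (LINT z|lborel. c z * \<phi> z)"
    and Le: "AE z in lborel. z \<in> \<Omega> \<longrightarrow> ((\<lambda>t. L (z + t *\<^sub>R e) (Du z)) has_real_derivative Le z) (at 0)"
    and Le_m: "(\<lambda>z. indicator \<Omega> z * Le z) \<in> borel_measurable borel"
    and dom: "\<And>K. compact K \<Longrightarrow> K \<subseteq> \<Omega> \<Longrightarrow> \<exists>\<delta>>0. \<exists>M. integrable lborel M \<and>
        (AE z in lborel. z \<in> K \<longrightarrow> (\<forall>t. \<bar>t\<bar> \<le> \<delta> \<longrightarrow> \<bar>L (z + t *\<^sub>R e) (Du z) - L z (Du z)\<bar> \<le> M z * \<bar>t\<bar>))"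
    and \<psi>: "C1_compact \<Omega> \<psi> \<Psi>" "\<And>z. \<psi> z \<ge> 0"
  shows "integrable lborel (\<lambda>z. \<psi> z * Le z)"
    and "(LINT z|lborel. L z (Du z) * (\<Psi> z \<bullet> e) - (Du z \<bullet> e) * (A z \<bullet> \<Psi> z))
      = - (LINT z|lborel. \<psi> z * Le z) - (LINT z|lborel. \<psi> z * (c z * (Du z \<bullet> e)))"
proof -
  obtain K where K: "compact K" "K \<subseteq> \<Omega>" "\<And>z. z \<notin> K \<Longrightarrow> \<psi> z = 0" "\<And>z. z \<notin> K \<Longrightarrow> \<Psi> z = 0"
    "\<And>z. GDERIV \<psi> z :> \<Psi> z" "continuous_on UNIV \<psi>" "continuous_on UNIV \<Psi>"
    by (rule C1_compactE[OF \<psi>(1)]) (rule that)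
  have cu: "continuous_on \<Omega> u"
    by (intro continuous_at_imp_continuous_on ballI GDERIV_imp_isCont[OF u(1)])
  have cL: "continuous_on S (\<lambda>z. L (a z) (b z))" if "continuous_on S a" "continuous_on S b" for S and a b :: "'a \<Rightarrow> 'a"
    using continuous_on_compose2[OF L continuous_on_Pair[OF that]] by simp
  obtain r where r: "r > 0" "(\<Union>x\<in>K. cball x r) \<subseteq> \<Omega>"
    using compact_subset_open_imp_cball_epsilon_subset[OF K(1) \<Omega> K(2)] by blast
  define K' where "K' = {x + y |x y. x \<in> K \<and> y \<in> cball 0 r}"
  have inK': "z + y \<in> K'" if "z \<in> K" "norm y \<le> r" for z y
    using that unfolding K'_def by (intro CollectI exI[of _ z] exI[of _ y]) auto
  have K': "compact K'" "K' \<subseteq> \<Omega>" "K \<subseteq> K'"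
  proof -
    show "compact K'" unfolding K'_def by (intro compact_sums K(1) compact_cball)
    have "x + y \<in> cball x r" if "y \<in> cball 0 r" for x y :: 'a using that by (simp add: dist_norm)
    then show "K' \<subseteq> \<Omega>" using r(2) unfolding K'_def by blast
    show "K \<subseteq> K'" using inK'[of _ 0] r(1) by auto
  qed
  obtain \<delta>' M where \<delta>': "\<delta>' > 0" and M: "integrable lborel M"
    "AE z in lborel. z \<in> K' \<longrightarrow> (\<forall>t. \<bar>t\<bar> \<le> \<delta>' \<longrightarrow> \<bar>L (z + t *\<^sub>R e) (Du z) - L z (Du z)\<bar> \<le> M z * \<bar>t\<bar>)"
    using dom[OF K'(1,2)] by blast
  define \<delta> where "\<delta> = min r \<delta>'"
  have \<delta>: "\<delta> > 0" "\<delta> \<le> r" "\<delta> \<le> \<delta>'" using r \<delta>' by (auto simp: \<delta>_def)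
  have bddK': "\<exists>B\<ge>0. \<forall>z\<in>K'. norm (v z) \<le> B" if "continuous_on \<Omega> v" for v :: "'a \<Rightarrow> 'b::real_normed_vector"
  proof -
    have "bounded (v ` K')"
      by (intro compact_imp_bounded compact_continuous_image K' continuous_on_subset[OF that])
    then show ?thesis by (auto simp: bounded_pos intro: less_imp_le)
  qed
  obtain Bu where Bu: "Bu \<ge> 0" "\<And>z. z \<in> K' \<Longrightarrow> norm (Du z) \<le> Bu" using bddK'[OF u(2)] by blast
  obtain BL where BL: "BL \<ge> 0" "\<And>z. z \<in> K' \<Longrightarrow> \<bar>L z (Du z)\<bar> \<le> BL"
    using bddK'[OF cL[OF continuous_on_id u(2)]] by auto
  obtain B\<psi> where B\<psi>: "B\<psi> > 0" "\<And>z. norm (\<psi> z) \<le> B\<psi>" using bounded_compact_support[OF K(6,1,3)] by blast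
  obtain B\<Psi> where B\<Psi>: "B\<Psi> > 0" "\<And>z. norm (\<Psi> z) \<le> B\<Psi>" using bounded_compact_support[OF K(7,1,4)] by blast
  have supp: "continuous_on UNIV v \<and> integrable lborel v"
    if "continuous_on \<Omega> v" "\<And>z. z \<notin> K' \<Longrightarrow> v z = 0" for v :: "'a \<Rightarrow> real"
    using continuous_on_compact_support[OF that(1) \<Omega> K'(1,2) that(2)] integrable_compact_support[of v, OF _ K'(1) that(2)] by blast
  have sub: "continuous_on S \<psi>" "continuous_on S \<Psi>" for S
    using continuous_on_subset[OF K(6)] continuous_on_subset[OF K(7)] by auto
  define q where "q z = c z * \<psi> z - A z \<bullet> \<Psi> z" for z
  have q0: "q z = 0" if "z \<notin> K" for z using that by (simp add: q_def K(3,4))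
  have cq: "continuous_on \<Omega> q" unfolding q_def by (intro continuous_intros c A sub)
  define R0 where "R0 = (LINT z|lborel. (Du z \<bullet> e) * q z)"
  define S0 where "S0 = (LINT z|lborel. - (\<Psi> z \<bullet> e) * L z (Du z) - \<psi> z * Le z)"
  \<comment> \<open>The sign \<open>s\<close> of the increment: \<open>s = 1\<close> and \<open>s = -1\<close> give the two inequalities.\<close>
  have main: "s * R0 \<le> s * S0 \<and> integrable lborel (\<lambda>z. - (\<Psi> z \<bullet> e) * L z (Du z) - \<psi> z * Le z)" if s: "\<bar>s\<bar> = 1" for s :: real
  proof -
    define h where "h n = s * (\<delta> * inverse (real (Suc n)))" for n
    have h: "h n \<noteq> 0" "\<bar>h n\<bar> \<le> \<delta>" "s * h n > 0" for n
    proof -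
      have ss: "s * s = 1" using s by (metis abs_mult_self_eq mult_1)
      have "s * h n = \<delta> * inverse (real (Suc n))" using ss by (simp add: h_def mult.assoc[symmetric])
      then show "s * h n > 0" using \<delta>(1) by simp
      then show "h n \<noteq> 0" by auto
      show "\<bar>h n\<bar> \<le> \<delta>" using \<delta>(1) s by (simp add: h_def abs_mult field_simps)
    qed
    have h0: "h \<longlonglongrightarrow> 0" unfolding h_def[abs_def]
      using tendsto_mult_right_zero[OF tendsto_mult_right_zero[OF LIMSEQ_inverse_real_of_nat]] by simp
    have he: "norm (h n *\<^sub>R e) \<le> r" for n using h(2)[of n] \<delta>(2) e by simp
    have shift: "z + h n *\<^sub>R e \<in> K'" if "z \<in> K" for z n by (rule inK'[OF that he])
    define dq where "dq n z = (u (z + h n *\<^sub>R e) - u z) / h n" for n z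
    \<comment> \<open>The set where both \<open>u\<close> and its translate are controlled; the test function is formed there.\<close>
    define Sh where "Sh n = \<Omega> \<inter> (\<lambda>z. z + h n *\<^sub>R e) -` \<Omega>" for n
    have Sh: "open (Sh n)" "K \<subseteq> Sh n" "Sh n \<subseteq> \<Omega>" "z \<in> Sh n \<Longrightarrow> z + h n *\<^sub>R e \<in> \<Omega>" for n z
    proof -
      show "open (Sh n)" unfolding Sh_def
        by (intro open_Int \<Omega> open_vimage) (auto intro!: continuous_intros)
      show "K \<subseteq> Sh n" using shift K' K(2) unfolding Sh_def by blast
      show "Sh n \<subseteq> \<Omega>" "z \<in> Sh n \<Longrightarrow> z + h n *\<^sub>R e \<in> \<Omega>" by (auto simp: Sh_def)
    qed
    have shc: "continuous_on (Sh n) (\<lambda>z. v (z + h n *\<^sub>R e))" if "continuous_on \<Omega> v" for n and v :: "'a \<Rightarrow> 'b::topological_space"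
      using Sh(4) by (intro continuous_on_compose2[OF that] continuous_intros) auto
    have suppS: "integrable lborel v"
      if "continuous_on (Sh n) v" "\<And>z. z \<notin> K \<Longrightarrow> v z = 0" for v :: "'a \<Rightarrow> real" and n
      by (rule integrable_compact_support[OF continuous_on_compact_support[OF that(1) Sh(1) K(1) Sh(2) that(2)] K(1) that(2)])
    note onS = continuous_on_subset[OF _ Sh(3)]
    have cdq: "continuous_on (Sh n) (dq n)" for n
      unfolding dq_def[abs_def] using h(1) by (intro continuous_intros shc cu onS[OF cu]) auto
    have idq: "integrable lborel (\<lambda>z. dq n z * v z)" if "continuous_on \<Omega> v" "\<And>z. z \<notin> K \<Longrightarrow> v z = 0" for n v
      by (rule suppS) (auto intro!: continuous_intros cdq onS[OF that(1)] simp: that(2))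
    have iq: "integrable lborel q" using supp[OF cq] q0 K'(3) by blast
    have iRq: "integrable lborel (\<lambda>z. (Du z \<bullet> e) * q z)"
      using supp[of "\<lambda>z. (Du z \<bullet> e) * q z"] K'(3) q0 by (force intro!: continuous_intros u(2) cq)
    have R: "(\<lambda>n. LINT z|lborel. dq n z * q z) \<longlonglongrightarrow> R0"
      unfolding R0_def
    proof (rule integral_dominated_convergence)
      show "(\<lambda>z. (Du z \<bullet> e) * q z) \<in> borel_measurable lborel" using iRq by blast
      show "(\<lambda>z. dq n z * q z) \<in> borel_measurable lborel" for n using idq[OF cq q0] by blast
      show "integrable lborel (\<lambda>z. Bu * \<bar>q z\<bar>)" using iq by (intro integrable_mult_right integrable_abs)
      show "AE z in lborel. (\<lambda>n. dq n z * q z) \<longlonglongrightarrow> (Du z \<bullet> e) * q z"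
      proof (rule AE_I2)
        fix z :: 'a
        show "(\<lambda>n. dq n z * q z) \<longlonglongrightarrow> (Du z \<bullet> e) * q z"
        proof (cases "z \<in> K")
          case True
          then have "GDERIV u z :> Du z" using u(1) K(2) by blast
          from LIMSEQ_difference_quotient[OF GDERIV_line[OF this] h0 h(1)]
          have "(\<lambda>n. dq n z) \<longlonglongrightarrow> Du z \<bullet> e" by (simp add: dq_def)
          then show ?thesis by (intro tendsto_mult tendsto_const)
        qed (simp add: q0)
      qed
      show "AE z in lborel. norm (dq n z * q z) \<le> Bu * \<bar>q z\<bar>" for n
      proof (rule AE_I2)
        fix z :: 'a
        show "norm (dq n z * q z) \<le> Bu * \<bar>q z\<bar>"
        proof (cases "z \<in> K")
          case True
          have sub: "cball z r \<subseteq> K'"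
          proof
            fix x assume "x \<in> cball z r"
            then have "z + (x - z) \<in> K'" by (intro inK'[OF True]) (simp add: dist_norm norm_minus_commute)
            then show "x \<in> K'" by simp
          qed
          have "\<bar>u (z + h n *\<^sub>R e) - u z\<bar> \<le> Bu * norm (z + h n *\<^sub>R e - z)"
          proof (rule GDERIV_bound)
            show "convex (cball z r)" by simp
            show "GDERIV u x :> Du x" "norm (Du x) \<le> Bu" if "x \<in> cball z r" for x
              using that sub K'(2) u(1) Bu(2) by blast+
            show "z + h n *\<^sub>R e \<in> cball z r" "z \<in> cball z r" using he[of n] r(1) by (auto simp: dist_norm)
          qed
          then have "\<bar>dq n z\<bar> \<le> Bu" using h(1)[of n] e by (simp add: dq_def abs_divide field_simps)
          then show ?thesis by (simp add: abs_mult mult_right_mono)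
        qed (simp add: q0)
      qed
    qed
    define sn where "sn n z = (\<psi> (z - h n *\<^sub>R e) * L (z - h n *\<^sub>R e) (Du z) - \<psi> z * L z (Du z)) / h n" for n z
    have off: "z - h n *\<^sub>R e \<notin> K" if "z \<notin> K'" for z n
      using shift[of "z - h n *\<^sub>R e" n] that by auto
    have s1: "continuous_on UNIV (\<lambda>z. \<psi> (z - h n *\<^sub>R e) * L (z - h n *\<^sub>R e) (Du z)) \<and> integrable lborel (\<lambda>z. \<psi> (z - h n *\<^sub>R e) * L (z - h n *\<^sub>R e) (Du z))" for n
      by (rule supp) (auto intro!: continuous_intros cL u(2) continuous_on_compose2[OF K(6)] simp: K(3)[OF off])
    have s2: "integrable lborel (\<lambda>z. \<psi> z * L z (Du z))"
      using supp[of "\<lambda>z. \<psi> z * L z (Du z)"] K(3) K'(3) by (force intro!: continuous_intros cL u(2) sub)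
    have isn: "integrable lborel (sn n)" for n
      unfolding sn_def[abs_def] using s1[of n] s2 by (intro integrable_divide Bochner_Integration.integrable_diff) auto
    define w where "w z = indicator K' z * (B\<Psi> * BL) + B\<psi> * \<bar>M z\<bar>" for z
    have dct: "(\<lambda>z. - (\<Psi> z \<bullet> e) * L z (Du z) - \<psi> z * Le z) \<in> borel_measurable lborel"
      "\<And>n. sn n \<in> borel_measurable lborel" "integrable lborel w"
      "AE z in lborel. (\<lambda>n. sn n z) \<longlonglongrightarrow> - (\<Psi> z \<bullet> e) * L z (Du z) - \<psi> z * Le z"
      "\<And>n. AE z in lborel. norm (sn n z) \<le> w z"
    proof -
      have "integrable lborel (\<lambda>z. - (\<Psi> z \<bullet> e) * L z (Du z))"
        using supp[of "\<lambda>z. - (\<Psi> z \<bullet> e) * L z (Du z)"] K(4) K'(3) by (force intro!: continuous_intros cL u(2) sub)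
      then have m1: "(\<lambda>z. - (\<Psi> z \<bullet> e) * L z (Du z)) \<in> borel_measurable borel" by auto
      have "(\<lambda>z. \<psi> z * (indicator \<Omega> z * Le z)) \<in> borel_measurable borel"
        by (intro borel_measurable_times Le_m borel_measurable_continuous_onI K(6))
      also have "(\<lambda>z. \<psi> z * (indicator \<Omega> z * Le z)) = (\<lambda>z. \<psi> z * Le z)"
        using K(2,3) by (force simp: indicator_def)
      finally show "(\<lambda>z. - (\<Psi> z \<bullet> e) * L z (Du z) - \<psi> z * Le z) \<in> borel_measurable lborel"
        using m1 by simp
      show "sn n \<in> borel_measurable lborel" for n using isn by blast
      have "integrable lborel (\<lambda>z. indicator K' z * (B\<Psi> * BL))"
        using emeasure_compact_finite[OF K'(1)] K'(1)
        by (intro integrable_mult_left integrable_real_indicator) (auto simp: borel_compact)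
      then show "integrable lborel w"
        unfolding w_def[abs_def] using M(1) by (intro Bochner_Integration.integrable_add integrable_mult_right integrable_abs)
      \<comment> \<open>The increment falls on \<open>\<psi>\<close> in the first term and on the explicit variable of \<open>L\<close> in the second.\<close>
      have eq: "sn n z = (\<psi> (z + (- h n) *\<^sub>R e) - \<psi> z) / h n * L z (Du z) +
         \<psi> (z + (- h n) *\<^sub>R e) * ((L (z + (- h n) *\<^sub>R e) (Du z) - L z (Du z)) / h n)" for n z
        using h(1)[of n] by (simp add: sn_def field_simps)
      have k: "(\<lambda>n. - h n) \<longlonglongrightarrow> 0" "\<And>n. - h n \<noteq> 0" using h0 h(1) tendsto_minus[OF h0] by auto
      show "AE z in lborel. (\<lambda>n. sn n z) \<longlonglongrightarrow> - (\<Psi> z \<bullet> e) * L z (Du z) - \<psi> z * Le z"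
        using Le
      proof eventually_elim
        case (elim z)
        show ?case
        proof (cases "z \<in> K'")
          case True
          then have "((\<lambda>t. L (z + t *\<^sub>R e) (Du z)) has_real_derivative Le z) (at 0)" using elim K'(2) by blast
          from tendsto_minus[OF LIMSEQ_difference_quotient[OF this k]]
          have 1: "(\<lambda>n. (L (z + (- h n) *\<^sub>R e) (Du z) - L z (Du z)) / h n) \<longlonglongrightarrow> - Le z" by simp
          from tendsto_minus[OF LIMSEQ_difference_quotient[OF GDERIV_line[OF K(5)] k, of z e]]
          have 2: "(\<lambda>n. (\<psi> (z + (- h n) *\<^sub>R e) - \<psi> z) / h n) \<longlonglongrightarrow> - (\<Psi> z \<bullet> e)" by simp
          have "(\<lambda>n. z + (- h n) *\<^sub>R e) \<longlonglongrightarrow> z + 0 *\<^sub>R e" by (intro tendsto_intros k(1))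
          then have 3: "(\<lambda>n. \<psi> (z + (- h n) *\<^sub>R e)) \<longlonglongrightarrow> \<psi> z"
            using isCont_tendsto_compose[OF GDERIV_imp_isCont[OF K(5)]] by fastforce
          have "(\<lambda>n. sn n z) \<longlonglongrightarrow> - (\<Psi> z \<bullet> e) * L z (Du z) + \<psi> z * (- Le z)"
            unfolding eq by (intro tendsto_add tendsto_mult 1 2 3 tendsto_const)
          then show ?thesis by simp
        next
          case False
          then have "z \<notin> K" using K'(3) by blast
          then show ?thesis using K(3)[OF off[OF False]] by (simp add: sn_def K(3,4))
        qed
      qed
      show "AE z in lborel. norm (sn n z) \<le> w z" for n
        using M(2)
      proof eventually_elim
        case (elim z)
        show ?case
        proof (cases "z \<in> K'")
          case True
          have "\<bar>\<psi> (z + (- h n) *\<^sub>R e) - \<psi> z\<bar> \<le> B\<Psi> * norm (z + (- h n) *\<^sub>R e - z)"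
            by (rule GDERIV_bound[OF convex_UNIV K(5) B\<Psi>(2)]) auto
          then have 1: "\<bar>(\<psi> (z + (- h n) *\<^sub>R e) - \<psi> z) / h n\<bar> \<le> B\<Psi>"
            using h(1)[of n] e by (simp add: abs_divide field_simps)
          have "\<bar>L (z + (- h n) *\<^sub>R e) (Du z) - L z (Du z)\<bar> \<le> M z * \<bar>- h n\<bar>"
            using elim True h(2)[of n] \<delta>(3) by (metis abs_minus_cancel order_trans)
          then have 2: "\<bar>(L (z + (- h n) *\<^sub>R e) (Du z) - L z (Du z)) / h n\<bar> \<le> \<bar>M z\<bar>"
            using h(1)[of n] by (simp add: abs_divide field_simps) (smt (verit) mult_right_mono abs_ge_zero)
          have "norm (sn n z) \<le> \<bar>(\<psi> (z + (- h n) *\<^sub>R e) - \<psi> z) / h n\<bar> * \<bar>L z (Du z)\<bar> +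
             \<bar>\<psi> (z + (- h n) *\<^sub>R e)\<bar> * \<bar>(L (z + (- h n) *\<^sub>R e) (Du z) - L z (Du z)) / h n\<bar>"
            unfolding eq abs_mult[symmetric] real_norm_def by (rule abs_triangle_ineq)
          also have "\<dots> \<le> B\<Psi> * BL + B\<psi> * \<bar>M z\<bar>"
            using 1 2 BL(2)[OF True] B\<psi>(2)[of "z + (- h n) *\<^sub>R e"] B\<psi>(1) B\<Psi>(1) BL(1)
            by (intro add_mono mult_mono) auto
          finally show ?thesis using True by (simp add: w_def)
        next
          case False
          then have "z \<notin> K" using K'(3) by blast
          then have "sn n z = 0" using K(3)[OF off[OF False]] by (simp add: sn_def K(3))
          then show ?thesis using B\<psi>(1) False by (simp add: w_def)
        qed
      qed
    qed
    have S: "(\<lambda>n. LINT z|lborel. sn n z) \<longlonglongrightarrow> S0" "integrable lborel (\<lambda>z. - (\<Psi> z \<bullet> e) * L z (Du z) - \<psi> z * Le z)"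
      unfolding S0_def by (rule integral_dominated_convergence[OF dct] integrable_dominated_convergence[OF dct])+
    \<comment> \<open>The weak equation tested with \<open>\<psi> (u(\<cdot> + h e) - u)\<close>, followed by convexity and a translation.\<close>
    have RS: "s * (LINT z|lborel. dq n z * q z) \<le> s * (LINT z|lborel. sn n z)" for n
    proof -
      let ?d = "\<lambda>z. u (z + h n *\<^sub>R e) - u z"
      let ?D = "\<lambda>z. Du (z + h n *\<^sub>R e) - Du z"
      have cD: "continuous_on (Sh n) ?D" by (intro continuous_intros shc u(2) onS[OF u(2)])
      have cd: "continuous_on (Sh n) ?d" by (intro continuous_intros shc cu onS[OF cu])
      have "C1_compact (Sh n) \<psi> \<Psi>" by (rule C1_compactI[OF K(5,7,1) Sh(2) K(3)])
      moreover have "GDERIV ?d z :> ?D z" if "z \<in> Sh n" for z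
        using Sh(3,4) that by (intro GDERIV_diff GDERIV_shift u(1)) auto
      ultimately have "C1_compact (Sh n) (\<lambda>z. \<psi> z * ?d z) (\<lambda>z. \<psi> z *\<^sub>R ?D z + ?d z *\<^sub>R \<Psi> z)"
        using cD by (intro C1_compact_mult Sh(1))
      from weak[OF C1_compact_mono[OF this Sh(3)]]
      have w: "(LINT z|lborel. A z \<bullet> (\<psi> z *\<^sub>R ?D z + ?d z *\<^sub>R \<Psi> z)) = (LINT z|lborel. c z * (\<psi> z * ?d z))" .
      have i1: "integrable lborel (\<lambda>z. \<psi> z * (A z \<bullet> ?D z))"
        by (rule suppS[of n]) (auto intro!: continuous_intros sub cD onS[OF A] simp: K(3))
      have i2: "integrable lborel (\<lambda>z. ?d z * (A z \<bullet> \<Psi> z))"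
        by (rule suppS[of n]) (auto intro!: continuous_intros sub cd onS[OF A] simp: K(4))
      have i3: "integrable lborel (\<lambda>z. c z * (\<psi> z * ?d z))"
        by (rule suppS[of n]) (auto intro!: continuous_intros sub cd onS[OF c] simp: K(3))
      have "(LINT z|lborel. \<psi> z * (A z \<bullet> ?D z)) = (LINT z|lborel. c z * (\<psi> z * ?d z)) - (LINT z|lborel. ?d z * (A z \<bullet> \<Psi> z))"
        using w i1 i2 by (simp add: inner_add_right)
      also have "\<dots> = (LINT z|lborel. c z * (\<psi> z * ?d z) - ?d z * (A z \<bullet> \<Psi> z))"
        using i2 i3 by simp
      also have "\<dots> = (LINT z|lborel. h n * (dq n z * q z))"
        using h(1)[of n] by (intro Bochner_Integration.integral_cong refl) (simp add: dq_def q_def field_simps)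
      finally have lhs: "h n * (LINT z|lborel. dq n z * q z) = (LINT z|lborel. \<psi> z * (A z \<bullet> ?D z))" by simp
      have i4: "integrable lborel (\<lambda>z. \<psi> z * L z (Du (z + h n *\<^sub>R e)))"
        by (rule suppS[of n]) (auto intro!: continuous_intros sub cL shc u(2) simp: K(3))
      have "(LINT z|lborel. \<psi> z * (A z \<bullet> ?D z)) \<le> (LINT z|lborel. \<psi> z * L z (Du (z + h n *\<^sub>R e)) - \<psi> z * L z (Du z))"
      proof (rule Bochner_Integration.integral_mono)
        show "integrable lborel (\<lambda>z. \<psi> z * (A z \<bullet> ?D z))" by (rule i1)
        show "integrable lborel (\<lambda>z. \<psi> z * L z (Du (z + h n *\<^sub>R e)) - \<psi> z * L z (Du z))"
          using i4 s2 by simp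
        fix z
        show "\<psi> z * (A z \<bullet> ?D z) \<le> \<psi> z * L z (Du (z + h n *\<^sub>R e)) - \<psi> z * L z (Du z)"
        proof (cases "z \<in> K")
          case True
          then have "z \<in> \<Omega>" using K(2) by blast
          from mult_left_mono[OF convex[OF this, of "Du (z + h n *\<^sub>R e)"] \<psi>(2)[of z]]
          show ?thesis by (simp add: right_diff_distrib)
        qed (simp add: K(3))
      qed
      also have "\<dots> = (LINT z|lborel. \<psi> z * L z (Du (z + h n *\<^sub>R e))) - (LINT z|lborel. \<psi> z * L z (Du z))"
        using i4 s2 by simp
      also have "(LINT z|lborel. \<psi> z * L z (Du (z + h n *\<^sub>R e))) = (LINT z|lborel. \<psi> (z - h n *\<^sub>R e) * L (z - h n *\<^sub>R e) (Du z))"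
        using integral_lborel_translation[of "\<lambda>z. \<psi> (z - h n *\<^sub>R e) * L (z - h n *\<^sub>R e) (Du z)" "h n *\<^sub>R e"]
          borel_measurable_continuous_onI[OF conjunct1[OF s1[of n]]] by simp
      also have "\<dots> - (LINT z|lborel. \<psi> z * L z (Du z)) = (LINT z|lborel. h n * sn n z)"
        using s1[of n] s2 h(1)[of n] by (simp add: sn_def)
      finally have "h n * (LINT z|lborel. dq n z * q z) \<le> h n * (LINT z|lborel. sn n z)" using lhs by simp
      then show ?thesis using h(3)[of n] s by (auto simp: abs_if zero_less_mult_iff mult_le_cancel_left split: if_splits)
    qed
    have "s * R0 \<le> s * S0"
      by (rule LIMSEQ_le[OF tendsto_mult_left[OF R] tendsto_mult_left[OF S(1)]]) (use RS in blast)
    with S(2) show ?thesis by blast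
  qed
  have iL: "integrable lborel (\<lambda>z. L z (Du z) * (\<Psi> z \<bullet> e))"
    using supp[of "\<lambda>z. L z (Du z) * (\<Psi> z \<bullet> e)"] K(4) K'(3) by (force intro!: continuous_intros cL u(2) sub)
  have iA: "integrable lborel (\<lambda>z. (Du z \<bullet> e) * (A z \<bullet> \<Psi> z))"
    using supp[of "\<lambda>z. (Du z \<bullet> e) * (A z \<bullet> \<Psi> z)"] K(4) K'(3) by (force intro!: continuous_intros A u(2) sub)
  have ic: "integrable lborel (\<lambda>z. \<psi> z * (c z * (Du z \<bullet> e)))"
    using supp[of "\<lambda>z. \<psi> z * (c z * (Du z \<bullet> e))"] K(3) K'(3) by (force intro!: continuous_intros c u(2) sub)
  have "integrable lborel (\<lambda>z. - (L z (Du z) * (\<Psi> z \<bullet> e)) - (- (\<Psi> z \<bullet> e) * L z (Du z) - \<psi> z * Le z))"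
    by (rule Bochner_Integration.integrable_diff[OF Bochner_Integration.integrable_minus[OF iL] conjunct2[OF main[OF abs_one]]])
  then show i: "integrable lborel (\<lambda>z. \<psi> z * Le z)" by (simp add: algebra_simps)
  have "R0 = S0" using main[of 1] main[of "-1"] by simp
  moreover have "R0 = (LINT z|lborel. \<psi> z * (c z * (Du z \<bullet> e)) - (Du z \<bullet> e) * (A z \<bullet> \<Psi> z))"
    unfolding R0_def q_def by (intro Bochner_Integration.integral_cong refl) (simp add: algebra_simps)
  moreover have "S0 = (LINT z|lborel. - (L z (Du z) * (\<Psi> z \<bullet> e)) - \<psi> z * Le z)"
    unfolding S0_def by (intro Bochner_Integration.integral_cong refl) (simp add: algebra_simps)
  ultimately show "(LINT z|lborel. L z (Du z) * (\<Psi> z \<bullet> e) - (Du z \<bullet> e) * (A z \<bullet> \<Psi> z))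
      = - (LINT z|lborel. \<psi> z * Le z) - (LINT z|lborel. \<psi> z * (c z * (Du z \<bullet> e)))"
    using iL iA ic i by simp
qed


section \<open>Dependence of the Grushin energy on the base point\<close>

text \<open>With \<open>s = r t\<close> this is \<open>|r\<^sup>a - 1| \<le> |r - 1|\<close>, because \<open>r\<^sup>a\<close> lies between \<open>1\<close> and \<open>r\<close>.\<close>

lemma powr_diff_le:
  fixes s t a :: real
  assumes "s \<ge> 0" "t > 0" "0 < a" "a \<le> 1"
  shows "\<bar>s powr a - t powr a\<bar> \<le> t powr (a - 1) * \<bar>s - t\<bar>"
proof -
  define r where "r = s / t"
  have r: "r \<ge> 0" "s = r * t" using assms by (auto simp: r_def)
  have "\<bar>r powr a - 1\<bar> \<le> \<bar>r - 1\<bar>"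
  proof (cases "r \<ge> 1")
    case True
    then have "r powr a \<ge> 1" using assms by (intro ge_one_powr_ge_zero) auto
    moreover have "r powr a \<le> r" using powr_mono[of a 1 r] True r(1) assms by simp
    ultimately show ?thesis using True by simp
  next
    case False
    have "r \<le> r powr a" using powr_mono'[of a 1 r] False r(1) assms by simp
    moreover have "r powr a \<le> 1" using False r(1) assms by (auto intro: powr_le1)
    ultimately show ?thesis using False r(1) by simp
  qed
  then have "t powr a * \<bar>r powr a - 1\<bar> \<le> t powr a * \<bar>r - 1\<bar>" by (intro mult_left_mono) auto
  moreover have "\<bar>s powr a - t powr a\<bar> = t powr a * \<bar>r powr a - 1\<bar>"
    using assms r by (simp add: powr_mult abs_mult_pos' right_diff_distrib mult.commute)
  moreover have "t powr a * \<bar>r - 1\<bar> = t powr (a - 1) * \<bar>s - t\<bar>"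
  proof -
    have "s - t = t * (r - 1)" by (simp add: r(2) algebra_simps)
    then have "\<bar>s - t\<bar> = t * \<bar>r - 1\<bar>" using assms(2) by (simp add: abs_mult)
    moreover have "t powr a = t powr (a - 1) * t" using assms(2) by (simp add: powr_mult_base mult.commute)
    ultimately show ?thesis by simp
  qed
  ultimately show ?thesis by simp
qed

lemma nn_integral_abs_powr_finite:
  assumes "a > -1"
  shows "(\<integral>\<^sup>+t. ennreal (indicator {-R..R} t * \<bar>t\<bar> powr a) \<partial>lborel) < \<infinity>"
proof -
  define P where "P = (\<integral>\<^sup>+t. ennreal (indicator {0..\<bar>R\<bar>} t * t powr a) \<partial>lborel)"
  have "((\<lambda>x. x powr a) has_integral \<bar>R\<bar> powr (a + 1) / (a + 1)) {0..\<bar>R\<bar>}"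
    by (rule has_integral_powr_from_0) (use assms in auto)
  then have "((\<lambda>t. if t \<in> {0..\<bar>R\<bar>} then t powr a else 0) has_integral \<bar>R\<bar> powr (a + 1) / (a + 1)) UNIV"
    by (simp only: has_integral_restrict_UNIV)
  then have "((\<lambda>t. indicator {0..\<bar>R\<bar>} t * t powr a) has_integral \<bar>R\<bar> powr (a + 1) / (a + 1)) UNIV"
    by (rule has_integral_eq[rotated]) auto
  then have "P = ennreal (\<bar>R\<bar> powr (a + 1) / (a + 1))"
    unfolding P_def by (intro nn_integral_has_integral_lborel) auto
  then have P: "P < \<infinity>" by simp
  have "(\<integral>\<^sup>+t. ennreal (indicator {-R..R} t * \<bar>t\<bar> powr a) \<partial>lborel)
     \<le> (\<integral>\<^sup>+t. ennreal (indicator {0..\<bar>R\<bar>} t * t powr a) + ennreal (indicator {0..\<bar>R\<bar>} (- t) * (- t) powr a) \<partial>lborel)"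
    by (intro nn_integral_mono) (auto simp: indicator_def)
  also have "\<dots> = P + (\<integral>\<^sup>+t. ennreal (indicator {0..\<bar>R\<bar>} (- t) * (- t) powr a) \<partial>lborel)"
    unfolding P_def by (rule nn_integral_add) auto
  also have "(\<integral>\<^sup>+t. ennreal (indicator {0..\<bar>R\<bar>} (- t) * (- t) powr a) \<partial>lborel) = P"
    unfolding P_def by (subst (2) nn_integral_real_affine[where c="-1" and t=0]) auto
  also have "P + P < \<infinity>" using P by simp
  finally show ?thesis .
qed

text \<open>On each line parallel to \<open>e\<close> this is the integrability of \<open>|t|\<^sup>a\<close> near \<open>0\<close>.\<close>

lemma integrable_abs_inner_powr:
  fixes e :: "'a::euclidean_space"
  assumes e: "norm e = 1" and a: "a > -1"
  shows "integrable lborel (\<lambda>z. indicator (cball 0 R) z * \<bar>z \<bullet> e\<bar> powr a)"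
proof (rule integrableI_bounded)
  have [measurable]: "cball (0::'a) R \<in> sets borel" by simp
  show "(\<lambda>z. indicator (cball 0 R) z * \<bar>z \<bullet> e\<bar> powr a) \<in> borel_measurable lborel" by measurable
  define C where "C = (\<integral>\<^sup>+t. ennreal (indicator {-R..R} t * \<bar>t\<bar> powr a) \<partial>lborel)"
  have C: "C < \<infinity>" unfolding C_def by (rule nn_integral_abs_powr_finite[OF a])
  have "(\<integral>\<^sup>+z. ennreal (norm (indicator (cball 0 R) z * \<bar>z \<bullet> e\<bar> powr a)) \<partial>lborel)
     = (\<integral>\<^sup>+z\<in>slab e. (\<integral>\<^sup>+t. ennreal (norm (indicator (cball 0 R) (z + t *\<^sub>R e) * \<bar>(z + t *\<^sub>R e) \<bullet> e\<bar> powr a)) \<partial>lborel) \<partial>lborel)"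
    by (rule nn_integral_slab[OF e]) measurable
  also have "\<dots> \<le> (\<integral>\<^sup>+z. indicator (cball (0::'a) (2 * R + 1)) z * C \<partial>lborel)"
  proof (rule nn_integral_mono)
    fix z :: 'a
    have ee: "e \<bullet> e = 1" using e by (simp add: norm_eq_1)
    show "(\<integral>\<^sup>+t. ennreal (norm (indicator (cball 0 R) (z + t *\<^sub>R e) * \<bar>(z + t *\<^sub>R e) \<bullet> e\<bar> powr a)) \<partial>lborel) * indicator (slab e) z
       \<le> indicator (cball 0 (2 * R + 1)) z * C"
    proof (cases "z \<in> slab e")
      case True
      have "(\<integral>\<^sup>+t. ennreal (norm (indicator (cball 0 R) (z + t *\<^sub>R e) * \<bar>(z + t *\<^sub>R e) \<bullet> e\<bar> powr a)) \<partial>lborel)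
         \<le> (\<integral>\<^sup>+t. indicator (cball 0 (2 * R + 1)) z * ennreal (indicator {-R..R} (z \<bullet> e + 1 * t) * \<bar>z \<bullet> e + 1 * t\<bar> powr a) \<partial>lborel)"
      proof (rule nn_integral_mono)
        fix t :: real
        have "norm z \<le> 2 * R + 1 \<and> \<bar>z \<bullet> e + t\<bar> \<le> R" if "norm (z + t *\<^sub>R e) \<le> R"
        proof -
          have "\<bar>(z + t *\<^sub>R e) \<bullet> e\<bar> \<le> norm (z + t *\<^sub>R e) * norm e" by (rule Cauchy_Schwarz_ineq2)
          then have 1: "\<bar>z \<bullet> e + t\<bar> \<le> R" using that e ee by (simp add: inner_add_left)
          then have "\<bar>t\<bar> \<le> R + 1" using True by auto
          moreover have "norm z \<le> norm (z + t *\<^sub>R e) + norm (t *\<^sub>R e)"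
            using norm_triangle_ineq4[of "z + t *\<^sub>R e" "t *\<^sub>R e"] by simp
          ultimately show ?thesis using 1 that e by simp
        qed
        then show "ennreal (norm (indicator (cball 0 R) (z + t *\<^sub>R e) * \<bar>(z + t *\<^sub>R e) \<bullet> e\<bar> powr a))
          \<le> indicator (cball 0 (2 * R + 1)) z * ennreal (indicator {-R..R} (z \<bullet> e + 1 * t) * \<bar>z \<bullet> e + 1 * t\<bar> powr a)"
          using ee by (auto simp: indicator_def inner_add_left abs_le_iff)
      qed
      also have "\<dots> = indicator (cball 0 (2 * R + 1)) z * (\<integral>\<^sup>+t. ennreal (indicator {-R..R} (z \<bullet> e + 1 * t) * \<bar>z \<bullet> e + 1 * t\<bar> powr a) \<partial>lborel)"
        by (rule nn_integral_cmult) measurable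
      also have "(\<integral>\<^sup>+t. ennreal (indicator {-R..R} (z \<bullet> e + 1 * t) * \<bar>z \<bullet> e + 1 * t\<bar> powr a) \<partial>lborel) = C"
        unfolding C_def by (subst (2) nn_integral_real_affine[where c=1 and t="z \<bullet> e"]) auto
      finally show ?thesis using True by simp
    qed simp
  qed
  also have "\<dots> = emeasure lborel (cball (0::'a) (2 * R + 1)) * C"
    by (subst nn_integral_multc) (simp_all add: borel_measurable_indicator)
  also have "\<dots> < \<infinity>" using C emeasure_compact_finite[OF compact_cball, of "0::'a" "2 * R + 1"]
    by (simp add: ennreal_mult_less_top)
  finally show "(\<integral>\<^sup>+z. ennreal (norm (indicator (cball 0 R) z * \<bar>z \<bullet> e\<bar> powr a)) \<partial>lborel) < \<infinity>" .
qed

abbreviation (input) x_dir :: "'n::finite \<Rightarrow> (real ^ 'n) \<times> (real ^ 'm)" where "x_dir i \<equiv> (axis i 1, 0)"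
abbreviation (input) y_dir :: "'m::finite \<Rightarrow> (real ^ 'n) \<times> (real ^ 'm)" where "y_dir j \<equiv> (0, axis j 1)"

lemma grushin_energy_y_dir [simp]: "grushin_energy p \<gamma> (z + t *\<^sub>R y_dir j) \<xi> = grushin_energy p \<gamma> z \<xi>"
  by (simp add: grushin_energy_def grushin_def)

text \<open>At a point where the Grushin gradient vanishes and \<open>x \<noteq> 0\<close> also \<open>\<xi> = 0\<close>, and both sides are zero. Elsewhere the energy is
  \<open>(|\<xi>\<^sub>x|\<^sup>2 + (x \<cdot> x)\<^sup>\<gamma> |\<xi>\<^sub>y|\<^sup>2)\<^sup>p\<^sup>/\<^sup>2 / p\<close>, a composition of powers of positive numbers.\<close>

lemma grushin_energy_x_derivative:
  fixes z \<xi> :: "(real ^ 'n) \<times> (real ^ 'm)"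
  assumes p: "p > 1" and \<gamma>: "\<gamma> \<ge> 0" and z: "fst z \<noteq> 0"
  shows "((\<lambda>t. grushin_energy p \<gamma> (z + t *\<^sub>R x_dir i) \<xi>) has_real_derivative
     norm (grushin \<gamma> z \<xi>) powr (p - 2) * \<gamma> * norm (fst z) powr (2 * (\<gamma> - 1)) * fst z $ i * (norm (snd \<xi>))\<^sup>2) (at 0)"
proof -
  consider "\<gamma> = 0" | "\<gamma> > 0" "grushin \<gamma> z \<xi> = 0" | "\<gamma> > 0" "grushin \<gamma> z \<xi> \<noteq> 0" using \<gamma> by fastforce
  then show ?thesis
  proof cases
    case 1
    then show ?thesis by (simp add: grushin_energy_def grushin_def grushin_weight_def)
  next
    case 2
    then have "\<xi> = 0" using z by (auto simp: grushin_def grushin_weight_def prod_eq_iff)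
    then show ?thesis by (simp add: grushin_energy_def grushin_def)
  next
    case 3
    define Q where "Q t = (norm (fst \<xi>))\<^sup>2 + ((fst z + t *\<^sub>R axis i 1) \<bullet> (fst z + t *\<^sub>R axis i 1)) powr \<gamma> * (norm (snd \<xi>))\<^sup>2" for t
    have Q: "(norm (grushin \<gamma> (z + t *\<^sub>R x_dir i) \<xi>))\<^sup>2 = Q t" for t
    proof -
      have "(norm x powr \<gamma>)\<^sup>2 = (x \<bullet> x) powr \<gamma>" for x :: "real ^ 'n"
        by (simp add: power2_norm_eq_inner[symmetric] powr_power powr_powr[symmetric] powr_numeral power2_eq_square powr_mult)
      then show ?thesis
        using 3(1) by (simp add: Q_def grushin_def grushin_weight_def norm_Pair power_mult_distrib)
    qed
    have half: "n powr a = (n\<^sup>2) powr (a / 2)" if "n \<ge> 0" for n a :: real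
      using that powr_powr[of n 2 "a/2"] by (simp add: powr_numeral)
    have E: "grushin_energy p \<gamma> (z + t *\<^sub>R x_dir i) \<xi> = 1 / p * Q t powr (p / 2)" for t
      unfolding grushin_energy_def half[OF norm_ge_zero, of _ p] Q ..
    have Q0: "Q 0 > 0" using Q[of 0] 3(2) by (metis scaleR_zero_left add_0_right zero_less_power norm_eq_zero norm_ge_zero less_eq_real_def power2_eq_square)
    have zz: "fst z \<bullet> fst z > 0" using z by simp
    have d1: "((\<lambda>t. (fst z + t *\<^sub>R axis i 1) \<bullet> (fst z + t *\<^sub>R axis i 1)) has_real_derivative 2 * fst z $ i) (at 0)"
      unfolding has_field_derivative_def
      by (auto intro!: derivative_eq_intros simp: inner_axis inner_commute[of _ "fst z"] fun_eq_iff)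
    have "(Q has_real_derivative (\<gamma> * (fst z \<bullet> fst z) powr (\<gamma> - 1) * (2 * fst z $ i)) * (norm (snd \<xi>))\<^sup>2) (at 0)"
      unfolding Q_def[abs_def] using zz
      by (auto intro!: derivative_eq_intros DERIV_fun_powr[THEN DERIV_cong] d1)
    then have "((\<lambda>t. 1 / p * Q t powr (p / 2)) has_real_derivative
       1 / p * (p / 2 * Q 0 powr (p / 2 - 1) * ((\<gamma> * (fst z \<bullet> fst z) powr (\<gamma> - 1) * (2 * fst z $ i)) * (norm (snd \<xi>))\<^sup>2))) (at 0)"
      using Q0 by (intro DERIV_cmult DERIV_fun_powr[THEN DERIV_cong]) auto
    moreover have "Q 0 powr (p / 2 - 1) = norm (grushin \<gamma> z \<xi>) powr (p - 2)"
      using Q[of 0] half[of "norm (grushin \<gamma> z \<xi>)" "p - 2"] by (simp add: diff_divide_distrib flip: zero_prod_def)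
    moreover have "(fst z \<bullet> fst z) powr (\<gamma> - 1) = norm (fst z) powr (2 * (\<gamma> - 1))"
      using half[of "norm (fst z)" "2 * (\<gamma> - 1)"] by (simp add: power2_norm_eq_inner diff_divide_distrib)
    ultimately show ?thesis unfolding E using p by (simp add: mult_ac)
  qed
qed

text \<open>The energy is a Lipschitz function of the weight, so only the increment of \<open>|x|\<^sup>\<gamma>\<close> matters. It is at most
  \<open>|t| |x|\<^sup>\<gamma>\<^sup>-\<^sup>1 \<le> |t| |x\<^sub>i|\<^sup>\<gamma>\<^sup>-\<^sup>1\<close> for \<open>0 < \<gamma> \<le> 1\<close>, and for \<open>\<gamma> > 1\<close> the weight itself is locally Lipschitz.\<close>

lemma grushin_energy_x_domination:
  fixes i :: "'n::finite"
  assumes p: "p > 1" and \<gamma>: "\<gamma> \<ge> 0"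
  obtains M :: "(real ^ 'n) \<times> (real ^ 'm) \<Rightarrow> real" where "integrable lborel M"
    "\<And>z \<xi> t. norm z \<le> R \<Longrightarrow> norm \<xi> \<le> B \<Longrightarrow> z \<bullet> x_dir i \<noteq> 0 \<Longrightarrow> \<bar>t\<bar> \<le> 1 \<Longrightarrow>
       \<bar>grushin_energy p \<gamma> (z + t *\<^sub>R x_dir i) \<xi> - grushin_energy p \<gamma> z \<xi>\<bar> \<le> M z * \<bar>t\<bar>"
proof -
  define e :: "(real ^ 'n) \<times> (real ^ 'm)" where "e = x_dir i"
  have e: "norm e = 1" by (simp add: e_def norm_Pair norm_axis_1)
  obtain m :: "(real ^ 'n) \<times> (real ^ 'm) \<Rightarrow> real" where m: "integrable lborel m"
    "\<And>z t. norm z \<le> R \<Longrightarrow> z \<bullet> e \<noteq> 0 \<Longrightarrow> \<bar>t\<bar> \<le> 1 \<Longrightarrow>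
       \<bar>grushin_weight \<gamma> (fst (z + t *\<^sub>R e)) - grushin_weight \<gamma> (fst z)\<bar> \<le> m z * \<bar>t\<bar>"
  proof -
    have nd: "\<bar>norm (fst (z + t *\<^sub>R e)) - norm (fst z)\<bar> \<le> \<bar>t\<bar>" for z t
      using norm_triangle_ineq3[of "fst (z + t *\<^sub>R e)" "fst z"] by (simp add: e_def norm_axis_1)
    consider "\<gamma> = 0" | "\<gamma> > 0" "\<gamma> \<le> 1" | "\<gamma> > 1" using \<gamma> by fastforce
    then show thesis
    proof cases
      case 1
      then show thesis by (intro that[of "\<lambda>_. 0"]) (auto simp: grushin_weight_def)
    next
      case 2
      show thesis
      proof (rule that)
        show "integrable lborel (\<lambda>z. indicator (cball 0 R) z * \<bar>z \<bullet> e\<bar> powr (\<gamma> - 1))"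
          by (rule integrable_abs_inner_powr[OF e]) (use 2 in auto)
        fix z t assume zt: "norm z \<le> R" "z \<bullet> e \<noteq> 0" "\<bar>t\<bar> \<le> (1::real)"
        have ze: "z \<bullet> e = fst z $ i" by (simp add: e_def inner_prod_def inner_axis)
        have le: "\<bar>z \<bullet> e\<bar> \<le> norm (fst z)" unfolding ze by (rule component_le_norm_cart)
        have "\<bar>grushin_weight \<gamma> (fst (z + t *\<^sub>R e)) - grushin_weight \<gamma> (fst z)\<bar>
           \<le> norm (fst z) powr (\<gamma> - 1) * \<bar>norm (fst (z + t *\<^sub>R e)) - norm (fst z)\<bar>"
          unfolding grushin_weight_def using 2 le zt(2) by (simp del: fst_add) (rule powr_diff_le, auto)
        also have "\<dots> \<le> \<bar>z \<bullet> e\<bar> powr (\<gamma> - 1) * \<bar>t\<bar>"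
          using 2 le zt(2) by (intro mult_mono nd powr_mono2') auto
        finally show "\<bar>grushin_weight \<gamma> (fst (z + t *\<^sub>R e)) - grushin_weight \<gamma> (fst z)\<bar>
           \<le> indicator (cball 0 R) z * \<bar>z \<bullet> e\<bar> powr (\<gamma> - 1) * \<bar>t\<bar>" using zt by simp
      qed
    next
      case 3
      show thesis
      proof (rule that)
        show "integrable lborel (\<lambda>z::(real ^ 'n) \<times> (real ^ 'm). indicator (cball 0 R) z * (\<gamma> * (R + 1) powr (\<gamma> - 1)))"
          using emeasure_compact_finite[OF compact_cball, of "0::(real ^ 'n) \<times> (real ^ 'm)" R]
          by (intro integrable_mult_left integrable_real_indicator) auto
        fix z t assume zt: "norm z \<le> R" "z \<bullet> e \<noteq> 0" "\<bar>t\<bar> \<le> (1::real)"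
        have "norm (fst z) \<le> R" using zt(1) norm_fst_le[of "fst z" "snd z"] by simp
        with nd[of z t] zt(3) have b: "norm (fst z) \<le> R + 1" "norm (fst (z + t *\<^sub>R e)) \<le> R + 1" by auto
        have "\<bar>1 / \<gamma> * norm (fst (z + t *\<^sub>R e)) powr \<gamma> - 1 / \<gamma> * norm (fst z) powr \<gamma>\<bar>
            \<le> (R + 1) powr (\<gamma> - 1) * norm (fst (z + t *\<^sub>R e) - fst z)"
          by (rule power_energy_Lipschitz[OF 3 b])
        also have "norm (fst (z + t *\<^sub>R e) - fst z) = \<bar>t\<bar>" by (simp add: e_def norm_axis_1)
        finally show "\<bar>grushin_weight \<gamma> (fst (z + t *\<^sub>R e)) - grushin_weight \<gamma> (fst z)\<bar>
           \<le> indicator (cball 0 R) z * (\<gamma> * (R + 1) powr (\<gamma> - 1)) * \<bar>t\<bar>"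
          using zt 3 by (simp add: grushin_weight_def right_diff_distrib[symmetric] abs_mult field_simps del: fst_add)
      qed
    qed
  qed
  obtain C where C: "C \<ge> 0" "\<And>z::(real ^ 'n) \<times> (real ^ 'm). z \<in> cball 0 (R + 1) \<Longrightarrow> grushin_weight \<gamma> (fst z) \<le> C"
    by (rule grushin_weight_bounded[OF \<gamma> bounded_cball]) (rule that)
  define S where "S = (1 + C) * B"
  show thesis
  proof (rule that)
    show "integrable lborel (\<lambda>z. S powr (p - 1) * B * \<bar>m z\<bar>)" using m(1) by auto
    fix z \<xi> :: "(real ^ 'n) \<times> (real ^ 'm)" and t :: real
    assume zt: "norm z \<le> R" "norm \<xi> \<le> B" "z \<bullet> x_dir i \<noteq> 0" "\<bar>t\<bar> \<le> 1"
    have B: "B \<ge> 0" using zt(2) norm_ge_zero order_trans by blast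
    have S: "norm (grushin \<gamma> z' \<xi>) \<le> S" if "norm z' \<le> R + 1" for z'
    proof -
      have "norm (grushin \<gamma> z' \<xi>) \<le> (1 + C) * norm \<xi>" by (rule norm_grushin_le[OF C(2)]) (use that in simp)
      also have "\<dots> \<le> S" unfolding S_def by (intro mult_left_mono zt) (use C(1) in auto)
      finally show ?thesis .
    qed
    have "norm (z + t *\<^sub>R e) \<le> R + 1" using norm_triangle_ineq[of z "t *\<^sub>R e"] zt e by simp
    then have d: "\<bar>grushin_energy p \<gamma> (z + t *\<^sub>R e) \<xi> - grushin_energy p \<gamma> z \<xi>\<bar>
       \<le> S powr (p - 1) * norm (grushin \<gamma> (z + t *\<^sub>R e) \<xi> - grushin \<gamma> z \<xi>)"
      unfolding grushin_energy_def using zt(1) by (intro power_energy_Lipschitz p S) auto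
    have "norm (grushin \<gamma> (z + t *\<^sub>R e) \<xi> - grushin \<gamma> z \<xi>) =
      \<bar>grushin_weight \<gamma> (fst (z + t *\<^sub>R e)) - grushin_weight \<gamma> (fst z)\<bar> * norm (snd \<xi>)"
      by (simp add: grushin_def norm_Pair scaleR_diff_left[symmetric])
    also have "\<dots> \<le> (\<bar>m z\<bar> * \<bar>t\<bar>) * B"
    proof (intro mult_mono)
      have "\<bar>grushin_weight \<gamma> (fst (z + t *\<^sub>R e)) - grushin_weight \<gamma> (fst z)\<bar> \<le> m z * \<bar>t\<bar>"
        using zt by (intro m(2)) (auto simp: e_def)
      also have "\<dots> \<le> \<bar>m z\<bar> * \<bar>t\<bar>" by (intro mult_right_mono) auto
      finally show "\<bar>grushin_weight \<gamma> (fst (z + t *\<^sub>R e)) - grushin_weight \<gamma> (fst z)\<bar> \<le> \<bar>m z\<bar> * \<bar>t\<bar>" .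
      show "norm (snd \<xi>) \<le> B" using zt(2) norm_snd_le[of "snd \<xi>" "fst \<xi>"] by simp
    qed auto
    finally have "S powr (p - 1) * norm (grushin \<gamma> (z + t *\<^sub>R e) \<xi> - grushin \<gamma> z \<xi>) \<le> S powr (p - 1) * ((\<bar>m z\<bar> * \<bar>t\<bar>) * B)"
      by (intro mult_left_mono) auto
    from order_trans[OF d this]
    show "\<bar>grushin_energy p \<gamma> (z + t *\<^sub>R x_dir i) \<xi> - grushin_energy p \<gamma> z \<xi>\<bar> \<le> S powr (p - 1) * B * \<bar>m z\<bar> * \<bar>t\<bar>"
      by (simp only: e_def mult_ac)
  qed
qed


section \<open>The primitive along a function\<close>

context
  fixes f :: "'a::euclidean_space \<Rightarrow> real \<Rightarrow> real"
  assumes f: "continuous_on UNIV (\<lambda>(z, s). f z s)"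
begin

lemma continuous_on_f: "continuous_on S a \<Longrightarrow> continuous_on S b \<Longrightarrow> continuous_on S (\<lambda>z. f (a z) (b z))"
  using continuous_on_compose2[OF f continuous_on_Pair, of S a b] by simp

lemma primitive_DERIV: "(primitive f z has_real_derivative f z s) (at s)"
proof -
  let ?b = "\<bar>s\<bar> + 1"
  have "((\<lambda>x. LBINT t=ereal 0..ereal x. f z t) has_vector_derivative f z s) (at s within {-?b..?b})"
    by (rule interval_integral_FTC2) (auto intro!: continuous_on_f continuous_intros)
  moreover have "at s within {-?b..?b} = at s" by (rule at_within_interior) auto
  ultimately show ?thesis by (simp add: primitive_def[abs_def] has_real_derivative_iff_has_vector_derivative)
qed

lemma primitive_0 [simp]: "primitive f z 0 = 0"
  by (simp add: primitive_def)

text \<open>An integral over a fixed interval, to which theorems on parameter integrals apply.\<close>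

lemma primitive_eq_integral: "primitive f z s = s * integral (cbox 0 1) (\<lambda>\<tau>. f z (s * \<tau>))"
proof -
  have "((\<lambda>\<tau>. f z (s * \<tau>) * s) has_integral primitive f z (s * 1) - primitive f z (s * 0)) {0..1}"
  proof (rule fundamental_theorem_of_calculus)
    fix \<tau> :: real
    have "((\<lambda>\<tau>. primitive f z (s * \<tau>)) has_real_derivative f z (s * \<tau>) * s) (at \<tau>)"
      by (rule DERIV_chain2[OF primitive_DERIV]) (auto intro!: derivative_eq_intros)
    then show "((\<lambda>\<tau>. primitive f z (s * \<tau>)) has_vector_derivative f z (s * \<tau>) * s) (at \<tau> within {0..1})"
      by (simp add: has_real_derivative_iff_has_vector_derivative has_vector_derivative_at_within)
  qed simp
  then have "integral {0..1} (\<lambda>\<tau>. f z (s * \<tau>) * s) = primitive f z s"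
    by (intro integral_unique) simp
  then show ?thesis by (simp add: mult.commute)
qed

lemma primitive_continuous:
  assumes "continuous_on S a" "continuous_on S b"
  shows "continuous_on S (\<lambda>z. primitive f (a z) (b z))"
proof -
  have "continuous_on S (\<lambda>z. integral (cbox 0 1) (\<lambda>\<tau>. f (a z) (b z * \<tau>)))"
  proof (rule integral_continuous_on_param)
    have "continuous_on (S \<times> cbox 0 1) (\<lambda>w. f (a (fst w)) (b (fst w) * snd w))"
      by (intro continuous_on_f continuous_intros continuous_on_compose2[OF assms(1)] continuous_on_compose2[OF assms(2)]) auto
    then show "continuous_on (S \<times> cbox 0 1) (\<lambda>(z, \<tau>). f (a z) (b z * \<tau>))" by (simp add: split_beta')
  qed
  then show ?thesis unfolding primitive_eq_integral using assms by (intro continuous_intros)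
qed

text \<open>The increment of \<open>F(z, u(z))\<close> is split at \<open>F(z + t e, u(z))\<close>. The explicit part is differentiable by assumption. The other part is, by the mean
  value theorem, \<open>f(z + t e, \<xi>)\<close> times the increment of \<open>u\<close> with \<open>\<xi>\<close> between the two values of \<open>u\<close>; joint
  continuity of \<open>f\<close> gives the limit.\<close>

lemma primitive_total_derivative:
  fixes u :: "'a \<Rightarrow> real"
  assumes u: "GDERIV u z :> Du" and F: "(\<lambda>t. primitive f (z + t *\<^sub>R e) (u z)) differentiable (at 0)"
  shows "((\<lambda>t. primitive f (z + t *\<^sub>R e) (u (z + t *\<^sub>R e))) has_real_derivative
     explicit_partial e (primitive f) z (u z) + f z (u z) * (Du \<bullet> e)) (at 0)"
proof -
  let ?u = "\<lambda>t. u (z + t *\<^sub>R e)"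
  have "\<exists>\<xi>. \<bar>\<xi> - u z\<bar> \<le> \<bar>?u t - u z\<bar> \<and>
      primitive f (z + t *\<^sub>R e) (?u t) - primitive f (z + t *\<^sub>R e) (u z) = f (z + t *\<^sub>R e) \<xi> * (?u t - u z)" for t
  proof -
    have M: "\<exists>\<xi>. a < \<xi> \<and> \<xi> < b \<and> primitive f y b - primitive f y a = (b - a) * f y \<xi>" if "a < b" for a b y
      using MVT2[OF that, of "primitive f y" "f y"] primitive_DERIV by blast
    consider "?u t = u z" | "?u t < u z" | "?u t > u z" by linarith
    then show ?thesis
    proof cases
      case 1 then show ?thesis by (intro exI[of _ "u z"]) simp
    next
      case 2
      from M[OF this, of "z + t *\<^sub>R e"] obtain \<xi> where \<xi>: "?u t < \<xi>" "\<xi> < u z"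
        "primitive f (z + t *\<^sub>R e) (u z) - primitive f (z + t *\<^sub>R e) (?u t) = (u z - ?u t) * f (z + t *\<^sub>R e) \<xi>" by blast
      then show ?thesis by (intro exI[of _ \<xi>]) (auto simp: algebra_simps)
    next
      case 3
      from M[OF this, of "z + t *\<^sub>R e"] obtain \<xi> where \<xi>: "u z < \<xi>" "\<xi> < ?u t"
        "primitive f (z + t *\<^sub>R e) (?u t) - primitive f (z + t *\<^sub>R e) (u z) = (?u t - u z) * f (z + t *\<^sub>R e) \<xi>" by blast
      then show ?thesis by (intro exI[of _ \<xi>]) (auto simp: algebra_simps)
    qed
  qed
  \<comment> \<open>The intermediate value as a function of \<open>t\<close>; nothing is known about it but that it is squeezed to \<open>u z\<close>.\<close>
  then obtain \<xi> where \<xi>: "\<bar>\<xi> t - u z\<bar> \<le> \<bar>?u t - u z\<bar>"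
      "primitive f (z + t *\<^sub>R e) (?u t) - primitive f (z + t *\<^sub>R e) (u z) = f (z + t *\<^sub>R e) (\<xi> t) * (?u t - u z)" for t
    by metis
  have du: "(?u has_real_derivative Du \<bullet> e) (at 0)" by (rule GDERIV_line[OF u])
  have "isCont ?u 0" by (rule DERIV_isCont[OF du])
  then have "(?u \<longlongrightarrow> u z) (at 0)" by (simp add: isCont_def)
  then have "((\<lambda>t. \<bar>?u t - u z\<bar>) \<longlongrightarrow> 0) (at 0)" by (simp add: LIM_zero tendsto_rabs_zero)
  then have "((\<lambda>t. \<xi> t - u z) \<longlongrightarrow> 0) (at 0)"
    by (rule Lim_null_comparison[rotated]) (auto intro!: always_eventually \<xi>(1))
  then have \<xi>0: "(\<xi> \<longlongrightarrow> u z) (at 0)" by (rule LIM_zero_cancel)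
  have z0: "((\<lambda>t. z + t *\<^sub>R e) \<longlongrightarrow> z) (at 0)"
    using tendsto_add[OF tendsto_const[of z] tendsto_scaleR[OF tendsto_ident_at tendsto_const[of e]], of 0 UNIV] by simp
  have "isCont (\<lambda>(z, s). f z s) (z, u z)" using f by (simp add: continuous_on_eq_continuous_at)
  from isCont_tendsto_compose[OF this tendsto_Pair[OF z0 \<xi>0]]
  have f0: "((\<lambda>t. f (z + t *\<^sub>R e) (\<xi> t)) \<longlongrightarrow> f z (u z)) (at 0)" by simp
  have "((\<lambda>t. (?u t - u z) / t) \<longlongrightarrow> Du \<bullet> e) (at 0)" using du by (simp add: DERIV_def)
  from tendsto_mult[OF f0 this]
  have 1: "((\<lambda>t. (primitive f (z + t *\<^sub>R e) (?u t) - primitive f (z + t *\<^sub>R e) (u z)) / t) \<longlongrightarrow> f z (u z) * (Du \<bullet> e)) (at 0)"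
    by (simp add: \<xi>(2))
  have "((\<lambda>t. primitive f (z + t *\<^sub>R e) (u z)) has_real_derivative explicit_partial e (primitive f) z (u z)) (at 0)"
    unfolding explicit_partial_def using F by (simp add: DERIV_deriv_iff_real_differentiable)
  then have 2: "((\<lambda>t. (primitive f (z + t *\<^sub>R e) (u z) - primitive f z (u z)) / t) \<longlongrightarrow> explicit_partial e (primitive f) z (u z)) (at 0)"
    by (simp add: DERIV_def)
  show ?thesis
    using tendsto_add[OF 2 1] by (simp add: DERIV_def add_divide_distrib[symmetric])
qed

text \<open>A pointwise limit of difference quotients, which are continuous in \<open>z\<close>.\<close>

lemma explicit_partial_measurable:
  fixes u :: "'a \<Rightarrow> real"
  assumes D: "open D" and u: "continuous_on D u"
    and F: "\<And>z. z \<in> D \<Longrightarrow> (\<lambda>t. primitive f (z + t *\<^sub>R e) (u z)) differentiable (at 0)"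
  shows "(\<lambda>z. indicator D z * explicit_partial e (primitive f) z (u z)) \<in> borel_measurable borel"
proof (rule borel_measurable_LIMSEQ_real)
  define h where "h n = inverse (real (Suc n))" for n
  show "(\<lambda>z. indicator D z *\<^sub>R ((primitive f (z + h n *\<^sub>R e) (u z) - primitive f z (u z)) / h n)) \<in> borel_measurable borel" for n
    using D by (intro borel_measurable_continuous_on_indicator primitive_continuous continuous_intros u)
      (auto simp: h_def)
  fix z :: 'a
  show "(\<lambda>n. indicator D z *\<^sub>R ((primitive f (z + h n *\<^sub>R e) (u z) - primitive f z (u z)) / h n))
    \<longlonglongrightarrow> indicator D z * explicit_partial e (primitive f) z (u z)"
  proof (cases "z \<in> D")
    case True
    have "((\<lambda>t. primitive f (z + t *\<^sub>R e) (u z)) has_real_derivative explicit_partial e (primitive f) z (u z)) (at 0)"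
      unfolding explicit_partial_def using F[OF True] by (simp add: DERIV_deriv_iff_real_differentiable)
    moreover have "h \<longlonglongrightarrow> 0" unfolding h_def[abs_def] by (rule LIMSEQ_inverse_real_of_nat)
    moreover have "h n \<noteq> 0" for n by (simp add: h_def)
    ultimately show ?thesis using LIMSEQ_difference_quotient True by fastforce
  qed simp
qed

text \<open>The function \<open>\<psi>(z) F(z, u(z))\<close> has compact support and an integrable derivative in the direction \<open>e\<close> at every point,
  although neither this derivative nor \<open>\<partial>F/\<partial>e\<close> has to be continuous.\<close>

lemma primitive_integration_by_parts:
  fixes u :: "'a \<Rightarrow> real"
  assumes D: "open D" and u: "\<And>z. z \<in> D \<Longrightarrow> GDERIV u z :> Du z" "continuous_on D Du" and e: "norm e = 1"
    and F: "\<And>z. z \<in> D \<Longrightarrow> (\<lambda>t. primitive f (z + t *\<^sub>R e) (u z)) differentiable (at 0)"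
      "set_integrable lebesgue D (\<lambda>z. explicit_partial e (primitive f) z (u z))"
    and \<psi>: "C1_compact D \<psi> \<Psi>"
  shows "integrable lborel (\<lambda>z. \<psi> z * explicit_partial e (primitive f) z (u z))"
    and "(LINT z|lborel. primitive f z (u z) * (\<Psi> z \<bullet> e))
      = - (LINT z|lborel. \<psi> z * explicit_partial e (primitive f) z (u z)) - (LINT z|lborel. \<psi> z * (f z (u z) * (Du z \<bullet> e)))"
proof -
  let ?F = "\<lambda>z. explicit_partial e (primitive f) z (u z)"
  obtain K where K: "compact K" "K \<subseteq> D" "\<And>z. z \<notin> K \<Longrightarrow> \<psi> z = 0" "\<And>z. z \<notin> K \<Longrightarrow> \<Psi> z = 0"
    "\<And>z. GDERIV \<psi> z :> \<Psi> z" "continuous_on UNIV \<psi>" "continuous_on UNIV \<Psi>"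
    by (rule C1_compactE[OF \<psi>]) (rule that)
  have cu: "continuous_on D u"
    by (intro continuous_at_imp_continuous_on ballI GDERIV_imp_isCont[OF u(1)])
  have supp: "integrable lborel v" if "continuous_on D v" "\<And>z. z \<notin> K \<Longrightarrow> v z = 0" for v :: "'a \<Rightarrow> real"
    by (rule integrable_compact_support[OF continuous_on_compact_support[OF that(1) D K(1,2) that(2)] K(1) that(2)])
  have sub: "continuous_on D \<psi>" "continuous_on D \<Psi>"
    using continuous_on_subset[OF K(6)] continuous_on_subset[OF K(7)] by auto
  have i1: "integrable lborel (\<lambda>z. primitive f z (u z) * (\<Psi> z \<bullet> e))"
    by (rule supp) (auto intro!: continuous_intros primitive_continuous cu sub simp: K(4))
  have i2: "integrable lborel (\<lambda>z. \<psi> z * (f z (u z) * (Du z \<bullet> e)))"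
    by (rule supp) (auto intro!: continuous_intros continuous_on_f cu u(2) sub simp: K(3))
  have "integrable lebesgue (\<lambda>z. indicator D z * ?F z)" using F(2) by (simp add: set_integrable_def)
  then have iF: "integrable lborel (\<lambda>z. indicator D z * ?F z)"
    by (subst (asm) integrable_completion) (simp_all add: explicit_partial_measurable[OF D cu F(1)])
  obtain B where B: "B > 0" "\<And>z. norm (\<psi> z) \<le> B" using bounded_compact_support[OF K(6,1,3)] by blast
  have eq: "\<psi> z * (indicator D z * ?F z) = \<psi> z * ?F z" for z
    using K(2,3) by (cases "z \<in> D") auto
  have "integrable lborel (\<lambda>z. \<psi> z * (indicator D z * ?F z))"
  proof (rule Bochner_Integration.integrable_bound)
    show "integrable lborel (\<lambda>z. B * (indicator D z * ?F z))" using iF by (rule integrable_mult_right)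
    show "(\<lambda>z. \<psi> z * (indicator D z * ?F z)) \<in> borel_measurable lborel"
      using borel_measurable_continuous_onI[OF K(6)]
      by (intro borel_measurable_times borel_measurable_integrable[OF iF]) simp
    show "AE z in lborel. norm (\<psi> z * (indicator D z * ?F z)) \<le> norm (B * (indicator D z * ?F z))"
      using B by (auto simp: abs_mult intro!: mult_right_mono)
  qed
  then show i3: "integrable lborel (\<lambda>z. \<psi> z * ?F z)" by (simp only: eq)
  have "(LINT z|lborel. primitive f z (u z) * (\<Psi> z \<bullet> e) + \<psi> z * ?F z + \<psi> z * (f z (u z) * (Du z \<bullet> e))) = 0"
  proof (rule integral_directional_derivative_eq_0[OF e _ compact_imp_bounded[OF K(1)]])
    fix z
    show "z \<notin> K \<Longrightarrow> \<psi> z * primitive f z (u z) = 0" by (simp add: K(3))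
    show "((\<lambda>t. \<psi> (z + t *\<^sub>R e) * primitive f (z + t *\<^sub>R e) (u (z + t *\<^sub>R e))) has_real_derivative
        primitive f z (u z) * (\<Psi> z \<bullet> e) + \<psi> z * ?F z + \<psi> z * (f z (u z) * (Du z \<bullet> e))) (at 0)"
    proof (cases "z \<in> D")
      case True
      from DERIV_mult[OF GDERIV_line[OF K(5)[of z], of e] primitive_total_derivative[OF u(1)[OF True] F(1)[OF True]]]
      show ?thesis by (simp add: algebra_simps)
    next
      case False
      then have z: "z \<notin> K" using K(2) by blast
      have "open ((\<lambda>t::real. z + t *\<^sub>R e) -` (- K))"
        using K(1) by (intro open_vimage continuous_intros) (simp add: compact_imp_closed open_Compl)
      then have ev: "\<forall>\<^sub>F t in nhds 0. z + t *\<^sub>R e \<notin> K"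
        using z eventually_nhds_in_open[of "(\<lambda>t::real. z + t *\<^sub>R e) -` (- K)" 0] by simp
      have "((\<lambda>t. \<psi> (z + t *\<^sub>R e) * primitive f (z + t *\<^sub>R e) (u (z + t *\<^sub>R e))) has_real_derivative 0) (at 0)
        = ((\<lambda>t. 0) has_real_derivative 0) (at (0::real))"
        by (rule DERIV_cong_ev[OF refl _ refl]) (use ev in eventually_elim, simp add: K(3))
      then show ?thesis by (simp add: K(3,4)[OF z])
    qed
  qed (intro Bochner_Integration.integrable_add i1 i2 i3)
  then show "(LINT z|lborel. primitive f z (u z) * (\<Psi> z \<bullet> e))
      = - (LINT z|lborel. \<psi> z * ?F z) - (LINT z|lborel. \<psi> z * (f z (u z) * (Du z \<bullet> e)))"
    using i1 i2 i3 by simp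
qed

end


section \<open>The divergence of the Grushin energy field\<close>

lemma AE_inner_neq_0:
  fixes e :: "'a::euclidean_space"
  assumes "e \<noteq> 0"
  shows "AE z in lborel. z \<bullet> e \<noteq> 0"
proof -
  have "negligible {z. e \<bullet> z = 0}" using assms by (intro negligible_hyperplane) auto
  moreover have "{z. e \<bullet> z = 0} \<in> sets lborel" by (simp add: closed_hyperplane borel_closed)
  ultimately have "{z. e \<bullet> z = 0} \<in> null_sets lborel"
    by (simp add: negligible_iff_null_sets null_sets_completion_iff)
  from AE_not_in[OF this] show ?thesis by (simp add: inner_commute)
qed

text \<open>A bound for difference quotients passes to the derivative.\<close>

lemma integrable_derivative_of_dominated:
  fixes g :: "'a::euclidean_space \<Rightarrow> real \<Rightarrow> real"
  assumes M: "integrable lborel M"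
    and dom: "AE z in lborel. z \<in> D \<longrightarrow> (\<forall>t. \<bar>t\<bar> \<le> 1 \<longrightarrow> \<bar>g z t - g z 0\<bar> \<le> M z * \<bar>t\<bar>)"
    and g': "AE z in lborel. z \<in> D \<longrightarrow> (g z has_real_derivative g' z) (at 0)"
    and m: "(\<lambda>z. indicator D z * g' z) \<in> borel_measurable borel"
  shows "integrable lborel (\<lambda>z. indicator D z * g' z)"
proof (rule Bochner_Integration.integrable_bound[OF M])
  show "AE z in lborel. norm (indicator D z * g' z) \<le> norm (M z)"
    using dom g'
  proof eventually_elim
    case (elim z)
    show ?case
    proof (cases "z \<in> D")
      case True
      define h where "h n = inverse (real (Suc n))" for n
      have "h \<longlonglongrightarrow> 0" unfolding h_def[abs_def] by (rule LIMSEQ_inverse_real_of_nat)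
      moreover have h0: "h n \<noteq> 0" "\<bar>h n\<bar> \<le> 1" for n by (auto simp: h_def field_simps)
      ultimately have "(\<lambda>n. (g z (h n) - g z 0) / h n) \<longlonglongrightarrow> g' z"
        using elim(2) True by (intro LIMSEQ_difference_quotient) auto
      then have "(\<lambda>n. \<bar>(g z (h n) - g z 0) / h n\<bar>) \<longlonglongrightarrow> \<bar>g' z\<bar>" by (rule tendsto_rabs)
      moreover have "\<bar>(g z (h n) - g z 0) / h n\<bar> \<le> M z" for n
        using elim(1) True h0[of n] by (simp add: abs_divide pos_divide_le_eq)
      ultimately have "\<bar>g' z\<bar> \<le> M z" by (intro LIMSEQ_le_const2) auto
      then show ?thesis using True by simp
    qed simp
  qed
qed (use m in simp)

text \<open>The \<open>e\<close>-row of the energy-momentum tensor, with the potential energy \<open>F(z, u)\<close> subtracted.\<close>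

definition grushin_field where
  "grushin_field p \<gamma> f u Du e z = grushin_energy p \<gamma> z (Du z) *\<^sub>R e - (Du z \<bullet> e) *\<^sub>R grushin_flux p \<gamma> z (Du z)
     - primitive f z (u z) *\<^sub>R e"

text \<open>The terms \<open>f(z, u) \<partial>\<^sub>e u\<close> in the divergences of the energy part and of \<open>F(z, u) e\<close> are equal and cancel.\<close>

lemma grushin_field_divergence:
  fixes u :: "(real ^ 'n) \<times> (real ^ 'm) \<Rightarrow> real"
  assumes D: "open D" and p: "p > 1" and \<gamma>: "\<gamma> \<ge> 0"
    and f: "continuous_on UNIV (\<lambda>(z, s). f z s)"
    and u: "\<And>z. z \<in> D \<Longrightarrow> GDERIV u z :> Du z" "continuous_on D Du" and e: "norm e = 1"
    and weak: "\<And>\<phi> \<Phi>. C1_compact D \<phi> \<Phi> \<Longrightarrow>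
      (LINT z|lborel. grushin_flux p \<gamma> z (Du z) \<bullet> \<Phi> z) = (LINT z|lborel. f z (u z) * \<phi> z)"
    and F: "\<And>z. z \<in> D \<Longrightarrow> (\<lambda>t. primitive f (z + t *\<^sub>R e) (u z)) differentiable (at 0)"
      "set_integrable lebesgue D (\<lambda>z. explicit_partial e (primitive f) z (u z))"
    and M: "integrable lborel M"
      "AE z in lborel. z \<in> D \<longrightarrow> (\<forall>t. \<bar>t\<bar> \<le> 1 \<longrightarrow>
         \<bar>grushin_energy p \<gamma> (z + t *\<^sub>R e) (Du z) - grushin_energy p \<gamma> z (Du z)\<bar> \<le> M z * \<bar>t\<bar>)"
    and Le: "AE z in lborel. z \<in> D \<longrightarrow> ((\<lambda>t. grushin_energy p \<gamma> (z + t *\<^sub>R e) (Du z)) has_real_derivative Le z) (at 0)"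
      "(\<lambda>z. indicator D z * Le z) \<in> borel_measurable borel"
    and \<psi>: "C1_compact D \<psi> \<Psi>" "\<And>z. \<psi> z \<ge> 0"
  shows "(LINT z|lborel. grushin_field p \<gamma> f u Du e z \<bullet> \<Psi> z) =
     - (LINT z|lborel. \<psi> z * (Le z - explicit_partial e (primitive f) z (u z)))"
proof -
  obtain K where K: "compact K" "K \<subseteq> D" "\<And>z. z \<notin> K \<Longrightarrow> \<psi> z = 0" "\<And>z. z \<notin> K \<Longrightarrow> \<Psi> z = 0"
    "\<And>z. GDERIV \<psi> z :> \<Psi> z" "continuous_on UNIV \<psi>" "continuous_on UNIV \<Psi>"
    by (rule C1_compactE[OF \<psi>(1)]) (rule that)
  have cu: "continuous_on D u"
    by (intro continuous_at_imp_continuous_on ballI GDERIV_imp_isCont[OF u(1)])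
  have supp: "integrable lborel v" if "continuous_on D v" "\<And>z. z \<notin> K \<Longrightarrow> v z = 0" for v :: "_ \<Rightarrow> real"
    by (rule integrable_compact_support[OF continuous_on_compact_support[OF that(1) D K(1,2) that(2)] K(1) that(2)])
  have sub: "continuous_on D \<Psi>" using continuous_on_subset[OF K(7)] by auto
  have cA: "continuous_on D (\<lambda>z. grushin_flux p \<gamma> z (Du z))"
    by (intro continuous_intros p \<gamma> u(2))
  have cf: "continuous_on D (\<lambda>z. f z (u z))" by (intro continuous_on_f[OF f] continuous_intros cu)
  have cL: "continuous_on UNIV (\<lambda>(z, \<xi>). grushin_energy p \<gamma> z \<xi>)"
    unfolding split_beta' using p by (intro continuous_intros \<gamma>) auto
  have dom: "\<exists>\<delta>>0. \<exists>M. integrable lborel M \<and>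
        (AE z in lborel. z \<in> K \<longrightarrow> (\<forall>t. \<bar>t\<bar> \<le> \<delta> \<longrightarrow> \<bar>grushin_energy p \<gamma> (z + t *\<^sub>R e) (Du z) - grushin_energy p \<gamma> z (Du z)\<bar> \<le> M z * \<bar>t\<bar>))"
    if "compact K" "K \<subseteq> D" for K
  proof -
    have "AE z in lborel. z \<in> K \<longrightarrow> (\<forall>t. \<bar>t\<bar> \<le> 1 \<longrightarrow> \<bar>grushin_energy p \<gamma> (z + t *\<^sub>R e) (Du z) - grushin_energy p \<gamma> z (Du z)\<bar> \<le> M z * \<bar>t\<bar>)"
      using M(2) by eventually_elim (use that(2) in blast)
    with M(1) show ?thesis using zero_less_one by blast
  qed
  note C = convex_stress_energy_identity[where L="grushin_energy p \<gamma>" and Du=Du and u=u and e=e and Le=Le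
      and A="\<lambda>z. grushin_flux p \<gamma> z (Du z)" and c="\<lambda>z. f z (u z)" and \<psi>=\<psi> and \<Psi>=\<Psi> and \<Omega>=D,
      OF D e grushin_energy_convex[OF p] cL cA cf u weak Le dom \<psi>]
  note P = primitive_integration_by_parts[where u=u and Du=Du and e=e, OF f D u e F \<psi>(1)]
  have i1: "integrable lborel (\<lambda>z. grushin_energy p \<gamma> z (Du z) * (\<Psi> z \<bullet> e) - (Du z \<bullet> e) * (grushin_flux p \<gamma> z (Du z) \<bullet> \<Psi> z))"
    using p by (intro supp) (auto intro!: continuous_intros p \<gamma> u(2) sub simp: K(4))
  have i2: "integrable lborel (\<lambda>z. primitive f z (u z) * (\<Psi> z \<bullet> e))"
    by (rule supp) (auto intro!: continuous_intros primitive_continuous[OF f] cu sub simp: K(4))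
  have "(LINT z|lborel. grushin_field p \<gamma> f u Du e z \<bullet> \<Psi> z) =
     (LINT z|lborel. (grushin_energy p \<gamma> z (Du z) * (\<Psi> z \<bullet> e) - (Du z \<bullet> e) * (grushin_flux p \<gamma> z (Du z) \<bullet> \<Psi> z)) - primitive f z (u z) * (\<Psi> z \<bullet> e))"
    by (simp add: grushin_field_def inner_diff_left inner_commute[of e])
  also have "\<dots> = - (LINT z|lborel. \<psi> z * Le z) + (LINT z|lborel. \<psi> z * explicit_partial e (primitive f) z (u z))"
    using i1 i2 C(2) P(2) by simp
  also have "\<dots> = - (LINT z|lborel. \<psi> z * (Le z - explicit_partial e (primitive f) z (u z)))"
    using C(1) P(1) by (simp add: right_diff_distrib)
  finally show ?thesis .
qed


section \<open>Boundary charts\<close>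

locale C1_chart_of =
  fixes D :: "'a::euclidean_space set" and e g U
  assumes D: "open D" and chart: "C1_chart D e g U"
begin

lemma chart_facts:
  shows norm_e: "norm e = 1" and g_shift: "g (z + t *\<^sub>R e) = g z" and open_U: "open U"
    and D_below: "z \<in> U \<Longrightarrow> z \<in> D \<longleftrightarrow> z \<bullet> e < g z"
    and GDERIV_g: "GDERIV g z :> grad g z" and grad_g_continuous: "continuous_on UNIV (grad g)"
    and e_e: "e \<bullet> e = 1"
proof -
  have c: "norm e = 1" "C_k 1 g" "\<And>z t. g (z + t *\<^sub>R e) = g z" "open U" "D \<inter> U = {z\<in>U. z \<bullet> e < g z}"
    using chart unfolding C1_chart_def by blast+
  from c show "norm e = 1" "g (z + t *\<^sub>R e) = g z" "open U" by simp_all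
  show "z \<in> U \<Longrightarrow> z \<in> D \<longleftrightarrow> z \<bullet> e < g z" using c(5) by blast
  show "GDERIV g z :> grad g z" "continuous_on UNIV (grad g)" by (rule C_k_1_continuous_grad[OF c(2)])+
  show "e \<bullet> e = 1" using c(1) by (simp add: norm_eq_1)
qed

lemma g_continuous: "continuous_on S g"
  by (intro continuous_at_imp_continuous_on ballI GDERIV_imp_isCont[OF GDERIV_g])

lemma grad_g_shift: "grad g (z + t *\<^sub>R e) = grad g z"
proof -
  have "GDERIV (\<lambda>z. g (z + t *\<^sub>R e)) z :> grad g (z + t *\<^sub>R e)"
    by (rule GDERIV_shift[OF GDERIV_g])
  then have "GDERIV g z :> grad g (z + t *\<^sub>R e)" by (simp add: g_shift)
  from GDERIV_unique[OF this GDERIV_g] show ?thesis .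
qed

lemma grad_g_orthogonal: "grad g z \<bullet> e = 0"
proof -
  have "((\<lambda>t. g z) has_real_derivative grad g z \<bullet> e) (at 0)"
    using GDERIV_line[OF GDERIV_g[of z], of e] by (simp add: g_shift)
  from DERIV_unique[OF this DERIV_const] show ?thesis by simp
qed

text \<open>Inside \<open>U\<close> the domain is \<open>{depth > 0}\<close> for the vertical distance \<open>depth\<close> below the graph, and \<open>proj\<close> is the projection onto the
  graph along \<open>e\<close>. Both are defined on the whole space.\<close>

definition depth where "depth z = g z - z \<bullet> e"
definition proj where "proj z = z + depth z *\<^sub>R e"

lemma depth_shift: "depth (z + t *\<^sub>R e) = depth z - t"
  by (simp add: depth_def g_shift inner_add_left e_e)

lemma depth_continuous: "continuous_on S depth"
  unfolding depth_def[abs_def] by (intro continuous_intros g_continuous)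

lemma proj_continuous: "continuous_on S proj"
  unfolding proj_def[abs_def] by (intro continuous_intros depth_continuous)

lemma depth_proj: "depth (proj z) = 0"
  by (simp add: proj_def depth_shift)

lemma GDERIV_depth: "GDERIV depth z :> grad g z - e"
proof -
  have "GDERIV (\<lambda>z. z \<bullet> e) z :> e" by (auto simp: gderiv_def intro!: derivative_eq_intros)
  from GDERIV_diff[OF GDERIV_g this] show ?thesis by (simp add: depth_def[abs_def])
qed

lemma in_D_iff: "z \<in> U \<Longrightarrow> z \<in> D \<longleftrightarrow> depth z > 0"
  using D_below by (simp add: depth_def)

lemma in_closure_iff:
  assumes "z \<in> U"
  shows "z \<in> closure D \<longleftrightarrow> depth z \<ge> 0"
proof
  assume z: "z \<in> closure D"
  show "depth z \<ge> 0"
  proof (rule ccontr)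
    assume "\<not> depth z \<ge> 0"
    then have "z \<in> U \<inter> depth -` {..<0}" using assms by simp
    moreover have "open (U \<inter> depth -` {..<0})"
      by (intro open_Int open_U open_vimage depth_continuous) simp
    ultimately obtain y where "y \<in> D" "y \<in> U \<inter> depth -` {..<0}"
      using z by (metis closure_iff_nhds_not_empty disjoint_iff subset_refl)
    then show False using in_D_iff[of y] by simp
  qed
next
  assume dz: "depth z \<ge> 0"
  have lim: "((\<lambda>t. z - t *\<^sub>R e) \<longlongrightarrow> z - 0 *\<^sub>R e) (at_right 0)" by (intro tendsto_intros)
  have "\<forall>\<^sub>F t in at_right (0::real). z - t *\<^sub>R e \<in> U"
    by (rule topological_tendstoD[OF lim open_U]) (simp add: assms)
  moreover have "\<forall>\<^sub>F t in at_right (0::real). t > 0" by (simp add: eventually_at_right_less)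
  ultimately have "\<forall>\<^sub>F t in at_right 0. z - t *\<^sub>R e \<in> closure D"
  proof eventually_elim
    case (elim t)
    then have "z - t *\<^sub>R e \<in> D" using dz depth_shift[of z "-t"] in_D_iff[OF elim(1)] by simp
    then show ?case using closure_subset by blast
  qed
  from Lim_in_closed_set[OF closed_closure this _ lim] show "z \<in> closure D" by simp
qed

lemma in_frontier_iff: "z \<in> U \<Longrightarrow> z \<in> frontier D \<longleftrightarrow> depth z = 0"
  using in_D_iff in_closure_iff D by (auto simp: frontier_def interior_open)

definition normal where "normal z = (1 / sqrt (1 + (norm (grad g z))\<^sup>2)) *\<^sub>R (e - grad g z)"

lemma norm_e_minus_grad: "norm (e - grad g z) = sqrt (1 + (norm (grad g z))\<^sup>2)"
proof -
  have "(norm (e - grad g z))\<^sup>2 = 1 + (norm (grad g z))\<^sup>2"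
    using grad_g_orthogonal[of z]
    by (simp add: power2_norm_eq_inner inner_diff_left inner_diff_right inner_commute e_e)
  then show ?thesis by (metis norm_ge_zero real_sqrt_unique)
qed

lemma sqrt_pos: "sqrt (1 + (norm (grad g z))\<^sup>2) > 0"
  by (simp add: add_pos_nonneg)

lemma norm_normal: "norm (normal z) = 1"
  using sqrt_pos[of z] norm_e_minus_grad[of z] by (simp add: normal_def)

lemma normal_continuous: "continuous_on S normal"
proof -
  have "continuous_on S (grad g)" by (rule continuous_on_subset[OF grad_g_continuous]) simp
  then show ?thesis
    unfolding normal_def[abs_def] using sqrt_pos by (intro continuous_intros) (auto simp: less_imp_neq[symmetric])
qed

text \<open>If \<open>n\<close> differed from the normal of the graph, the vector \<open>n - normal z\<close> would make an acute angle with \<open>n\<close> and an obtuse one with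
  \<open>normal z\<close>. The first means that it leaves \<open>D\<close>, the second that \<open>depth\<close> increases along it, so that it enters \<open>D\<close>.\<close>

lemma outward_normal_eq:
  assumes z: "z \<in> U" "z \<in> frontier D" and n: "outward_normal D z n"
  shows "n = normal z"
proof (rule ccontr)
  assume "n \<noteq> normal z"
  have n1: "norm n = 1" using n unfolding outward_normal_def by blast
  define v where "v = n - normal z"
  have "0 < (norm v)\<^sup>2" using \<open>n \<noteq> normal z\<close> by (simp add: v_def)
  also have "(norm v)\<^sup>2 = 2 - 2 * (n \<bullet> normal z)"
    using n1 norm_normal[of z]
    by (simp add: v_def power2_norm_eq_inner inner_diff_left inner_diff_right inner_commute norm_eq_1)
  finally have lt: "n \<bullet> normal z < 1" by simp
  have vn: "v \<bullet> n > 0" using lt n1 by (simp add: v_def inner_diff_left norm_eq_1 inner_commute[of "normal z" n])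
  have "v \<bullet> normal z < 0" using lt norm_normal[of z] by (simp add: v_def inner_diff_left norm_eq_1)
  then have "v \<bullet> (e - grad g z) / sqrt (1 + (norm (grad g z))\<^sup>2) < 0" by (simp add: normal_def)
  then have "v \<bullet> (e - grad g z) < 0" using sqrt_pos[of z] by (simp add: divide_less_0_iff)
  then have pos: "(grad g z - e) \<bullet> v > 0" by (simp add: inner_commute[of v] inner_diff_left)
  have d0: "depth z = 0" using in_frontier_iff[OF z(1)] z(2) by simp
  obtain d where d: "d > 0" "\<And>h. 0 < h \<Longrightarrow> h < d \<Longrightarrow> depth (z + 0 *\<^sub>R v) < depth (z + (0 + h) *\<^sub>R v)"
    using DERIV_pos_inc_right[OF GDERIV_line[OF GDERIV_depth[of z], of v] pos] by blast
  have lim: "((\<lambda>t. z + t *\<^sub>R v) \<longlongrightarrow> z + 0 *\<^sub>R v) (at_right 0)" by (intro tendsto_intros)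
  have "\<forall>\<^sub>F t in at_right (0::real). z + t *\<^sub>R v \<in> U"
    by (rule topological_tendstoD[OF lim open_U]) (simp add: z)
  moreover have "\<forall>\<^sub>F t in at_right (0::real). 0 < t \<and> t < d"
    using d(1) by (intro eventually_at_rightI[of 0 d]) auto
  moreover have "\<forall>\<^sub>F t in at_right 0. z + t *\<^sub>R v \<notin> D"
    using n vn unfolding outward_normal_def by blast
  ultimately have "\<forall>\<^sub>F t in at_right (0::real). False"
  proof eventually_elim
    case (elim t)
    then have "depth (z + t *\<^sub>R v) > 0" using d(2)[of t] d0 by simp
    then show ?case using in_D_iff elim by blast
  qed
  then show False by simp
qed

text \<open>If \<open>H\<close> has bounded support then so has \<open>z \<mapsto> H (proj z)\<close> on the slab; this bounds the support of surface integrands.\<close>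

lemma slab_norm_bound:
  assumes "z \<in> slab e"
  shows "norm z \<le> 2 * norm (z + t *\<^sub>R e) + 1"
proof -
  have "\<bar>(z + t *\<^sub>R e) \<bullet> e\<bar> \<le> norm (z + t *\<^sub>R e)" using Cauchy_Schwarz_ineq2[of "z + t *\<^sub>R e" e] norm_e by simp
  then have "\<bar>z \<bullet> e + t\<bar> \<le> norm (z + t *\<^sub>R e)" by (simp add: inner_add_left e_e)
  then have "\<bar>t\<bar> \<le> norm (z + t *\<^sub>R e) + 1" using assms by auto
  moreover have "norm z \<le> norm (z + t *\<^sub>R e) + norm (t *\<^sub>R e)"
    using norm_triangle_ineq4[of "z + t *\<^sub>R e" "t *\<^sub>R e"] by simp
  ultimately show ?thesis using norm_e by simp
qed

lemma proj_measurable [measurable]: "proj \<in> borel_measurable borel"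
  by (rule borel_measurable_continuous_onI[OF proj_continuous])

lemma depth_measurable [measurable]: "depth \<in> borel_measurable borel"
  by (rule borel_measurable_continuous_onI[OF depth_continuous])

lemma grad_g_measurable [measurable]: "grad g \<in> borel_measurable borel"
  by (rule borel_measurable_continuous_onI[OF grad_g_continuous])

context
  fixes \<sigma> :: "'a measure"
  assumes \<sigma>: "surface_measure D \<sigma>"
begin

lemma sets_sigma: "sets \<sigma> = sets borel"
  using \<sigma> by (simp add: surface_measure_def)

lemma emeasure_surface_chart:
  assumes "A \<in> sets borel" "A \<subseteq> frontier D \<inter> U"
  shows "emeasure \<sigma> A = (\<integral>\<^sup>+z. indicator (slab e) z * indicator A (proj z) * ennreal (sqrt (1 + (norm (grad g z))\<^sup>2)) \<partial>lborel)"
proof -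
  have "emeasure \<sigma> A = (\<integral>\<^sup>+ z\<in>{z. 0 \<le> z \<bullet> e \<and> z \<bullet> e \<le> 1 \<and> z + (g z - z \<bullet> e) *\<^sub>R e \<in> A}.
             ennreal (sqrt (1 + (norm (grad g z))\<^sup>2)) \<partial>lborel)"
    using \<sigma> chart assms unfolding surface_measure_def by blast
  also have "\<dots> = (\<integral>\<^sup>+z. indicator (slab e) z * indicator A (proj z) * ennreal (sqrt (1 + (norm (grad g z))\<^sup>2)) \<partial>lborel)"
    by (intro nn_integral_cong) (auto simp: indicator_def proj_def depth_def)
  finally show ?thesis .
qed

text \<open>On \<open>\<partial>D \<inter> U\<close> the measure \<open>\<sigma>\<close> is the image under \<open>proj\<close> of the area element on the slab.\<close>

lemma surface_integral_chart:
  fixes H :: "'a \<Rightarrow> real"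
  assumes H [measurable]: "H \<in> borel_measurable borel" and H0: "\<And>z. z \<notin> frontier D \<inter> U \<Longrightarrow> H z = 0"
  shows "(LINT z|\<sigma>. H z) = (LINT z:slab e|lborel. H (proj z) * sqrt (1 + (norm (grad g z))\<^sup>2))"
proof -
  note [measurable_cong] = sets_sigma
  define S where "S = frontier D \<inter> U"
  have S [measurable]: "S \<in> sets borel" unfolding S_def by (intro sets.Int borel_closed borel_open open_U frontier_closed)
  define w where "w z = indicator (slab e) z * indicator S (proj z) * sqrt (1 + (norm (grad g z))\<^sup>2)" for z
  have w0: "w z \<ge> 0" for z by (simp add: w_def)
  have w [measurable]: "w \<in> borel_measurable borel" unfolding w_def[abs_def] by measurable
  have eq: "density \<sigma> (\<lambda>z. ennreal (indicator S z)) = distr (density lborel (\<lambda>z. ennreal (w z))) borel proj"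
  proof (rule measure_eqI)
    fix A assume "A \<in> sets (density \<sigma> (\<lambda>z. ennreal (indicator S z)))"
    then have A [measurable]: "A \<in> sets borel" by (simp add: sets_sigma)
    have "emeasure (density \<sigma> (\<lambda>z. ennreal (indicator S z))) A = (\<integral>\<^sup>+z. ennreal (indicator S z) * indicator A z \<partial>\<sigma>)"
      by (subst emeasure_density) auto
    also have "\<dots> = (\<integral>\<^sup>+z. indicator (A \<inter> S) z \<partial>\<sigma>)"
      by (rule nn_integral_cong) (auto simp: indicator_def)
    also have "\<dots> = emeasure \<sigma> (A \<inter> S)" by (simp add: sets_sigma)
    also have "\<dots> = (\<integral>\<^sup>+z. indicator (slab e) z * indicator (A \<inter> S) (proj z) * ennreal (sqrt (1 + (norm (grad g z))\<^sup>2)) \<partial>lborel)"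
      by (rule emeasure_surface_chart) (auto simp: S_def[symmetric])
    also have "\<dots> = (\<integral>\<^sup>+z. ennreal (w z) * indicator A (proj z) \<partial>lborel)"
      by (intro nn_integral_cong) (auto simp: w_def indicator_def)
    also have "\<dots> = emeasure (distr (density lborel (\<lambda>z. ennreal (w z))) borel proj) A"
      using measurable_sets_borel[OF proj_measurable A]
      by (subst emeasure_distr, simp_all, subst emeasure_density) (auto intro!: nn_integral_cong simp: indicator_def)
    finally show "emeasure (density \<sigma> (\<lambda>z. ennreal (indicator S z))) A = emeasure (distr (density lborel (\<lambda>z. ennreal (w z))) borel proj) A" .
  qed (simp add: sets_sigma)
  have "(LINT z|\<sigma>. H z) = (LINT z|\<sigma>. indicator S z *\<^sub>R H z)"
    using H0 by (intro Bochner_Integration.integral_cong) (auto simp: S_def indicator_def)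
  also have "\<dots> = (LINT z|density \<sigma> (\<lambda>z. ennreal (indicator S z)). H z)"
    by (subst integral_density) auto
  also have "\<dots> = (LINT z|density lborel (\<lambda>z. ennreal (w z)). H (proj z))"
    unfolding eq by (rule integral_distr) auto
  also have "\<dots> = (LINT z|lborel. w z *\<^sub>R H (proj z))"
    using w0 by (subst integral_density) auto
  also have "\<dots> = (LINT z:slab e|lborel. H (proj z) * sqrt (1 + (norm (grad g z))\<^sup>2))"
    unfolding set_lebesgue_integral_def
    using H0 by (intro Bochner_Integration.integral_cong refl) (auto simp: w_def S_def indicator_def)
  finally show ?thesis .
qed

lemma surface_measure_chart_finite:
  assumes K: "compact K" "K \<subseteq> U"
  shows "emeasure \<sigma> (frontier D \<inter> K) < \<infinity>"
proof -
  have [measurable]: "frontier D \<inter> K \<in> sets borel"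
    using K(1) by (intro sets.Int borel_closed borel_compact frontier_closed)
  have "bounded (grad g ` K)"
    by (intro compact_imp_bounded compact_continuous_image K continuous_on_subset[OF grad_g_continuous]) simp
  then obtain B where B: "B > 0" "\<And>z. z \<in> K \<Longrightarrow> norm (grad g z) \<le> B" by (auto simp: bounded_pos)
  obtain R where R: "\<And>z. z \<in> K \<Longrightarrow> norm z \<le> R" using compact_imp_bounded[OF K(1)] by (auto simp: bounded_iff)
  have "emeasure \<sigma> (frontier D \<inter> K) = (\<integral>\<^sup>+z. indicator (slab e) z * indicator (frontier D \<inter> K) (proj z) * ennreal (sqrt (1 + (norm (grad g z))\<^sup>2)) \<partial>lborel)"
    by (rule emeasure_surface_chart) (use K(2) in auto)
  also have "\<dots> \<le> (\<integral>\<^sup>+z. ennreal (sqrt (1 + B\<^sup>2)) * indicator (cball (0::'a) (2 * R + 1)) z \<partial>lborel)"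
  proof (rule nn_integral_mono)
    fix z
    show "indicator (slab e) z * indicator (frontier D \<inter> K) (proj z) * ennreal (sqrt (1 + (norm (grad g z))\<^sup>2))
      \<le> ennreal (sqrt (1 + B\<^sup>2)) * indicator (cball 0 (2 * R + 1)) z"
    proof (cases "z \<in> slab e \<and> proj z \<in> K")
      case True
      have "norm z \<le> 2 * norm (proj z) + 1" unfolding proj_def using True by (intro slab_norm_bound) auto
      also have "\<dots> \<le> 2 * R + 1" using R True by simp
      finally have 1: "z \<in> cball 0 (2 * R + 1)" by simp
      have "norm (grad g z) \<le> B" using B(2)[of "proj z"] True by (simp add: proj_def grad_g_shift)
      then have "sqrt (1 + (norm (grad g z))\<^sup>2) \<le> sqrt (1 + B\<^sup>2)" by (simp add: power_mono)
      then have "ennreal (sqrt (1 + (norm (grad g z))\<^sup>2)) \<le> ennreal (sqrt (1 + B\<^sup>2))" by (rule ennreal_leI)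
      then show ?thesis using 1 by (auto simp: indicator_def)
    qed (auto simp: indicator_def)
  qed
  also have "\<dots> = ennreal (sqrt (1 + B\<^sup>2)) * emeasure lborel (cball (0::'a) (2 * R + 1))"
    by (subst nn_integral_cmult_indicator) auto
  also have "\<dots> < \<infinity>" using emeasure_compact_finite[OF compact_cball, of "0::'a" "2 * R + 1"]
    by (simp add: ennreal_mult_less_top)
  finally show ?thesis .
qed

end

end


section \<open>Boundary layers\<close>

text \<open>A quadratic spline of class \<open>C\<^sup>1\<close> that rises from \<open>0\<close> to \<open>1\<close> on the unit interval.\<close>

definition ramp :: "real \<Rightarrow> real" where
  "ramp t = 2 * (max 0 t)\<^sup>2 - 4 * (max 0 (t - 1/2))\<^sup>2 + 2 * (max 0 (t - 1))\<^sup>2"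
text \<open>The derivative of \<open>ramp\<close>, a probability density on the unit interval.\<close>

definition hat :: "real \<Rightarrow> real" where
  "hat t = 4 * max 0 t - 8 * max 0 (t - 1/2) + 4 * max 0 (t - 1)"

lemma DERIV_max0_square: "((\<lambda>t. (max 0 (t - a))\<^sup>2) has_real_derivative 2 * max 0 (t - a)) (at t)" for a t :: real
proof -
  consider "t < a" | "t > a" | "t = a" by linarith
  then show ?thesis
  proof cases
    case 1
    have "((\<lambda>t. 0) has_real_derivative 2 * max 0 (t - a)) (at t)" using 1 by simp
    then show ?thesis
      by (rule has_field_derivative_transform_within_open[of _ _ _ "{..<a}"]) (use 1 in auto)
  next
    case 2
    have "((\<lambda>t. (t - a)\<^sup>2) has_real_derivative 2 * max 0 (t - a)) (at t)"
      using 2 by (auto intro!: derivative_eq_intros)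
    then show ?thesis
      by (rule has_field_derivative_transform_within_open[of _ _ _ "{a<..}"]) (use 2 in auto)
  next
    case 3
    have "((\<lambda>h. (max 0 h)\<^sup>2 / h) \<longlongrightarrow> 0) (at (0::real))"
    proof (rule Lim_null_comparison)
      show "\<forall>\<^sub>F h in at (0::real). norm ((max 0 h)\<^sup>2 / h) \<le> \<bar>h\<bar>"
        by (rule always_eventually) (auto simp: max_def power2_eq_square)
      show "((\<lambda>h::real. \<bar>h\<bar>) \<longlongrightarrow> 0) (at 0)" by (intro tendsto_rabs_zero tendsto_ident_at)
    qed
    then show ?thesis using 3 by (simp add: DERIV_def)
  qed
qed

lemma ramp_deriv: "(ramp has_real_derivative hat t) (at t)"
proof -
  have "((\<lambda>t. 2 * (max 0 (t - 0))\<^sup>2 - 4 * (max 0 (t - 1/2))\<^sup>2 + 2 * (max 0 (t - 1))\<^sup>2) has_real_derivative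
     2 * (2 * max 0 (t - 0)) - 4 * (2 * max 0 (t - 1/2)) + 2 * (2 * max 0 (t - 1))) (at t)"
    by (intro DERIV_add DERIV_diff DERIV_cmult DERIV_max0_square)
  then show ?thesis by (simp add: ramp_def[abs_def] hat_def)
qed

lemma ramp_bounds: "t \<le> 0 \<Longrightarrow> ramp t = 0" "t \<ge> 1 \<Longrightarrow> ramp t = 1" "0 \<le> ramp t" "ramp t \<le> 1"
proof -
  show 0: "t \<le> 0 \<Longrightarrow> ramp t = 0" by (simp add: ramp_def max_def)
  show 1: "t \<ge> 1 \<Longrightarrow> ramp t = 1" by (simp add: ramp_def max_def power2_eq_square algebra_simps)
  have a: "ramp t = 2 * t\<^sup>2" if "0 \<le> t" "t \<le> 1/2" using that by (simp add: ramp_def max_def)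
  have b: "ramp t = 1 - 2 * (1 - t)\<^sup>2" if "1/2 \<le> t" "t \<le> 1"
    using that by (simp add: ramp_def max_def power2_eq_square algebra_simps)
  have "0 \<le> ramp t \<and> ramp t \<le> 1"
  proof -
    consider "t \<le> 0" | "0 \<le> t" "t \<le> 1/2" | "1/2 \<le> t" "t \<le> 1" | "t \<ge> 1" by linarith
    then show ?thesis
    proof cases
      case 2
      have "t\<^sup>2 \<le> (1/2)\<^sup>2" using 2 by (intro power_mono) auto
      then show ?thesis unfolding a[OF 2] by (simp add: power2_eq_square)
    next
      case 3
      have "(1 - t)\<^sup>2 \<le> (1/2)\<^sup>2" using 3 by (intro power_mono) auto
      then show ?thesis unfolding b[OF 3] by (simp add: power2_eq_square)
    qed (simp_all add: 0 1)
  qed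
  then show "0 \<le> ramp t" "ramp t \<le> 1" by auto
qed

lemma hat_bounds: "t \<notin> {0..1} \<Longrightarrow> hat t = 0" "0 \<le> hat t" "hat t \<le> 2"
  by (auto simp: hat_def max_def)

lemma hat_continuous: "continuous_on S hat"
  unfolding hat_def[abs_def] by (intro continuous_intros)

lemma ramp_continuous: "continuous_on S ramp"
  unfolding ramp_def[abs_def] by (intro continuous_intros)

lemma hat_integral: "integrable lborel hat" "(LINT t|lborel. hat t) = 1"
proof -
  show i: "integrable lborel hat"
    by (rule integrable_compact_support[OF hat_continuous compact_Icc[of 0 1] hat_bounds(1)])
  have "(hat has_integral ramp 1 - ramp 0) {0..1}"
    by (rule fundamental_theorem_of_calculus)
      (auto simp: has_real_derivative_iff_has_vector_derivative[symmetric] intro: has_field_derivative_at_within ramp_deriv)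
  then have "(hat has_integral 1) {0..1}" by (simp add: ramp_bounds)
  then have "(hat has_integral 1) UNIV"
    by (rule has_integral_on_superset) (auto intro: hat_bounds(1))
  then show "(LINT t|lborel. hat t) = 1"
    using has_integral_integral_lborel[OF i] has_integral_unique by blast
qed

context C1_chart_of
begin

lemma boundary_layer_integrable:
  fixes H :: "'a \<Rightarrow> real"
  assumes H: "H \<in> borel_measurable borel" "\<And>z. \<bar>H z\<bar> \<le> B" "\<And>z. z \<notin> K \<Longrightarrow> H z = 0" "compact K"
    and r: "r > 0"
  shows "integrable lborel (\<lambda>z. H z * (hat (depth z / r - 1) / r))"
proof (rule Bochner_Integration.integrable_bound)
  note [measurable] = H(1) borel_measurable_continuous_onI[OF hat_continuous]
  show "integrable lborel (\<lambda>z. indicator K z * (B * (2 / r)))"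
    using emeasure_compact_finite[OF H(4)] H(4) by (intro integrable_mult_left integrable_real_indicator) (auto simp: borel_compact)
  show "(\<lambda>z. H z * (hat (depth z / r - 1) / r)) \<in> borel_measurable lborel" by measurable
  show "AE z in lborel. norm (H z * (hat (depth z / r - 1) / r)) \<le> norm (indicator K z * (B * (2 / r)))"
  proof (rule AE_I2)
    fix z
    have B: "B \<ge> 0" using H(2)[of z] by linarith
    show "norm (H z * (hat (depth z / r - 1) / r)) \<le> norm (indicator K z * (B * (2 / r)))"
    proof (cases "z \<in> K")
      case True
      have "\<bar>H z\<bar> * \<bar>hat (depth z / r - 1) / r\<bar> \<le> B * (2 / r)"
        using r hat_bounds(2,3)[of "depth z / r - 1"] H(2)[of z] B
        by (intro mult_mono) (auto simp: abs_divide divide_right_mono)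
      then show ?thesis using True B r by (simp add: abs_mult)
    qed (simp add: H(3))
  qed
qed

text \<open>On the line through \<open>z\<close> in direction \<open>e\<close> the substitution \<open>depth = \<epsilon> (1 + s)\<close> turns the kernel into the fixed probability density
  \<open>hat\<close>, and the argument of \<open>H\<close> tends to \<open>proj z\<close> from below the graph. So continuity of \<open>H\<close> up to the graph from below suffices.\<close>

lemma boundary_layer_limit:
  fixes H :: "'a \<Rightarrow> real"
  assumes H: "H \<in> borel_measurable borel" "\<And>z. \<bar>H z\<bar> \<le> B" "\<And>z. z \<notin> K \<Longrightarrow> H z = 0" "compact K" "K \<subseteq> U"
    and cont: "continuous_on (U \<inter> closure D) H"
    and \<epsilon>: "\<epsilon> \<longlonglongrightarrow> 0" "\<And>n. \<epsilon> n > 0"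
  shows "(\<lambda>n. LINT z|lborel. H z * (hat (depth z / \<epsilon> n - 1) / \<epsilon> n)) \<longlonglongrightarrow> (LINT z:slab e|lborel. H (proj z))"
proof -
  note [measurable] = H(1) borel_measurable_continuous_onI[OF hat_continuous]
  obtain R where R: "\<And>z. z \<in> K \<Longrightarrow> norm z \<le> R" using compact_imp_bounded[OF H(4)] by (auto simp: bounded_iff)
  have B: "B \<ge> 0" using H(2)[of 0] by linarith
  define J where "J n z = (LINT s|lborel. H (proj z - (\<epsilon> n * (1 + s)) *\<^sub>R e) * hat s)" for n z
  have T: "(LINT z|lborel. H z * (hat (depth z / \<epsilon> n - 1) / \<epsilon> n)) = (LINT z:slab e|lborel. J n z)" for n
  proof -
    from integral_slab(2)[OF norm_e boundary_layer_integrable[OF H(1-4) \<epsilon>(2)[of n]]]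
    have "(LINT z|lborel. H z * (hat (depth z / \<epsilon> n - 1) / \<epsilon> n)) =
       (LINT z:slab e|lborel. (LINT t|lborel. H (z + t *\<^sub>R e) * (hat (depth (z + t *\<^sub>R e) / \<epsilon> n - 1) / \<epsilon> n)))" .
    also have "(\<lambda>z. LINT t|lborel. H (z + t *\<^sub>R e) * (hat (depth (z + t *\<^sub>R e) / \<epsilon> n - 1) / \<epsilon> n)) = J n"
    proof
      fix z
      have "(LINT t|lborel. H (z + t *\<^sub>R e) * (hat (depth (z + t *\<^sub>R e) / \<epsilon> n - 1) / \<epsilon> n))
         = \<bar>- \<epsilon> n\<bar> *\<^sub>R (LINT s|lborel. H (z + (depth z - \<epsilon> n + (- \<epsilon> n) * s) *\<^sub>R e) * (hat (depth (z + (depth z - \<epsilon> n + (- \<epsilon> n) * s) *\<^sub>R e) / \<epsilon> n - 1) / \<epsilon> n))"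
        using \<epsilon>(2)[of n] by (intro lborel_integral_real_affine) simp
      also have "(\<lambda>s. H (z + (depth z - \<epsilon> n + (- \<epsilon> n) * s) *\<^sub>R e) * (hat (depth (z + (depth z - \<epsilon> n + (- \<epsilon> n) * s) *\<^sub>R e) / \<epsilon> n - 1) / \<epsilon> n))
          = (\<lambda>s. (H (proj z - (\<epsilon> n * (1 + s)) *\<^sub>R e) * hat s) / \<epsilon> n)"
      proof
        fix s
        have "depth (z + (depth z - \<epsilon> n + (- \<epsilon> n) * s) *\<^sub>R e) / \<epsilon> n - 1 = s"
          unfolding depth_shift using \<epsilon>(2)[of n] by (simp add: field_simps)
        moreover have "z + (depth z - \<epsilon> n + (- \<epsilon> n) * s) *\<^sub>R e = proj z - (\<epsilon> n * (1 + s)) *\<^sub>R e"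
          by (simp add: proj_def algebra_simps)
        ultimately show "H (z + (depth z - \<epsilon> n + (- \<epsilon> n) * s) *\<^sub>R e) * (hat (depth (z + (depth z - \<epsilon> n + (- \<epsilon> n) * s) *\<^sub>R e) / \<epsilon> n - 1) / \<epsilon> n)
          = (H (proj z - (\<epsilon> n * (1 + s)) *\<^sub>R e) * hat s) / \<epsilon> n" by simp
      qed
      finally show "(LINT t|lborel. H (z + t *\<^sub>R e) * (hat (depth (z + t *\<^sub>R e) / \<epsilon> n - 1) / \<epsilon> n)) = J n z"
        using \<epsilon>(2)[of n] by (simp add: J_def)
    qed
    finally show ?thesis .
  qed
  have Jlim: "(\<lambda>n. J n z) \<longlonglongrightarrow> H (proj z)" for z
  proof -
    have "(\<lambda>n. J n z) \<longlonglongrightarrow> (LINT s|lborel. H (proj z) * hat s)"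
      unfolding J_def
    proof (rule integral_dominated_convergence)
      show "integrable lborel (\<lambda>s. B * hat s)" using hat_integral(1) by (rule integrable_mult_right)
      show "AE s in lborel. norm (H (proj z - (\<epsilon> n * (1 + s)) *\<^sub>R e) * hat s) \<le> B * hat s" for n
        using H(2) hat_bounds(2) by (intro AE_I2) (simp add: abs_mult mult_right_mono)
      show "AE s in lborel. (\<lambda>n. H (proj z - (\<epsilon> n * (1 + s)) *\<^sub>R e) * hat s) \<longlonglongrightarrow> H (proj z) * hat s"
      proof (rule AE_I2)
        fix s :: real
        show "(\<lambda>n. H (proj z - (\<epsilon> n * (1 + s)) *\<^sub>R e) * hat s) \<longlonglongrightarrow> H (proj z) * hat s"
        proof (cases "s \<ge> 0")
          case False
          then show ?thesis using hat_bounds(1)[of s] by simp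
        next
          case True
          define q where "q n = proj z - (\<epsilon> n * (1 + s)) *\<^sub>R e" for n
          have "q \<longlonglongrightarrow> proj z - (0 * (1 + s)) *\<^sub>R e" unfolding q_def[abs_def] by (intro tendsto_intros \<epsilon>(1))
          then have q: "q \<longlonglongrightarrow> proj z" by simp
          have "(\<lambda>n. H (q n)) \<longlonglongrightarrow> H (proj z)"
          proof (cases "proj z \<in> U")
            case U: True
            have "\<forall>\<^sub>F n in sequentially. q n \<in> U" by (rule topological_tendstoD[OF q open_U U])
            then have "\<forall>\<^sub>F n in sequentially. q n \<in> U \<inter> closure D"
            proof eventually_elim
              case (elim n)
              have "depth (q n) = \<epsilon> n * (1 + s)"
                using depth_shift[of "proj z" "- (\<epsilon> n * (1 + s))"] by (simp add: q_def depth_proj)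
              then have "depth (q n) \<ge> 0" using \<epsilon>(2)[of n] True by simp
              then show ?case using in_closure_iff[OF elim] elim by simp
            qed
            moreover have "proj z \<in> U \<inter> closure D" using in_closure_iff[OF U] U by (simp add: depth_proj)
            ultimately show ?thesis by (rule continuous_on_tendsto_compose[OF cont q, rotated])
          next
            case False
            then have pK: "proj z \<in> - K" using H(5) by blast
            have "open (- K)" using H(4) by (simp add: compact_imp_closed open_Compl)
            from topological_tendstoD[OF q this pK]
            have "\<forall>\<^sub>F n in sequentially. H (q n) = 0" by eventually_elim (simp add: H(3))
            then show ?thesis using pK H(3)[of "proj z"] by (simp add: tendsto_eventually)
          qed
          then show ?thesis unfolding q_def by (intro tendsto_mult tendsto_const)
        qed
      qed
    qed measurable
    then show ?thesis using hat_integral(2) by simp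
  qed
  have Jm: "J n \<in> borel_measurable borel" for n
    unfolding J_def[abs_def] by measurable
  have Jb: "\<bar>J n z\<bar> \<le> B" for n z
  proof -
    have "norm (J n z) \<le> (LINT s|lborel. norm (H (proj z - (\<epsilon> n * (1 + s)) *\<^sub>R e) * hat s))"
      unfolding J_def by (rule integral_norm_bound)
    also have "\<dots> \<le> (LINT s|lborel. B * hat s)"
    proof (rule integral_mono')
      show "integrable lborel (\<lambda>s. B * hat s)" using hat_integral(1) by (rule integrable_mult_right)
      show "norm (H (proj z - (\<epsilon> n * (1 + s)) *\<^sub>R e) * hat s) \<le> B * hat s" for s
        using H(2) hat_bounds(2) by (simp add: abs_mult mult_right_mono)
      show "0 \<le> B * hat s" for s using B hat_bounds(2)[of s] by simp
    qed
    finally show ?thesis using hat_integral(2) by simp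
  qed
  have J0: "J n z = 0" if z: "z \<in> slab e" "z \<notin> cball 0 (2 * R + 1)" for n z
  proof -
    have "H (proj z - (\<epsilon> n * (1 + s)) *\<^sub>R e) = 0" for s
    proof (rule H(3), rule notI)
      assume a: "proj z - (\<epsilon> n * (1 + s)) *\<^sub>R e \<in> K"
      have eq: "proj z - (\<epsilon> n * (1 + s)) *\<^sub>R e = z + (depth z - \<epsilon> n * (1 + s)) *\<^sub>R e" by (simp add: proj_def algebra_simps)
      have "norm z \<le> 2 * R + 1"
        using slab_norm_bound[OF z(1), of "depth z - \<epsilon> n * (1 + s)"] R[OF a] unfolding eq by linarith
      then show False using z(2) by simp
    qed
    then show ?thesis by (simp add: J_def)
  qed
  have "(\<lambda>n. LINT z:slab e|lborel. J n z) \<longlonglongrightarrow> (LINT z:slab e|lborel. H (proj z))"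
    unfolding set_lebesgue_integral_def
  proof (rule integral_dominated_convergence)
    show "integrable lborel (\<lambda>z. indicator (cball (0::'a) (2 * R + 1)) z * B)"
      using emeasure_compact_finite[OF compact_cball, of "0::'a" "2 * R + 1"]
      by (intro integrable_mult_left integrable_real_indicator) auto
    show "AE z in lborel. norm (indicator (slab e) z *\<^sub>R J n z) \<le> indicator (cball 0 (2 * R + 1)) z * B" for n
      using Jb J0 B by (intro AE_I2) (auto simp: indicator_def)
    show "AE z in lborel. (\<lambda>n. indicator (slab e) z *\<^sub>R J n z) \<longlonglongrightarrow> indicator (slab e) z *\<^sub>R H (proj z)"
      by (intro AE_I2 tendsto_scaleR tendsto_const Jlim)
    show "(\<lambda>z. indicator (slab e) z *\<^sub>R J n z) \<in> borel_measurable lborel" for n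
      using Jm by measurable
  qed measurable
  then show ?thesis by (simp only: T)
qed

end


section \<open>The divergence theorem in a chart\<close>

text \<open>The distributional divergence of the field \<open>Y\<close> is \<open>G\<close>, tested with nonnegative functions only: this is what the convexity
  argument yields, and the cutoffs below are nonnegative.\<close>

locale weak_divergence =
  fixes D :: "'a::euclidean_space set" and \<sigma> :: "'a measure" and \<nu> Y :: "'a \<Rightarrow> 'a" and G :: "'a \<Rightarrow> real"
  assumes D: "C1_domain D" and bounded_D: "bounded D"
    and \<nu>: "\<And>z. z \<in> frontier D \<Longrightarrow> outward_normal D z (\<nu> z)" and \<sigma>: "surface_measure D \<sigma>"
    and Y: "continuous_on (closure D) Y" and G: "integrable lborel (\<lambda>z. indicator D z * G z)"
    and div: "\<And>\<psi> \<Psi>. C1_compact D \<psi> \<Psi> \<Longrightarrow> (\<And>z. \<psi> z \<ge> 0) \<Longrightarrow>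
      (LINT z|lborel. Y z \<bullet> \<Psi> z) = - (LINT z|lborel. \<psi> z * G z)"
begin

lemma open_D: "open D"
  using D by (simp add: C1_domain_def)

lemma compact_closure_D: "compact (closure D)" and compact_frontier_D: "compact (frontier D)"
  using bounded_D by (simp_all add: compact_frontier_bounded)

lemma chart_at:
  assumes "z \<in> frontier D"
  obtains e g U where "C1_chart_of D e g U" "z \<in> U"
  using D assms unfolding C1_domain_def C1_chart_of_def by blast

lemma set_integrable_D:
  fixes v :: "'a \<Rightarrow> real"
  assumes "continuous_on (closure D) v"
  shows "integrable lborel (\<lambda>z. indicator D z * v z)"
proof -
  have "integrable lborel (\<lambda>z. indicator (closure D) z *\<^sub>R v z)"
    by (rule borel_integrable_compact[OF compact_closure_D assms])
  from integrable_mult_indicator[OF _ this, of D]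
  have "integrable lborel (\<lambda>z. indicator D z *\<^sub>R (indicator (closure D) z *\<^sub>R v z))" using open_D by simp
  also have "(\<lambda>z. indicator D z *\<^sub>R (indicator (closure D) z *\<^sub>R v z)) = (\<lambda>z. indicator D z * v z)"
    using closure_subset by (fastforce simp: indicator_def)
  finally show ?thesis .
qed

lemma integrable_mult_G:
  fixes \<rho> :: "'a \<Rightarrow> real"
  assumes \<rho>: "continuous_on UNIV \<rho>"
  shows "integrable lborel (\<lambda>z. indicator D z * (\<rho> z * G z))"
proof -
  have "bounded (\<rho> ` closure D)"
    by (intro compact_imp_bounded compact_continuous_image compact_closure_D continuous_on_subset[OF \<rho>]) simp
  then obtain B where B: "B > 0" "\<And>z. z \<in> closure D \<Longrightarrow> \<bar>\<rho> z\<bar> \<le> B" by (auto simp: bounded_pos)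
  have "integrable lborel (\<lambda>z. \<rho> z * (indicator D z * G z))"
  proof (rule Bochner_Integration.integrable_bound)
    show "integrable lborel (\<lambda>z. B * (indicator D z * G z))" using G by (rule integrable_mult_right)
    show "(\<lambda>z. \<rho> z * (indicator D z * G z)) \<in> borel_measurable lborel"
      using borel_measurable_continuous_onI[OF \<rho>] by (intro borel_measurable_times borel_measurable_integrable[OF G]) simp
    show "AE z in lborel. norm (\<rho> z * (indicator D z * G z)) \<le> norm (B * (indicator D z * G z))"
    proof (rule AE_I2)
      fix z
      show "norm (\<rho> z * (indicator D z * G z)) \<le> norm (B * (indicator D z * G z))"
        using B(1) B(2)[of z] closure_subset[of D]
        by (cases "z \<in> D") (auto simp: abs_mult intro!: mult_right_mono)
    qed
  qed
  then show ?thesis by (simp add: mult_ac)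
qed

text \<open>The field is tested with \<open>\<rho>\<close> times a cutoff that is \<open>1\<close> away from the graph and \<open>0\<close> near it. As the layer shrinks, the gradient
  of the cutoff produces the boundary integral, because \<open>grad g z - e\<close> is \<open>- normal z\<close> times the area element.\<close>

lemma divergence_chart:
  assumes chart: "C1_chart_of D e g U" and \<rho>: "C1_compact U \<rho> P" "\<And>z. \<rho> z \<ge> 0"
  shows "(LINT z:frontier D|\<sigma>. \<rho> z * (Y z \<bullet> \<nu> z)) = (LINT z:D|lborel. \<rho> z * G z + Y z \<bullet> P z)"
proof -
  interpret C1_chart_of D e g U by (rule chart)
  obtain K where K: "compact K" "K \<subseteq> U" "\<And>z. z \<notin> K \<Longrightarrow> \<rho> z = 0" "\<And>z. z \<notin> K \<Longrightarrow> P z = 0"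
    "\<And>z. GDERIV \<rho> z :> P z" "continuous_on UNIV \<rho>" "continuous_on UNIV P"
    by (rule C1_compactE[OF \<rho>(1)]) (rule that)
  define \<epsilon> where "\<epsilon> n = inverse (real (Suc n))" for n
  have \<epsilon>: "\<epsilon> \<longlonglongrightarrow> 0" "\<And>n. \<epsilon> n > 0"
    unfolding \<epsilon>_def[abs_def] by (rule LIMSEQ_inverse_real_of_nat) simp
  have \<epsilon>0: "\<epsilon> n \<noteq> 0" for n using \<epsilon>(2)[of n] by simp
  \<comment> \<open>The shift by \<open>1\<close> makes the cutoff vanish up to depth \<open>\<epsilon> n\<close>, so that its product with \<open>\<rho>\<close> has compact support in \<open>D\<close>.\<close>
  define cut where "cut n z = ramp (depth z / \<epsilon> n - 1)" for n z
  have cut: "0 \<le> cut n z" "cut n z \<le> 1" for n z using ramp_bounds by (auto simp: cut_def)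
  have cut0: "cut n z = 0" if "depth z \<le> \<epsilon> n" for n z
    unfolding cut_def using that \<epsilon>(2)[of n] by (intro ramp_bounds(1)) (simp add: field_simps)
  have cutc: "continuous_on UNIV (cut n)" for n
    unfolding cut_def[abs_def] by (intro continuous_on_compose2[OF ramp_continuous] continuous_intros depth_continuous) (auto simp: \<epsilon>0)
  note [measurable] = borel_measurable_continuous_onI[OF cutc] borel_measurable_continuous_onI[OF K(6)]
  have cut_lim: "(\<lambda>n. cut n z) \<longlonglongrightarrow> 1" if "depth z > 0" for z
  proof -
    have "(\<lambda>n. 2 * \<epsilon> n) \<longlonglongrightarrow> 2 * 0" by (intro tendsto_mult tendsto_const \<epsilon>(1))
    then have "\<forall>\<^sub>F n in sequentially. 2 * \<epsilon> n < depth z" by (rule order_tendstoD(2)) (use that in simp)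
    then have "\<forall>\<^sub>F n in sequentially. cut n z = 1"
    proof eventually_elim
      case (elim n)
      show ?case unfolding cut_def using elim \<epsilon>(2)[of n] by (intro ramp_bounds(2)) (simp add: field_simps)
    qed
    then show ?thesis by (rule tendsto_eventually)
  qed
  have inD: "z \<in> D" if "z \<in> K" "cut n z \<noteq> 0" for n z
  proof -
    have "depth z > \<epsilon> n" using cut0[of z n] that(2) by linarith
    then show ?thesis using in_D_iff[of z] K(2) that(1) \<epsilon>(2)[of n] by force
  qed
  let ?D = "\<lambda>n z. (hat (depth z / \<epsilon> n - 1) / \<epsilon> n) *\<^sub>R (grad g z - e)"
  have GDERIV_cut: "GDERIV (cut n) z :> ?D n z" for n z
  proof -
    have "((\<lambda>t. ramp (t / \<epsilon> n - 1)) has_real_derivative hat (depth z / \<epsilon> n - 1) * (1 / \<epsilon> n)) (at (depth z))"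
      by (rule DERIV_chain2[OF ramp_deriv]) (auto intro!: derivative_eq_intros simp: \<epsilon>0)
    from GDERIV_DERIV_compose[OF GDERIV_depth this] show ?thesis by (simp add: cut_def[abs_def])
  qed
  have cD: "continuous_on UNIV (?D n)" for n
    by (intro continuous_intros continuous_on_compose2[OF hat_continuous] depth_continuous grad_g_continuous) (auto simp: \<epsilon>0)
  have \<psi>: "C1_compact D (\<lambda>z. \<rho> z * cut n z) (\<lambda>z. \<rho> z *\<^sub>R ?D n z + cut n z *\<^sub>R P z)" for n
  proof (rule C1_compactI)
    show "GDERIV (\<lambda>z. \<rho> z * cut n z) z :> \<rho> z *\<^sub>R ?D n z + cut n z *\<^sub>R P z" for z
      by (rule GDERIV_mult[OF K(5) GDERIV_cut])
    show "continuous_on UNIV (\<lambda>z. \<rho> z *\<^sub>R ?D n z + cut n z *\<^sub>R P z)"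
      by (intro continuous_on_add continuous_on_scaleR K cD cutc)
    have "closed (depth -` {\<epsilon> n..})" by (rule closed_vimage[OF _ depth_continuous]) simp
    then show "compact (K \<inter> depth -` {\<epsilon> n..})" using K(1) by (rule compact_Int_closed[rotated])
    show "K \<inter> depth -` {\<epsilon> n..} \<subseteq> D"
    proof
      fix z assume "z \<in> K \<inter> depth -` {\<epsilon> n..}"
      then show "z \<in> D" using in_D_iff[of z] K(2) \<epsilon>(2)[of n] by force
    qed
    show "\<rho> z * cut n z = 0" if "z \<notin> K \<inter> depth -` {\<epsilon> n..}" for z
    proof (cases "z \<in> K")
      case True
      then show ?thesis using that by (simp add: cut0)
    qed (simp add: K(3))
  qed
  have div_n: "(LINT z|lborel. Y z \<bullet> (\<rho> z *\<^sub>R ?D n z + cut n z *\<^sub>R P z)) = - (LINT z|lborel. (\<rho> z * cut n z) * G z)" for n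
    using \<rho>(2) cut(1) by (intro div[OF \<psi>]) simp
  \<comment> \<open>The density in the layer, extended by zero; it is continuous on the part of the closure of \<open>D\<close> in \<open>U\<close>.\<close>
  define H where "H z = indicator (closure D \<inter> K) z * (\<rho> z * (Y z \<bullet> (grad g z - e)))" for z
  have cYr: "continuous_on (closure D) (\<lambda>z. \<rho> z * (Y z \<bullet> (grad g z - e)))"
    by (intro continuous_intros Y continuous_on_subset[OF K(6)] continuous_on_subset[OF grad_g_continuous]) auto
  have compK: "compact (closure D \<inter> K)" using K(1) compact_closure_D by (intro compact_Int)
  have Hm: "H \<in> borel_measurable borel"
    unfolding H_def[abs_def] real_scaleR_def[symmetric]
    using compK continuous_on_subset[OF cYr] by (intro borel_measurable_continuous_on_indicator) (auto simp: borel_compact)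
  obtain BH where BH: "\<And>z. \<bar>H z\<bar> \<le> BH"
  proof -
    have "bounded ((\<lambda>z. \<rho> z * (Y z \<bullet> (grad g z - e))) ` (closure D))"
      by (intro compact_imp_bounded compact_continuous_image compact_closure_D cYr)
    then obtain B where "B > 0" "\<And>z. z \<in> closure D \<Longrightarrow> \<bar>\<rho> z * (Y z \<bullet> (grad g z - e))\<bar> \<le> B" by (auto simp: bounded_pos)
    then show thesis by (intro that[of B]) (auto simp: H_def indicator_def)
  qed
  have H0: "H z = 0" if "z \<notin> K" for z using that by (simp add: H_def)
  have H_closure: "H z = \<rho> z * (Y z \<bullet> (grad g z - e))" if "z \<in> closure D" for z
    using that K(3)[of z] by (auto simp: H_def indicator_def)
  have Hc: "continuous_on (U \<inter> closure D) H"
    by (rule continuous_on_eq[OF continuous_on_subset[OF cYr]]) (auto simp: H_closure)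
  note layer = boundary_layer_limit[OF Hm BH H0 K(1,2) Hc \<epsilon>]
  note iH = boundary_layer_integrable[OF Hm BH H0 K(1) \<epsilon>(2)]
  have limD: "(\<lambda>n. LINT z|lborel. cut n z * w z) \<longlonglongrightarrow> (LINT z|lborel. w z) \<and> (\<forall>n. integrable lborel (\<lambda>z. cut n z * w z))"
    if w: "integrable lborel w" "\<And>z. z \<notin> K \<inter> D \<Longrightarrow> w z = 0" for w
  proof -
    note [measurable] = borel_measurable_integrable[OF w(1)]
    have b: "AE z in lborel. norm (cut n z * w z) \<le> norm (w z)" for n
      using cut by (intro AE_I2) (simp add: abs_mult mult_left_le_one_le)
    have "AE z in lborel. (\<lambda>n. cut n z * w z) \<longlonglongrightarrow> w z"
    proof (rule AE_I2)
      fix z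
      show "(\<lambda>n. cut n z * w z) \<longlonglongrightarrow> w z"
      proof (cases "z \<in> K \<inter> D")
        case True
        then have "depth z > 0" using in_D_iff[of z] K(2) by blast
        from tendsto_mult[OF cut_lim[OF this] tendsto_const[of "w z"]] show ?thesis by simp
      qed (simp add: w(2))
    qed
    then have "(\<lambda>n. LINT z|lborel. cut n z * w z) \<longlonglongrightarrow> (LINT z|lborel. w z)"
      by (intro integral_dominated_convergence[where w="\<lambda>z. norm (w z)"] b integrable_norm w(1)) measurable
    moreover have "integrable lborel (\<lambda>z. cut n z * w z)" for n
      by (rule Bochner_Integration.integrable_bound[OF w(1) _ b]) measurable
    ultimately show ?thesis by blast
  qed
  have i\<rho>G: "integrable lborel (\<lambda>z. \<rho> z * (indicator D z * G z))"
    using integrable_mult_G[OF K(6)] by (simp add: mult_ac)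
  have iYP: "integrable lborel (\<lambda>z. indicator D z * (Y z \<bullet> P z))"
    by (intro set_integrable_D continuous_intros Y continuous_on_subset[OF K(7)]) auto
  have limG: "(\<lambda>n. LINT z|lborel. cut n z * (\<rho> z * (indicator D z * G z))) \<longlonglongrightarrow> (LINT z|lborel. \<rho> z * (indicator D z * G z))"
    by (rule conjunct1[OF limD[OF i\<rho>G]]) (auto simp: K(3) indicator_def)
  have limP: "(\<lambda>n. LINT z|lborel. cut n z * (indicator D z * (Y z \<bullet> P z))) \<longlonglongrightarrow> (LINT z|lborel. indicator D z * (Y z \<bullet> P z))"
    and iP: "integrable lborel (\<lambda>z. cut n z * (indicator D z * (Y z \<bullet> P z)))" for n
  proof -
    have "indicator D z * (Y z \<bullet> P z) = 0" if "z \<notin> K \<inter> D" for z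
      using that by (cases "z \<in> D") (simp_all add: K(4))
    from limD[OF iYP this]
    show "(\<lambda>n. LINT z|lborel. cut n z * (indicator D z * (Y z \<bullet> P z))) \<longlonglongrightarrow> (LINT z|lborel. indicator D z * (Y z \<bullet> P z))"
      "integrable lborel (\<lambda>z. cut n z * (indicator D z * (Y z \<bullet> P z)))" for n by simp_all
  qed
  have "(LINT z|lborel. H z * (hat (depth z / \<epsilon> n - 1) / \<epsilon> n)) =
      - (LINT z|lborel. cut n z * (\<rho> z * (indicator D z * G z))) - (LINT z|lborel. cut n z * (indicator D z * (Y z \<bullet> P z)))" for n
  proof -
    have 1: "(\<rho> z * cut n z) * G z = cut n z * (\<rho> z * (indicator D z * G z))" for z
      using inD[of z n] K(3)[of z] by (cases "z \<in> K") (auto simp: indicator_def)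
    have 2: "Y z \<bullet> (\<rho> z *\<^sub>R ?D n z + cut n z *\<^sub>R P z) = H z * (hat (depth z / \<epsilon> n - 1) / \<epsilon> n) + cut n z * (indicator D z * (Y z \<bullet> P z))" for z
    proof (cases "z \<in> K")
      case True
      have a: "cut n z * (Y z \<bullet> P z) = cut n z * (indicator D z * (Y z \<bullet> P z))"
        using inD[OF True, of n] by (auto simp: indicator_def)
      have b: "(Y z \<bullet> (grad g z - e)) * \<rho> z * (hat (depth z / \<epsilon> n - 1) / \<epsilon> n) = H z * (hat (depth z / \<epsilon> n - 1) / \<epsilon> n)"
      proof (cases "z \<in> closure D")
        case True
        then show ?thesis by (simp add: H_closure)
      next
        case False
        then have "depth z < 0" using in_closure_iff[of z] K(2) \<open>z \<in> K\<close> by force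
        then have "depth z / \<epsilon> n - 1 < 0" using \<epsilon>(2)[of n] by (simp add: field_simps)
        then have "hat (depth z / \<epsilon> n - 1) = 0" by (intro hat_bounds(1)) simp
        then show ?thesis by simp
      qed
      have "Y z \<bullet> (\<rho> z *\<^sub>R ?D n z + cut n z *\<^sub>R P z) =
          (Y z \<bullet> (grad g z - e)) * \<rho> z * (hat (depth z / \<epsilon> n - 1) / \<epsilon> n) + cut n z * (Y z \<bullet> P z)"
        by (simp add: inner_add_right mult_ac)
      also have "\<dots> = H z * (hat (depth z / \<epsilon> n - 1) / \<epsilon> n) + cut n z * (indicator D z * (Y z \<bullet> P z))"
        by (rule arg_cong2[where f="(+)", OF b a])
      finally show ?thesis .
    next
      case False
      then show ?thesis by (simp add: K(3,4) H0)
    qed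
    show ?thesis using div_n[of n] iH[of n] iP[of n] unfolding 1 2 by simp
  qed
  with layer have "(\<lambda>n. - (LINT z|lborel. cut n z * (\<rho> z * (indicator D z * G z))) - (LINT z|lborel. cut n z * (indicator D z * (Y z \<bullet> P z))))
     \<longlonglongrightarrow> (LINT z:slab e|lborel. H (proj z))" by simp
  moreover have "(\<lambda>n. - (LINT z|lborel. cut n z * (\<rho> z * (indicator D z * G z))) - (LINT z|lborel. cut n z * (indicator D z * (Y z \<bullet> P z))))
     \<longlonglongrightarrow> - (LINT z|lborel. \<rho> z * (indicator D z * G z)) - (LINT z|lborel. indicator D z * (Y z \<bullet> P z))"
    by (intro tendsto_intros limG limP)
  ultimately have slab_eq: "(LINT z:slab e|lborel. H (proj z)) = - (LINT z|lborel. \<rho> z * (indicator D z * G z)) - (LINT z|lborel. indicator D z * (Y z \<bullet> P z))"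
    by (rule LIMSEQ_unique)
  define Hs where "Hs z = indicator (frontier D \<inter> K) z * (\<rho> z * (Y z \<bullet> normal z))" for z
  have Hs_eq: "indicator (frontier D) z * (\<rho> z * (Y z \<bullet> \<nu> z)) = Hs z" for z
    using outward_normal_eq[OF _ _ \<nu>] K(2,3) by (cases "z \<in> K"; cases "z \<in> frontier D") (auto simp: Hs_def)
  have "continuous_on (frontier D) (\<lambda>z. \<rho> z * (Y z \<bullet> normal z))"
    by (intro continuous_intros normal_continuous continuous_on_subset[OF Y] continuous_on_subset[OF K(6)])
      (auto simp: frontier_def)
  then have Hsm: "Hs \<in> borel_measurable borel"
    unfolding Hs_def[abs_def] real_scaleR_def[symmetric]
    using compact_Int[OF compact_frontier_D K(1)]
    by (intro borel_measurable_continuous_on_indicator) (auto simp: borel_compact intro: continuous_on_subset)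
  have "(LINT z:frontier D|\<sigma>. \<rho> z * (Y z \<bullet> \<nu> z)) = (LINT z|\<sigma>. Hs z)"
    unfolding set_lebesgue_integral_def real_scaleR_def Hs_eq ..
  also have "\<dots> = (LINT z:slab e|lborel. Hs (proj z) * sqrt (1 + (norm (grad g z))\<^sup>2))"
    by (rule surface_integral_chart[OF \<sigma> Hsm]) (use K(2) in \<open>auto simp: Hs_def indicator_def\<close>)
  also have "\<dots> = (LINT z:slab e|lborel. - H (proj z))"
  proof -
    have "Hs (proj z) * sqrt (1 + (norm (grad g z))\<^sup>2) = - H (proj z)" for z
    proof (cases "proj z \<in> K")
      case True
      then have U: "proj z \<in> U" using K(2) by blast
      then have fr: "proj z \<in> frontier D" "proj z \<in> closure D"
        using in_frontier_iff in_closure_iff by (auto simp: depth_proj)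
      have gr: "grad g (proj z) = grad g z" by (simp add: proj_def grad_g_shift)
      have "normal (proj z) = (1 / sqrt (1 + (norm (grad g z))\<^sup>2)) *\<^sub>R (e - grad g z)" by (simp add: normal_def gr)
      then have "(Y (proj z) \<bullet> normal (proj z)) * sqrt (1 + (norm (grad g z))\<^sup>2) = - (Y (proj z) \<bullet> (grad g z - e))"
        using sqrt_pos[of z] by (simp add: inner_diff_right)
      then show ?thesis using True fr by (simp add: Hs_def H_def gr mult.assoc)
    qed (simp add: Hs_def H0)
    then show ?thesis by simp
  qed
  also have "\<dots> = - (LINT z:slab e|lborel. H (proj z))" by (simp add: set_lebesgue_integral_def)
  also have "\<dots> = (LINT z|lborel. \<rho> z * (indicator D z * G z) + indicator D z * (Y z \<bullet> P z))"
    using slab_eq i\<rho>G iYP by simp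
  also have "\<dots> = (LINT z:D|lborel. \<rho> z * G z + Y z \<bullet> P z)"
    unfolding set_lebesgue_integral_def by (intro Bochner_Integration.integral_cong refl) (simp add: algebra_simps)
  finally show ?thesis .
qed

end


section \<open>The divergence theorem\<close>

lemma C1_bump_exists:
  fixes a :: "'a::euclidean_space"
  assumes r: "r > 0" and S: "cball a (2 * r) \<subseteq> S"
  obtains b b' where "C1_compact S b b'" "\<And>w. 0 \<le> b w" "\<And>w. b w \<le> 1" "\<And>w. w \<in> ball a r \<Longrightarrow> b w = 1"
proof -
  \<comment> \<open>\<open>q \<le> 0\<close> on the ball of radius \<open>r\<close>, and \<open>q \<ge> 1\<close> outside the ball of radius \<open>2 r\<close>.\<close>
  define q where "q w = (w - a) \<bullet> (w - a) / r\<^sup>2 - 1" for w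
  have q_norm: "q w = (norm (w - a))\<^sup>2 / r\<^sup>2 - 1" for w by (simp add: q_def power2_norm_eq_inner)
  have dq: "GDERIV q w :> (2 / r\<^sup>2) *\<^sub>R (w - a)" for w
  proof -
    have "GDERIV (\<lambda>w. (w - a) \<bullet> (w - a)) w :> 2 *\<^sub>R (w - a)"
      unfolding gderiv_def by (auto intro!: derivative_eq_intros simp: inner_commute)
    moreover have "((\<lambda>t. t / r\<^sup>2 - 1) has_real_derivative 1 / r\<^sup>2) (at t)" for t
      using DERIV_diff[OF DERIV_cdivide[OF DERIV_ident, of "r\<^sup>2" t UNIV] DERIV_const[of 1]] by simp
    ultimately have "GDERIV (\<lambda>w. (w - a) \<bullet> (w - a) / r\<^sup>2 - 1) w :> (1 / r\<^sup>2) *\<^sub>R 2 *\<^sub>R (w - a)"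
      by (rule GDERIV_DERIV_compose)
    then show ?thesis by (simp add: q_def[abs_def])
  qed
  show thesis
  proof (rule that)
    show "C1_compact S (\<lambda>w. 1 - ramp (q w)) (\<lambda>w. 0 - hat (q w) *\<^sub>R ((2 / r\<^sup>2) *\<^sub>R (w - a)))"
    proof (rule C1_compactI[OF _ _ compact_cball S])
      show "GDERIV (\<lambda>w. 1 - ramp (q w)) z :> 0 - hat (q z) *\<^sub>R (2 / r\<^sup>2) *\<^sub>R (z - a)" for z
        by (intro GDERIV_diff GDERIV_const GDERIV_DERIV_compose[OF dq] ramp_deriv)
      have "continuous_on UNIV q"
        by (intro continuous_at_imp_continuous_on ballI GDERIV_imp_isCont[OF dq])
      then show "continuous_on UNIV (\<lambda>w. 0 - hat (q w) *\<^sub>R (2 / r\<^sup>2) *\<^sub>R (w - a))"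
        by (intro continuous_intros continuous_on_compose2[OF hat_continuous]) auto
      show "1 - ramp (q z) = 0" if "z \<notin> cball a (2 * r)" for z
      proof -
        have "(2 * r)\<^sup>2 \<le> (norm (z - a))\<^sup>2" using that r by (intro power_mono) (auto simp: dist_norm norm_minus_commute)
        moreover have "2 * r\<^sup>2 \<le> (2 * r)\<^sup>2" by (simp add: power_mult_distrib)
        ultimately have "2 * r\<^sup>2 \<le> (norm (z - a))\<^sup>2" by linarith
        then have "1 \<le> q z" using r by (simp add: q_norm pos_le_divide_eq)
        then show ?thesis by (simp add: ramp_bounds)
      qed
    qed
    show "0 \<le> 1 - ramp (q w)" "1 - ramp (q w) \<le> 1" for w using ramp_bounds(3,4)[of "q w"] by auto
    show "1 - ramp (q w) = 1" if "w \<in> ball a r" for w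
    proof -
      have "(norm (w - a))\<^sup>2 \<le> r\<^sup>2" using that r by (intro power_mono) (auto simp: dist_norm norm_minus_commute)
      then have "q w \<le> 0" using r by (simp add: q_norm field_simps)
      then show ?thesis by (simp add: ramp_bounds)
    qed
  qed
qed

context weak_divergence
begin

text \<open>The boundary is compact, and it has finite measure in a compact neighbourhood of each of its points.\<close>

lemma sigma_frontier_finite: "emeasure \<sigma> (frontier D) < \<infinity>"
proof -
  have "\<exists>r>0. emeasure \<sigma> (frontier D \<inter> cball z r) < \<infinity>" if z: "z \<in> frontier D" for z
  proof -
    obtain e g U where ch: "C1_chart_of D e g U" "z \<in> U" by (rule chart_at[OF z])
    interpret C1_chart_of D e g U by (rule ch(1))
    obtain r where "r > 0" "cball z r \<subseteq> U" using open_U ch(2) open_contains_cball by blast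
    then show ?thesis using surface_measure_chart_finite[OF \<sigma> compact_cball] by blast
  qed
  then obtain r where r: "\<And>z. z \<in> frontier D \<Longrightarrow> r z > 0" "\<And>z. z \<in> frontier D \<Longrightarrow> emeasure \<sigma> (frontier D \<inter> cball z (r z)) < \<infinity>"
    by metis
  obtain C where C: "C \<subseteq> frontier D" "finite C" "frontier D \<subseteq> (\<Union>z\<in>C. ball z (r z))"
    by (rule compactE_image[OF compact_frontier_D, of "frontier D" "\<lambda>z. ball z (r z)"]) (use r(1) in auto)
  have sets: "sets \<sigma> = sets borel" using \<sigma> by (simp add: surface_measure_def)
  have "frontier D \<subseteq> (\<Union>z\<in>C. frontier D \<inter> cball z (r z))" using C(3) ball_subset_cball by blast
  then have "emeasure \<sigma> (frontier D) \<le> emeasure \<sigma> (\<Union>z\<in>C. frontier D \<inter> cball z (r z))"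
    using C(2) by (intro emeasure_mono) (auto simp: sets frontier_closed intro!: sets.finite_UN)
  also have "\<dots> \<le> (\<Sum>z\<in>C. emeasure \<sigma> (frontier D \<inter> cball z (r z)))"
    using C(2) by (intro emeasure_subadditive_finite) (auto simp: sets frontier_closed)
  also have "\<dots> < \<infinity>" using r(2) C(1,2) by (simp add: subset_iff)
  finally show ?thesis .
qed

lemma surface_integrable:
  fixes v :: "'a \<Rightarrow> real"
  assumes v: "continuous_on (frontier D) v"
  shows "set_integrable \<sigma> (frontier D) v"
proof -
  have sets: "sets \<sigma> = sets borel" using \<sigma> by (simp add: surface_measure_def)
  have "bounded (v ` frontier D)" by (intro compact_imp_bounded compact_continuous_image v compact_frontier_D)
  then obtain B where B: "\<And>z. z \<in> frontier D \<Longrightarrow> norm (v z) \<le> B" by (auto simp: bounded_iff)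
  have "(\<lambda>z. indicator (frontier D) z *\<^sub>R v z) \<in> borel_measurable borel"
    by (intro borel_measurable_continuous_on_indicator v) (simp add: borel_closed)
  then have m: "(\<lambda>z. indicator (frontier D) z *\<^sub>R v z) \<in> borel_measurable \<sigma>"
    by (simp add: measurable_cong_sets[OF sets refl])
  have "integrable \<sigma> (\<lambda>z. indicator (frontier D) z *\<^sub>R (indicator (frontier D) z *\<^sub>R v z))"
    by (rule integrableI_bounded_set_indicator[where B=B])
      (use m B sigma_frontier_finite in \<open>auto simp: sets frontier_closed\<close>)
  also have "(\<lambda>z. indicator (frontier D) z *\<^sub>R (indicator (frontier D) z *\<^sub>R v z)) = (\<lambda>z. indicator (frontier D) z *\<^sub>R v z)"
    by (auto simp: indicator_def)
  finally show ?thesis by (simp add: set_integrable_def)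
qed

lemma normal_continuous_on_frontier: "continuous_on (frontier D) \<nu>"
  unfolding continuous_on_eq_continuous_within
proof
  fix z assume z: "z \<in> frontier D"
  obtain e g U where ch: "C1_chart_of D e g U" "z \<in> U" by (rule chart_at[OF z])
  interpret C1_chart_of D e g U by (rule ch(1))
  have eq: "normal w = \<nu> w" if "w \<in> frontier D \<inter> U" for w
    using outward_normal_eq[OF _ _ \<nu>, of w] that by simp
  have "isCont normal z" using normal_continuous[of UNIV] by (simp add: continuous_on_eq_continuous_at)
  then have "(normal \<longlongrightarrow> normal z) (at z within frontier D)"
    unfolding isCont_def by (rule tendsto_within_subset) simp
  moreover have "\<forall>\<^sub>F w in at z within frontier D. normal w = \<nu> w"
  proof -
    have "\<forall>\<^sub>F w in at z within frontier D. w \<in> U"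
      using open_U ch(2) by (auto simp: eventually_at_topological)
    moreover have "\<forall>\<^sub>F w in at z within frontier D. w \<in> frontier D" by (simp add: eventually_at_filter)
    ultimately show ?thesis by eventually_elim (simp add: eq)
  qed
  ultimately have "(\<nu> \<longlongrightarrow> normal z) (at z within frontier D)" by (rule Lim_transform_eventually)
  then show "continuous (at z within frontier D) \<nu>" using eq z ch(2) by (simp add: continuous_within)
qed

text \<open>The divergence theorem for \<open>\<rho> Y\<close>, where \<open>P\<close> is the gradient of \<open>\<rho>\<close>.\<close>

abbreviation balanced :: "('a \<Rightarrow> real) \<Rightarrow> ('a \<Rightarrow> 'a) \<Rightarrow> bool" where
  "balanced \<rho> P \<equiv> (LINT z:frontier D|\<sigma>. \<rho> z * (Y z \<bullet> \<nu> z)) = (LINT z:D|lborel. \<rho> z * G z + Y z \<bullet> P z)"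

lemma balanced_interior:
  assumes \<psi>: "C1_compact D \<psi> \<Psi>" "\<And>z. \<psi> z \<ge> 0"
  shows "balanced \<psi> \<Psi>"
proof -
  obtain K where K: "compact K" "K \<subseteq> D" "\<And>z. z \<notin> K \<Longrightarrow> \<psi> z = 0" "\<And>z. z \<notin> K \<Longrightarrow> \<Psi> z = 0"
    "\<And>z. GDERIV \<psi> z :> \<Psi> z" "continuous_on UNIV \<psi>" "continuous_on UNIV \<Psi>"
    by (rule C1_compactE[OF \<psi>(1)]) (rule that)
  have off: "\<psi> z = 0" "\<Psi> z = 0" if "z \<notin> D" for z using K(2,3,4) that by blast+
  have z0: "indicator (frontier D) z *\<^sub>R (\<psi> z * (Y z \<bullet> \<nu> z)) = 0" for z
    using off(1)[of z] open_D by (cases "z \<in> frontier D") (auto simp: frontier_def interior_open)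
  have "(LINT z:frontier D|\<sigma>. \<psi> z * (Y z \<bullet> \<nu> z)) = 0"
    unfolding set_lebesgue_integral_def z0 by simp
  moreover have "(LINT z:D|lborel. \<psi> z * G z + Y z \<bullet> \<Psi> z) = 0"
  proof -
    have e1: "indicator D z * (\<psi> z * G z) = \<psi> z * G z" for z using off[of z] by (cases "z \<in> D") auto
    have e2: "indicator D z * (Y z \<bullet> \<Psi> z) = Y z \<bullet> \<Psi> z" for z using off[of z] by (cases "z \<in> D") auto
    have i1: "integrable lborel (\<lambda>z. \<psi> z * G z)" using integrable_mult_G[OF K(6)] by (simp add: e1)
    have "integrable lborel (\<lambda>z. indicator D z * (Y z \<bullet> \<Psi> z))"
      by (intro set_integrable_D continuous_intros Y continuous_on_subset[OF K(7)]) auto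
    then have i2: "integrable lborel (\<lambda>z. Y z \<bullet> \<Psi> z)" by (simp only: e2)
    have "(LINT z:D|lborel. \<psi> z * G z + Y z \<bullet> \<Psi> z) = (LINT z|lborel. \<psi> z * G z + Y z \<bullet> \<Psi> z)"
      unfolding set_lebesgue_integral_def real_scaleR_def distrib_left e1 e2 ..
    also have "\<dots> = 0" using i1 i2 div[OF \<psi>] by simp
    finally show ?thesis .
  qed
  ultimately show ?thesis by simp
qed

text \<open>The splitting \<open>\<rho> = b \<rho> + (1 - b) \<rho>\<close> takes the place of a partition of unity.\<close>

lemma balanced_split:
  assumes \<rho>: "\<And>z. GDERIV \<rho> z :> P z" "continuous_on UNIV P"
    and b: "\<And>z. GDERIV b z :> b' z" "continuous_on UNIV b'"
    and 1: "balanced (\<lambda>z. b z * \<rho> z) (\<lambda>z. b z *\<^sub>R P z + \<rho> z *\<^sub>R b' z)"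
    and 2: "balanced (\<lambda>z. (1 - b z) * \<rho> z) (\<lambda>z. (1 - b z) *\<^sub>R P z + \<rho> z *\<^sub>R (0 - b' z))"
  shows "balanced \<rho> P"
proof -
  have c: "continuous_on UNIV \<rho>" "continuous_on UNIV b"
    using GDERIV_imp_isCont[OF \<rho>(1)] GDERIV_imp_isCont[OF b(1)] by (auto intro!: continuous_at_imp_continuous_on)
  have sI: "set_integrable \<sigma> (frontier D) (\<lambda>z. h z * (Y z \<bullet> \<nu> z))" if "continuous_on UNIV h" for h :: "'a \<Rightarrow> real"
    by (intro surface_integrable continuous_intros continuous_on_subset[OF that] continuous_on_subset[OF Y] normal_continuous_on_frontier)
      (auto simp: frontier_def)
  have dI: "set_integrable lborel D (\<lambda>z. h z * G z + Y z \<bullet> V z)" if "continuous_on UNIV h" "continuous_on UNIV V" for h :: "'a \<Rightarrow> real" and V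
    unfolding set_integrable_def real_scaleR_def distrib_left
    by (intro Bochner_Integration.integrable_add integrable_mult_G that set_integrable_D continuous_intros Y continuous_on_subset[OF that(2)]) auto
  have "(LINT z:frontier D|\<sigma>. \<rho> z * (Y z \<bullet> \<nu> z)) =
     (LINT z:frontier D|\<sigma>. (b z * \<rho> z) * (Y z \<bullet> \<nu> z) + ((1 - b z) * \<rho> z) * (Y z \<bullet> \<nu> z))"
    by (simp add: algebra_simps)
  also have "\<dots> = (LINT z:frontier D|\<sigma>. (b z * \<rho> z) * (Y z \<bullet> \<nu> z)) + (LINT z:frontier D|\<sigma>. ((1 - b z) * \<rho> z) * (Y z \<bullet> \<nu> z))"
    by (intro set_integral_add sI continuous_intros c)
  also have "\<dots> = (LINT z:D|lborel. (b z * \<rho> z) * G z + Y z \<bullet> (b z *\<^sub>R P z + \<rho> z *\<^sub>R b' z))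
     + (LINT z:D|lborel. ((1 - b z) * \<rho> z) * G z + Y z \<bullet> ((1 - b z) *\<^sub>R P z + \<rho> z *\<^sub>R (0 - b' z)))"
    unfolding 1 2 ..
  also have "\<dots> = (LINT z:D|lborel. ((b z * \<rho> z) * G z + Y z \<bullet> (b z *\<^sub>R P z + \<rho> z *\<^sub>R b' z))
     + (((1 - b z) * \<rho> z) * G z + Y z \<bullet> ((1 - b z) *\<^sub>R P z + \<rho> z *\<^sub>R (0 - b' z))))"
    by (intro set_integral_add(2)[symmetric] dI continuous_intros c \<rho>(2) b(2))
  also have "\<dots> = (LINT z:D|lborel. \<rho> z * G z + Y z \<bullet> P z)"
    unfolding set_lebesgue_integral_def
    by (intro Bochner_Integration.integral_cong refl) (simp add: inner_add_right inner_diff_right algebra_simps)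
  finally show ?thesis .
qed

text \<open>Finitely many bump functions, each supported in a chart or in \<open>D\<close>, are such that at every point of the closure of \<open>D\<close> one of them
  equals \<open>1\<close>. Splitting off the parts \<open>b \<rho>\<close> one after the other leaves the function \<open>1\<close> times the product of all
  \<open>1 - b\<close>, which vanishes on the closure of \<open>D\<close>.\<close>

theorem divergence_theorem:
  "(LINT z:frontier D|\<sigma>. Y z \<bullet> \<nu> z) = (LINT z:D|lborel. G z)"
proof -
  define adm where "adm b b' \<longleftrightarrow> (\<forall>w. 0 \<le> b w \<and> b w \<le> 1) \<and>
    (\<exists>S. open S \<and> C1_compact S b b' \<and> (S = D \<or> (\<exists>e g. C1_chart_of D e g S)))" for b :: "'a \<Rightarrow> real" and b'
  have cover: "\<exists>b b' r. r > 0 \<and> adm b b' \<and> (\<forall>w\<in>ball z r. b w = 1)" if "z \<in> closure D" for z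
  proof -
    obtain S where S: "open S" "z \<in> S" "S = D \<or> (\<exists>e g. C1_chart_of D e g S)"
    proof (cases "z \<in> D")
      case True
      then show thesis using that open_D by blast
    next
      case False
      then have "z \<in> frontier D" using \<open>z \<in> closure D\<close> open_D by (simp add: frontier_def interior_open)
      then obtain e g U where "C1_chart_of D e g U" "z \<in> U" by (rule chart_at)
      then show thesis using that C1_chart_of.open_U by blast
    qed
    obtain r where r: "r > 0" "cball z r \<subseteq> S" using S(1,2) open_contains_cball by blast
    obtain b b' where b: "C1_compact S b b'" "\<And>w. 0 \<le> b w" "\<And>w. b w \<le> 1" "\<And>w. w \<in> ball z (r / 2) \<Longrightarrow> b w = 1"
      by (rule C1_bump_exists[of "r / 2" z S]) (use r in auto)
    have "adm b b'" unfolding adm_def using b S by blast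
    then show ?thesis using b(4) r(1) by (intro exI[of _ b] exI[of _ b'] exI[of _ "r / 2"]) auto
  qed
  then obtain b b' r where b: "\<And>z. z \<in> closure D \<Longrightarrow> r z > 0" "\<And>z. z \<in> closure D \<Longrightarrow> adm (b z) (b' z)"
    "\<And>z w. z \<in> closure D \<Longrightarrow> w \<in> ball z (r z) \<Longrightarrow> b z w = 1"
    by metis
  obtain C where C: "C \<subseteq> closure D" "finite C" "closure D \<subseteq> (\<Union>z\<in>C. ball z (r z))"
    by (rule compactE_image[OF compact_closure_D, of "closure D" "\<lambda>z. ball z (r z)"]) (use b(1) in auto)
  have step: "balanced \<rho> P" if "finite J" "J \<subseteq> closure D" "\<And>z. GDERIV \<rho> z :> P z" "continuous_on UNIV P" "\<And>z. \<rho> z \<ge> 0"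
    "\<And>w. w \<in> closure D \<Longrightarrow> \<rho> w \<noteq> 0 \<Longrightarrow> \<exists>z\<in>J. b z w = 1" for J \<rho> P
    using that
  proof (induction J arbitrary: \<rho> P rule: finite_induct)
    case empty
    have \<rho>0: "\<rho> z = 0" if "z \<in> closure D" for z using empty.prems(5) that by blast
    have P0: "P z = 0" if "z \<in> D" for z
    proof (rule GDERIV_unique[OF empty.prems(2)])
      show "GDERIV \<rho> z :> 0"
        by (rule GDERIV_cong_open[OF open_D that _ GDERIV_const[of 0]]) (use \<rho>0 closure_subset in blast)
    qed
    have z1: "indicator (frontier D) z *\<^sub>R (\<rho> z * (Y z \<bullet> \<nu> z)) = 0" for z
      using \<rho>0[of z] by (cases "z \<in> frontier D") (auto simp: frontier_def)
    have z2: "indicator D z *\<^sub>R (\<rho> z * G z + Y z \<bullet> P z) = 0" for z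
      using \<rho>0[of z] P0[of z] closure_subset[of D] by (cases "z \<in> D") auto
    show ?case unfolding set_lebesgue_integral_def z1 z2 by simp
  next
    case (insert x J)
    have x: "x \<in> closure D" using insert.prems(1) by simp
    obtain S where S: "open S" "C1_compact S (b x) (b' x)" "S = D \<or> (\<exists>e g. C1_chart_of D e g S)"
      and b01: "\<And>w. 0 \<le> b x w" "\<And>w. b x w \<le> 1" using b(2)[OF x] unfolding adm_def by blast
    have db: "\<And>z. GDERIV (b x) z :> b' x z" "continuous_on UNIV (b' x)"
      using S(2) unfolding C1_compact_def by blast+
    have \<rho>c: "continuous_on UNIV \<rho>"
      using GDERIV_imp_isCont[OF insert.prems(2)] by (intro continuous_at_imp_continuous_on) blast
    have bc: "continuous_on UNIV (b x)"
      using GDERIV_imp_isCont[OF db(1)] by (intro continuous_at_imp_continuous_on) blast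
    have prod: "C1_compact S (\<lambda>z. b x z * \<rho> z) (\<lambda>z. b x z *\<^sub>R P z + \<rho> z *\<^sub>R b' x z)"
      by (rule C1_compact_mult[OF S(2,1) insert.prems(2)]) (rule continuous_on_subset[OF insert.prems(3)], simp)
    have nonneg: "0 \<le> b x z * \<rho> z" for z using b01(1) insert.prems(4) by simp
    from S(3) have 1: "balanced (\<lambda>z. b x z * \<rho> z) (\<lambda>z. b x z *\<^sub>R P z + \<rho> z *\<^sub>R b' x z)"
    proof (elim disjE exE)
      assume "S = D"
      from balanced_interior[OF prod[unfolded this] nonneg] show ?thesis .
    next
      fix e g assume "C1_chart_of D e g S"
      from divergence_chart[OF this prod nonneg] show ?thesis .
    qed
    have 2: "balanced (\<lambda>z. (1 - b x z) * \<rho> z) (\<lambda>z. (1 - b x z) *\<^sub>R P z + \<rho> z *\<^sub>R (0 - b' x z))"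
    proof (rule insert.IH)
      show "J \<subseteq> closure D" using insert.prems(1) by simp
      show "GDERIV (\<lambda>z. (1 - b x z) * \<rho> z) z :> (1 - b x z) *\<^sub>R P z + \<rho> z *\<^sub>R (0 - b' x z)" for z
        by (rule GDERIV_mult[OF GDERIV_diff[OF GDERIV_const db(1)] insert.prems(2)])
      show "continuous_on UNIV (\<lambda>z. (1 - b x z) *\<^sub>R P z + \<rho> z *\<^sub>R (0 - b' x z))"
        by (intro continuous_intros bc \<rho>c db(2) insert.prems(3))
      show "0 \<le> (1 - b x z) * \<rho> z" for z using b01 insert.prems(4) by simp
      show "\<exists>z\<in>J. b z w = 1" if "w \<in> closure D" "(1 - b x w) * \<rho> w \<noteq> 0" for w
        using insert.prems(5)[OF that(1)] that(2) by auto
    qed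
    show ?case by (rule balanced_split[OF insert.prems(2,3) db 1 2])
  qed
  have "balanced (\<lambda>z. 1) (\<lambda>z. 0)"
  proof (rule step[OF C(2,1) GDERIV_const])
    show "\<exists>z\<in>C. b z w = 1" if "w \<in> closure D" for w using C(1,3) b(3) that by blast
  qed auto
  then show ?thesis by simp
qed

end


section \<open>The integral identities\<close>

lemma set_integral_lebesgue_eq_lborel:
  fixes v :: "'a::euclidean_space \<Rightarrow> real"
  assumes "(\<lambda>z. indicator D z * v z) \<in> borel_measurable borel"
  shows "(LINT z:D|lebesgue. v z) = (LINT z:D|lborel. v z)"
  using assms by (simp add: set_lebesgue_integral_def integral_completion)

text \<open>The flux of \<open>grushin_field\<close> through the boundary, separated into its three parts. Each part is integrable by itself, since
  \<open>u\<close> and its gradient are continuous up to the compact boundary.\<close>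

lemma grushin_identity_in_direction:
  fixes \<Omega> D :: "((real ^ 'n) \<times> (real ^ 'm)) set" and u :: "(real ^ 'n) \<times> (real ^ 'm) \<Rightarrow> real"
  assumes p: "p > 1" and \<gamma>: "\<gamma> \<ge> 0" and \<Omega>: "open \<Omega>" "bounded \<Omega>"
    and f: "continuous_on UNIV (\<lambda>(z, s). f z s)" and u_sol: "weak_solution \<Omega> \<gamma> p f u"
    and u_C1: "\<And>z. z \<in> \<Omega> \<Longrightarrow> GDERIV u z :> Du z" "continuous_on \<Omega> Du"
    and D: "C1_domain D" "D \<subseteq> \<Omega>"
    and u_boundary: "continuous_on (closure D) u" "continuous_on (closure D) Du"
    and \<nu>: "\<And>z. z \<in> frontier D \<Longrightarrow> outward_normal D z (\<nu> z)" and \<sigma>: "surface_measure D \<sigma>"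
    and e: "norm e = 1"
    and F: "\<And>z. z \<in> D \<Longrightarrow> (\<lambda>t. primitive f (z + t *\<^sub>R e) (u z)) differentiable (at 0)"
      "set_integrable lebesgue D (\<lambda>z. explicit_partial e (primitive f) z (u z))"
    and M: "integrable lborel M"
      "AE z in lborel. z \<in> D \<longrightarrow> (\<forall>t. \<bar>t\<bar> \<le> 1 \<longrightarrow>
         \<bar>grushin_energy p \<gamma> (z + t *\<^sub>R e) (Du z) - grushin_energy p \<gamma> z (Du z)\<bar> \<le> M z * \<bar>t\<bar>)"
    and Le: "AE z in lborel. z \<in> D \<longrightarrow> ((\<lambda>t. grushin_energy p \<gamma> (z + t *\<^sub>R e) (Du z)) has_real_derivative Le z) (at 0)"
      "(\<lambda>z. indicator D z * Le z) \<in> borel_measurable borel"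
  shows "1 / p * (LINT z:frontier D|\<sigma>. norm (grushin \<gamma> z (Du z)) powr p * (\<nu> z \<bullet> e))
      - (LINT z:frontier D|\<sigma>. norm (grushin \<gamma> z (Du z)) powr (p - 2) * (Du z \<bullet> e) * (grushin \<gamma> z (Du z) \<bullet> grushin \<gamma> z (\<nu> z)))
      - (LINT z:D|lebesgue. Le z)
      = (LINT z:frontier D|\<sigma>. primitive f z (u z) * (\<nu> z \<bullet> e)) - (LINT z:D|lebesgue. explicit_partial e (primitive f) z (u z))"
proof -
  let ?F = "\<lambda>z. explicit_partial e (primitive f) z (u z)"
  have oD: "open D" using D(1) by (simp add: C1_domain_def)
  have uD: "GDERIV u z :> Du z" if "z \<in> D" for z using u_C1(1) D(2) that by blast
  have DuD: "continuous_on D Du" by (rule continuous_on_subset[OF u_C1(2) D(2)])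
  have cuD: "continuous_on D u" by (rule continuous_on_subset[OF u_boundary(1) closure_subset])
  have weak: "(LINT z|lborel. grushin_flux p \<gamma> z (Du z) \<bullet> \<Phi> z) = (LINT z|lborel. f z (u z) * \<phi> z)"
    if "C1_compact D \<phi> \<Phi>" for \<phi> \<Phi>
    by (rule weak_solution_C1_compact[OF \<Omega> p \<gamma> f u_sol u_C1 C1_compact_mono[OF that D(2)]])
  have Fm: "(\<lambda>z. indicator D z * ?F z) \<in> borel_measurable borel"
    by (rule explicit_partial_measurable[OF f oD cuD F(1)])
  have "integrable lebesgue (\<lambda>z. indicator D z * ?F z)" using F(2) by (simp add: set_integrable_def)
  then have iF: "integrable lborel (\<lambda>z. indicator D z * ?F z)"
    by (subst (asm) integrable_completion) (use Fm in simp_all)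
  have iL: "integrable lborel (\<lambda>z. indicator D z * Le z)"
    by (rule integrable_derivative_of_dominated[where g="\<lambda>z t. grushin_energy p \<gamma> (z + t *\<^sub>R e) (Du z)" and M=M])
      (use M Le in simp_all)
  have cL: "continuous_on (closure D) (\<lambda>z. grushin_energy p \<gamma> z (Du z))"
    using p by (intro continuous_intros \<gamma> u_boundary(2)) auto
  have cA: "continuous_on (closure D) (\<lambda>z. grushin_flux p \<gamma> z (Du z))"
    by (intro continuous_intros p \<gamma> u_boundary(2))
  have cV: "continuous_on (closure D) (\<lambda>z. primitive f z (u z))"
    by (intro primitive_continuous[OF f] continuous_intros u_boundary(1))
  interpret weak_divergence D \<sigma> \<nu> "grushin_field p \<gamma> f u Du e" "\<lambda>z. Le z - ?F z"
  proof
    show "C1_domain D" by (rule D(1))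
    show "bounded D" by (rule bounded_subset[OF \<Omega>(2) D(2)])
    show "z \<in> frontier D \<Longrightarrow> outward_normal D z (\<nu> z)" for z by (rule \<nu>)
    show "surface_measure D \<sigma>" by (rule \<sigma>)
    show "continuous_on (closure D) (grushin_field p \<gamma> f u Du e)"
      unfolding grushin_field_def by (intro continuous_intros cL cA cV u_boundary(2))
    show "integrable lborel (\<lambda>z. indicator D z * (Le z - ?F z))"
      using iL iF by (simp add: right_diff_distrib)
    fix \<psi> \<Psi> assume \<psi>: "C1_compact D \<psi> \<Psi>" "\<And>z. 0 \<le> \<psi> z"
    show "(LINT z|lborel. grushin_field p \<gamma> f u Du e z \<bullet> \<Psi> z) = - (LINT z|lborel. \<psi> z * (Le z - ?F z))"
      by (rule grushin_field_divergence[where M=M]) (fact oD p \<gamma> f uD DuD e weak F M Le \<psi>)+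
  qed
  have fr: "frontier D \<subseteq> closure D" by (auto simp: frontier_def)
  note onF = continuous_on_subset[OF _ fr]
  have 1: "set_integrable \<sigma> (frontier D) (\<lambda>z. grushin_energy p \<gamma> z (Du z) * (\<nu> z \<bullet> e))"
    by (intro surface_integrable continuous_intros onF[OF cL] normal_continuous_on_frontier)
  have 2: "set_integrable \<sigma> (frontier D) (\<lambda>z. (Du z \<bullet> e) * (grushin_flux p \<gamma> z (Du z) \<bullet> \<nu> z))"
    by (intro surface_integrable continuous_intros onF[OF cA] onF[OF u_boundary(2)] normal_continuous_on_frontier)
  have 3: "set_integrable \<sigma> (frontier D) (\<lambda>z. primitive f z (u z) * (\<nu> z \<bullet> e))"
    by (intro surface_integrable continuous_intros onF[OF cV] normal_continuous_on_frontier)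
  have "(LINT z:frontier D|\<sigma>. grushin_field p \<gamma> f u Du e z \<bullet> \<nu> z) =
      (LINT z:frontier D|\<sigma>. grushin_energy p \<gamma> z (Du z) * (\<nu> z \<bullet> e) - (Du z \<bullet> e) * (grushin_flux p \<gamma> z (Du z) \<bullet> \<nu> z) - primitive f z (u z) * (\<nu> z \<bullet> e))"
    by (simp add: grushin_field_def inner_diff_left inner_commute[of e])
  also have "\<dots> = (LINT z:frontier D|\<sigma>. grushin_energy p \<gamma> z (Du z) * (\<nu> z \<bullet> e))
      - (LINT z:frontier D|\<sigma>. (Du z \<bullet> e) * (grushin_flux p \<gamma> z (Du z) \<bullet> \<nu> z)) - (LINT z:frontier D|\<sigma>. primitive f z (u z) * (\<nu> z \<bullet> e))"
    using 1 2 3 by simp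
  also have "(LINT z:frontier D|\<sigma>. grushin_energy p \<gamma> z (Du z) * (\<nu> z \<bullet> e))
      = 1 / p * (LINT z:frontier D|\<sigma>. norm (grushin \<gamma> z (Du z)) powr p * (\<nu> z \<bullet> e))"
    by (subst set_integral_mult_right[symmetric]) (simp add: grushin_energy_def)
  also have "(LINT z:frontier D|\<sigma>. (Du z \<bullet> e) * (grushin_flux p \<gamma> z (Du z) \<bullet> \<nu> z))
      = (LINT z:frontier D|\<sigma>. norm (grushin \<gamma> z (Du z)) powr (p - 2) * (Du z \<bullet> e) * (grushin \<gamma> z (Du z) \<bullet> grushin \<gamma> z (\<nu> z)))"
    by (simp add: grushin_flux_inner mult_ac)
  finally have "1 / p * (LINT z:frontier D|\<sigma>. norm (grushin \<gamma> z (Du z)) powr p * (\<nu> z \<bullet> e))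
      - (LINT z:frontier D|\<sigma>. norm (grushin \<gamma> z (Du z)) powr (p - 2) * (Du z \<bullet> e) * (grushin \<gamma> z (Du z) \<bullet> grushin \<gamma> z (\<nu> z)))
      - (LINT z:frontier D|\<sigma>. primitive f z (u z) * (\<nu> z \<bullet> e)) = (LINT z:D|lborel. Le z - ?F z)"
    using divergence_theorem by simp
  also have "\<dots> = (LINT z:D|lborel. Le z) - (LINT z:D|lborel. ?F z)"
    using iL iF by (intro set_integral_diff(2)) (simp_all add: set_integrable_def)
  also have "\<dots> = (LINT z:D|lebesgue. Le z) - (LINT z:D|lebesgue. ?F z)"
    using Le(2) Fm by (simp add: set_integral_lebesgue_eq_lborel)
  finally show ?thesis by linarith
qed

theorem theorem1p1:
  fixes \<Omega> D :: "((real ^ 'n) \<times> (real ^ 'm)) set"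
    and f :: "(real ^ 'n) \<times> (real ^ 'm) \<Rightarrow> real \<Rightarrow> real"
    and u :: "(real ^ 'n) \<times> (real ^ 'm) \<Rightarrow> real"
    and Du \<nu> :: "(real ^ 'n) \<times> (real ^ 'm) \<Rightarrow> (real ^ 'n) \<times> (real ^ 'm)"
    and \<sigma> :: "((real ^ 'n) \<times> (real ^ 'm)) measure"
    and p \<gamma> :: real
  defines "F \<equiv> primitive f"
  assumes dim: "CARD('n) + CARD('m) \<ge> 3"
    and p: "p > 1" and \<gamma>: "\<gamma> \<ge> 0"
    and \<Omega>: "open \<Omega>" "connected \<Omega>" "bounded \<Omega>"
    and f: "continuous_on UNIV (\<lambda>(z, s). f z s)"
    and u_sol: "weak_solution \<Omega> \<gamma> p f u"
    and u_C1: "\<And>z. z \<in> \<Omega> \<Longrightarrow> GDERIV u z :> Du z" "continuous_on \<Omega> Du"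
    and D: "C1_domain D" "D \<subseteq> \<Omega>"
    and u_boundary: "continuous_on (closure D) u" "continuous_on (closure D) Du"
    and \<nu>: "\<And>z. z \<in> frontier D \<Longrightarrow> outward_normal D z (\<nu> z)"
    and \<sigma>: "surface_measure D \<sigma>"
    and F_partial: "\<And>b z. b \<in> Basis \<Longrightarrow> z \<in> D \<Longrightarrow>
          (\<lambda>t. F (z + t *\<^sub>R b) (u z)) differentiable (at 0)"
        "\<And>b. b \<in> Basis \<Longrightarrow> set_integrable lebesgue D (\<lambda>z. explicit_partial b F z (u z))"
  shows "(\<forall>i::'n.
      1 / p * (LINT z:frontier D|\<sigma>. norm (grushin \<gamma> z (Du z)) powr p * fst (\<nu> z) $ i)
      - (LINT z:frontier D|\<sigma>. norm (grushin \<gamma> z (Du z)) powr (p - 2) * fst (Du z) $ i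
            * (grushin \<gamma> z (Du z) \<bullet> grushin \<gamma> z (\<nu> z)))
      - (LINT z:D|lebesgue. norm (grushin \<gamma> z (Du z)) powr (p - 2) * \<gamma>
            * norm (fst z) powr (2 * (\<gamma> - 1)) * fst z $ i * (norm (snd (Du z)))\<^sup>2)
      = (LINT z:frontier D|\<sigma>. F z (u z) * fst (\<nu> z) $ i)
        - (LINT z:D|lebesgue. explicit_partial (axis i 1, 0) F z (u z)))
    \<and> (\<forall>j::'m.
      1 / p * (LINT z:frontier D|\<sigma>. norm (grushin \<gamma> z (Du z)) powr p * snd (\<nu> z) $ j)
      - (LINT z:frontier D|\<sigma>. norm (grushin \<gamma> z (Du z)) powr (p - 2) * snd (Du z) $ j
            * (grushin \<gamma> z (Du z) \<bullet> grushin \<gamma> z (\<nu> z)))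
      = (LINT z:frontier D|\<sigma>. F z (u z) * snd (\<nu> z) $ j)
        - (LINT z:D|lebesgue. explicit_partial (0, axis j 1) F z (u z)))"
proof -
  have oD: "open D" using D(1) by (simp add: C1_domain_def)
  have bD: "bounded D" by (rule bounded_subset[OF \<Omega>(3) D(2)])
  have DuD: "continuous_on D Du" by (rule continuous_on_subset[OF u_C1(2) D(2)])
  note Fp = F_partial[unfolded F_def]
  {
    fix i :: 'n
    let ?e = "x_dir i :: (real ^ 'n) \<times> (real ^ 'm)"
    let ?Le = "\<lambda>z. norm (grushin \<gamma> z (Du z)) powr (p - 2) * \<gamma>
            * norm (fst z) powr (2 * (\<gamma> - 1)) * fst z $ i * (norm (snd (Du z)))\<^sup>2"
    have e: "?e \<in> Basis" by (auto simp: Basis_prod_def axis_in_Basis_iff)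
    have ze: "z \<bullet> ?e = fst z $ i" for z by (simp add: inner_prod_def inner_axis)
    \<comment> \<open>On the hyperplane \<open>x\<^sub>i = 0\<close>, a null set, the bound is not available and the derivative may not exist.\<close>
    have ne: "AE z in lborel. z \<bullet> ?e \<noteq> 0" using e by (intro AE_inner_neq_0) auto
    have "bounded (Du ` closure D)"
      using bD by (intro compact_imp_bounded compact_continuous_image u_boundary) simp
    then obtain B where B: "\<And>z. z \<in> D \<Longrightarrow> norm (Du z) \<le> B"
      using closure_subset[of D] by (auto simp: bounded_iff)
    obtain R where R: "\<And>z. z \<in> D \<Longrightarrow> norm z \<le> R" using bD by (auto simp: bounded_iff)
    obtain M :: "(real ^ 'n) \<times> (real ^ 'm) \<Rightarrow> real" where M: "integrable lborel M"
      "\<And>z \<xi> t. norm z \<le> R \<Longrightarrow> norm \<xi> \<le> B \<Longrightarrow> z \<bullet> ?e \<noteq> 0 \<Longrightarrow> \<bar>t\<bar> \<le> 1 \<Longrightarrow>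
       \<bar>grushin_energy p \<gamma> (z + t *\<^sub>R ?e) \<xi> - grushin_energy p \<gamma> z \<xi>\<bar> \<le> M z * \<bar>t\<bar>"
      using grushin_energy_x_domination[OF p \<gamma>] by blast
    have dom: "AE z in lborel. z \<in> D \<longrightarrow> (\<forall>t. \<bar>t\<bar> \<le> 1 \<longrightarrow>
         \<bar>grushin_energy p \<gamma> (z + t *\<^sub>R ?e) (Du z) - grushin_energy p \<gamma> z (Du z)\<bar> \<le> M z * \<bar>t\<bar>)"
      using ne by eventually_elim (use M(2) R B in blast)
    have deriv: "AE z in lborel. z \<in> D \<longrightarrow> ((\<lambda>t. grushin_energy p \<gamma> (z + t *\<^sub>R ?e) (Du z)) has_real_derivative ?Le z) (at 0)"
      using ne
    proof eventually_elim
      case (elim z)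
      then have "fst z \<noteq> 0" by (auto simp: ze)
      then show ?case by (intro impI grushin_energy_x_derivative p \<gamma>)
    qed
    have meas: "(\<lambda>z. indicator D z * ?Le z) \<in> borel_measurable borel"
    proof -
      \<comment> \<open>For \<open>p < 2\<close> the factor \<open>|\<nabla>\<^sub>\<gamma>u|\<^sup>p\<^sup>-\<^sup>2\<close> may be discontinuous, so measurability is obtained factor by factor.\<close>
      have n: "(\<lambda>z. indicator D z *\<^sub>R norm (grushin \<gamma> z (Du z))) \<in> borel_measurable borel"
        using oD by (intro borel_measurable_continuous_on_indicator continuous_intros \<gamma> DuD) auto
      have s: "(\<lambda>z. indicator D z *\<^sub>R (norm (snd (Du z)))\<^sup>2) \<in> borel_measurable borel"
        using oD by (intro borel_measurable_continuous_on_indicator continuous_intros DuD) auto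
      have x: "(\<lambda>z::(real ^ 'n) \<times> (real ^ 'm). norm (fst z)) \<in> borel_measurable borel"
        "(\<lambda>z::(real ^ 'n) \<times> (real ^ 'm). fst z $ i) \<in> borel_measurable borel"
        by (intro borel_measurable_continuous_onI continuous_intros)+
      have "(\<lambda>z. (indicator D z *\<^sub>R norm (grushin \<gamma> z (Du z))) powr (p - 2) * \<gamma> * norm (fst z) powr (2 * (\<gamma> - 1)) * fst z $ i
          * (indicator D z *\<^sub>R (norm (snd (Du z)))\<^sup>2)) \<in> borel_measurable borel"
        by (intro borel_measurable_times powr_real_measurable n s x borel_measurable_const)
      also have "(\<lambda>z. (indicator D z *\<^sub>R norm (grushin \<gamma> z (Du z))) powr (p - 2) * \<gamma> * norm (fst z) powr (2 * (\<gamma> - 1)) * fst z $ i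
          * (indicator D z *\<^sub>R (norm (snd (Du z)))\<^sup>2)) = (\<lambda>z. indicator D z * ?Le z)"
        by (auto simp: indicator_def)
      finally show ?thesis .
    qed
    have "1 / p * (LINT z:frontier D|\<sigma>. norm (grushin \<gamma> z (Du z)) powr p * (\<nu> z \<bullet> ?e))
      - (LINT z:frontier D|\<sigma>. norm (grushin \<gamma> z (Du z)) powr (p - 2) * (Du z \<bullet> ?e) * (grushin \<gamma> z (Du z) \<bullet> grushin \<gamma> z (\<nu> z)))
      - (LINT z:D|lebesgue. ?Le z)
      = (LINT z:frontier D|\<sigma>. primitive f z (u z) * (\<nu> z \<bullet> ?e)) - (LINT z:D|lebesgue. explicit_partial ?e (primitive f) z (u z))"
      by (rule grushin_identity_in_direction[where M=M and \<Omega>=\<Omega>])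
        (fact p \<gamma> \<Omega> f u_sol u_C1 D u_boundary \<nu> \<sigma> norm_Basis[OF e] Fp(1)[OF e] Fp(2)[OF e] M(1) dom deriv meas)+
    note this[unfolded ze]
  }
  moreover {
    fix j :: 'm
    let ?e = "y_dir j :: (real ^ 'n) \<times> (real ^ 'm)"
    have e: "?e \<in> Basis" by (auto simp: Basis_prod_def axis_in_Basis_iff)
    have ze: "z \<bullet> ?e = snd z $ j" for z by (simp add: inner_prod_def inner_axis)
    have "1 / p * (LINT z:frontier D|\<sigma>. norm (grushin \<gamma> z (Du z)) powr p * (\<nu> z \<bullet> ?e))
      - (LINT z:frontier D|\<sigma>. norm (grushin \<gamma> z (Du z)) powr (p - 2) * (Du z \<bullet> ?e) * (grushin \<gamma> z (Du z) \<bullet> grushin \<gamma> z (\<nu> z)))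
      - (LINT z:D|lebesgue. 0)
      = (LINT z:frontier D|\<sigma>. primitive f z (u z) * (\<nu> z \<bullet> ?e)) - (LINT z:D|lebesgue. explicit_partial ?e (primitive f) z (u z))"
    proof (rule grushin_identity_in_direction[where M="\<lambda>_. 0" and \<Omega>=\<Omega>])
      show "AE z in lborel. z \<in> D \<longrightarrow> (\<forall>t. \<bar>t\<bar> \<le> 1 \<longrightarrow>
         \<bar>grushin_energy p \<gamma> (z + t *\<^sub>R ?e) (Du z) - grushin_energy p \<gamma> z (Du z)\<bar> \<le> 0 * \<bar>t\<bar>)"
        unfolding grushin_energy_y_dir by simp
      show "AE z in lborel. z \<in> D \<longrightarrow> ((\<lambda>t. grushin_energy p \<gamma> (z + t *\<^sub>R ?e) (Du z)) has_real_derivative 0) (at 0)"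
        unfolding grushin_energy_y_dir by simp
      show "(\<lambda>z. indicator D z * 0 :: real) \<in> borel_measurable borel" "integrable lborel (\<lambda>_::(real ^ 'n) \<times> (real ^ 'm). 0 :: real)"
        by simp_all
    qed (fact p \<gamma> \<Omega> f u_sol u_C1 D u_boundary \<nu> \<sigma> norm_Basis[OF e] Fp(1)[OF e] Fp(2)[OF e])+
    note this[unfolded ze]
  }
  ultimately show ?thesis unfolding F_def by simp
qed

end
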